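(* Let $\mathfrak{M}$ be a smooth $n$-dimensional matchbox manifold which is homogeneous as a topological space, and suppose that $\mathfrak{M}$ embeds (topologically) in a closed orientable $(n+1)$-dimensional manifold. Then $\mathfrak{M}$ is a manifold.
   Context: Homogeneous: a topological space $X$ is homogeneous if for all $x,y\in X$ there is a homeomorphism $h\colon X\to X$ with $h(x)=y$. Foliated spaces: a continuum is a compact, connected, non-empty metrizable space. A continuum $\mathfrak{M}$ is a foliated space of dimension $n$ if there is a compact separable metric space $\mathfrak{X}$ and, for each $x\in\mathfrak{M}$, a compact subset $\mathfrak{T}_x\subset\mathfrak{X}$, an open set $U_x\subset\mathfrak{M}$ containing $x$, and a homeomorphism $\varphi_x\colon\overline{U}_x\to[-1,1]^n\times\mathfrak{T}_x$ with $\varphi_x(x)=(0,w_x)$, $w_x\in \mathrm{int}(\mathfrak{T}_x)$, and $U_x=\varphi_x^{-1}((-1,1)^n\times \mathrm{int}(\mathfrak{T}_x))$. Let $\pi_x\colon\overline{U}_x\to\mathfrak{T}_x$ be $\varphi_x$ followed by projection to the second factor. For $w\in\mathfrak{T}_x$ the plaque is $\mathcal{P}_x(w)=\pi_x^{-1}(w)$, with $\mathrm{int}(\mathcal{P}_x(w))=\varphi_x^{-1}((-1,1)^n\times\{w\})$, and for $z\in\overline{U}_x$ one writes $\mathcal{P}_x(z)=\mathcal{P}_x(\pi_x(z))$. It is required that for $z\in U_x\cap U_y$ the set $\mathrm{int}(\mathcal{P}_x(z))\cap \mathrm{int}(\mathcal{P}_y(z))$ is open in both $\mathcal{P}_x(z)$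 and $\mathcal{P}_y(z)$. Smoothness: the foliated space is smooth if the charts can be chosen such that whenever $z\in U_x\cap U_y$ there is an open set $V_z$ with $z\in V_z\subset U_x\cap U_y$, with $\mathcal{P}_x(z)\cap V_z$ and $\mathcal{P}_y(z)\cap V_z$ connected open sets, such that $\varphi_y\circ\varphi_x^{-1}\colon\varphi_x(\mathcal{P}_x(z)\cap V_z)\to\varphi_y(\mathcal{P}_y(z)\cap V_z)$ is a smooth map (between subsets of $\mathbb{R}^n\times\{w\}\cong\mathbb{R}^n$ and $\mathbb{R}^n\times\{w'\}\cong\mathbb{R}^n$), depending continuously on $z$ in the $C^\infty$-topology on maps. A matchbox manifold is a continuum with the structure of a smooth foliated space such that every $\mathfrak{T}_x$ is totally disconnected. A closed manifold is a compact manifold without boundary. *)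

theory Defs
  imports "HOL-Analysis.Analysis" "HOL-Homology.Homology"
begin

section \<open>Topological spaces\<close>

definition homogeneous_space :: "'a topology \<Rightarrow> bool" where
  "homogeneous_space X \<longleftrightarrow>
     (\<forall>x\<in>topspace X. \<forall>y\<in>topspace X. \<exists>h. homeomorphic_map X X h \<and> h x = y)"

definition totally_disconnected_space :: "'a topology \<Rightarrow> bool" where
  "totally_disconnected_space X \<longleftrightarrow> (\<forall>S. connectedin X S \<longrightarrow> (\<exists>a. S \<subseteq> {a}))"

definition continuum :: "'a topology \<Rightarrow> bool" where
  "continuum X \<longleftrightarrow>
     compact_space X \<and> connected_space X \<and> topspace X \<noteq> {} \<and> metrizable_space X"

section \<open>Topological manifolds and orientability\<close>

text \<open>Manifolds are topological and without boundary; they need not be connected.\<close>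

definition topological_manifold :: "nat \<Rightarrow> 'a topology \<Rightarrow> bool" where
  "topological_manifold m N \<longleftrightarrow>
     Hausdorff_space N \<and> second_countable N \<and>
     (\<forall>x\<in>topspace N. \<exists>W V. openin N W \<and> x \<in> W \<and> openin (Euclidean_space m) V \<and>
        subtopology N W homeomorphic_space subtopology (Euclidean_space m) V)"

definition closed_manifold :: "nat \<Rightarrow> 'a topology \<Rightarrow> bool" where
  "closed_manifold m N \<longleftrightarrow> topological_manifold m N \<and> compact_space N"

text \<open>
  An orientation of an \<open>m\<close>-manifold is a choice, at each point \<open>x\<close>, of a generator of the
  local homology group \<open>H\<^sub>m(N, N - x; \<int>)\<close> which is locally consistent: near any point the chosen
  generators are all restrictions of one class in \<open>H\<^sub>m(N, N - B; \<int>)\<close> for some open \<open>B\<close>.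
\<close>

definition orientation_of :: "nat \<Rightarrow> 'a topology \<Rightarrow> ('a \<Rightarrow> 'a chain set) \<Rightarrow> bool" where
  "orientation_of m N \<mu> \<longleftrightarrow>
     (\<forall>x\<in>topspace N.
        \<mu> x \<in> carrier (relative_homology_group (int m) N (topspace N - {x})) \<and>
        subgroup_generated (relative_homology_group (int m) N (topspace N - {x})) {\<mu> x} =
          relative_homology_group (int m) N (topspace N - {x})) \<and>
     (\<forall>x\<in>topspace N. \<exists>B. openin N B \<and> x \<in> B \<and>
        (\<exists>b\<in>carrier (relative_homology_group (int m) N (topspace N - B)). \<forall>y\<in>B.
           hom_induced (int m) N (topspace N - B) N (topspace N - {y}) id b = \<mu> y))"

definition orientable :: "nat \<Rightarrow> 'a topology \<Rightarrow> bool" where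
  "orientable m N \<longleftrightarrow> (\<exists>\<mu>. orientation_of m N \<mu>)"

section \<open>Smooth maps between subsets of Euclidean space\<close>

definition cube :: "nat \<Rightarrow> (nat \<Rightarrow> real) set" where
  "cube n = {u \<in> topspace (Euclidean_space n). \<forall>i<n. u i \<in> {-1..1}}"

definition open_cube :: "nat \<Rightarrow> (nat \<Rightarrow> real) set" where
  "open_cube n = {u \<in> topspace (Euclidean_space n). \<forall>i<n. u i \<in> {-1<..<1}}"

definition partial_deriv :: "nat \<Rightarrow> ((nat \<Rightarrow> real) \<Rightarrow> real) \<Rightarrow> (nat \<Rightarrow> real) \<Rightarrow> real" where
  "partial_deriv i g u = deriv (\<lambda>t. g (u(i := t))) (u i)"

fun iterated_partial :: "nat list \<Rightarrow> ((nat \<Rightarrow> real) \<Rightarrow> real) \<Rightarrow> (nat \<Rightarrow> real) \<Rightarrow> real" where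
  "iterated_partial [] g = g"
| "iterated_partial (i # is) g = partial_deriv i (iterated_partial is g)"

text \<open>\<open>C\<^sup>\<infinity>\<close> on an open set \<open>D\<close>: all iterated partial derivatives of all components
  exist and are continuous on \<open>D\<close>.\<close>

definition smooth_map_on ::
    "nat \<Rightarrow> (nat \<Rightarrow> real) set \<Rightarrow> ((nat \<Rightarrow> real) \<Rightarrow> (nat \<Rightarrow> real)) \<Rightarrow> bool" where
  "smooth_map_on n D f \<longleftrightarrow>
     openin (Euclidean_space n) D \<and>
     (\<forall>j<n. \<forall>is\<in>lists {..<n}.
        continuous_map (subtopology (Euclidean_space n) D) euclideanreal
          (iterated_partial is (\<lambda>v. f v j)) \<and>
        (\<forall>u\<in>D. \<forall>i<n.
           (\<lambda>t. iterated_partial is (\<lambda>v. f v j) (u(i := t))) differentiable (at (u i))))"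

text \<open>
  Continuity in the parameter \<open>z\<close> of a family of maps \<open>f z\<close>, defined on open sets \<open>D z\<close>, for the
  \<open>C\<^sup>\<infinity>\<close>-topology: near any parameter \<open>z\<^sub>0\<close>, any compact subset \<open>K\<close> of \<open>D z\<^sub>0\<close> lies in the
  domain of \<open>f z\<close>, and each partial derivative of \<open>f z\<close> is uniformly close to that of \<open>f z\<^sub>0\<close>
  on \<open>K\<close>.
\<close>

definition smooth_family_continuous ::
    "nat \<Rightarrow> 'p topology \<Rightarrow> ('p \<Rightarrow> (nat \<Rightarrow> real) set) \<Rightarrow>
     ('p \<Rightarrow> (nat \<Rightarrow> real) \<Rightarrow> (nat \<Rightarrow> real)) \<Rightarrow> bool" where
  "smooth_family_continuous n S D f \<longleftrightarrow>
     (\<forall>z0\<in>topspace S. \<forall>K. compactin (Euclidean_space n) K \<and> K \<subseteq> D z0 \<longrightarrow>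
       (\<forall>is\<in>lists {..<n}. \<forall>j<n. \<forall>\<epsilon>>0. \<exists>W. openin S W \<and> z0 \<in> W \<and>
         (\<forall>z\<in>W. K \<subseteq> D z \<and>
           (\<forall>u\<in>K. \<bar>iterated_partial is (\<lambda>v. f z v j) u
                    - iterated_partial is (\<lambda>v. f z0 v j) u\<bar> < \<epsilon>))))"

section \<open>Foliated spaces and matchbox manifolds\<close>

text \<open>
  \<open>M\<close> is the space and \<open>X\<close> the transverse model space; \<open>T x\<close>, \<open>U x\<close> and \<open>\<phi> x\<close> are the transversal,
  the open set and the chart at the point \<open>x\<close>, the chart being defined on the closure of \<open>U x\<close>.
\<close>

locale foliation_charts =
  fixes n :: nat
    and M :: "'a topology"
    and X :: "'x topology"
    and T :: "'a \<Rightarrow> 'x set"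
    and U :: "'a \<Rightarrow> 'a set"
    and \<phi> :: "'a \<Rightarrow> 'a \<Rightarrow> (nat \<Rightarrow> real) \<times> 'x"
begin

definition proj :: "'a \<Rightarrow> 'a \<Rightarrow> 'x" where
  "proj x z = snd (\<phi> x z)"

definition plaque :: "'a \<Rightarrow> 'x \<Rightarrow> 'a set" where
  "plaque x w = {z \<in> M closure_of U x. proj x z = w}"

definition plaque_interior :: "'a \<Rightarrow> 'x \<Rightarrow> 'a set" where
  "plaque_interior x w = {z \<in> M closure_of U x. \<phi> x z \<in> open_cube n \<times> {w}}"

definition plaque_at :: "'a \<Rightarrow> 'a \<Rightarrow> 'a set" where
  "plaque_at x z = plaque x (proj x z)"

definition plaque_interior_at :: "'a \<Rightarrow> 'a \<Rightarrow> 'a set" where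
  "plaque_interior_at x z = plaque_interior x (proj x z)"

definition transition :: "'a \<Rightarrow> 'a \<Rightarrow> (nat \<Rightarrow> real) \<times> 'x \<Rightarrow> (nat \<Rightarrow> real) \<times> 'x" where
  "transition x y p = \<phi> y (inv_into (M closure_of U x) (\<phi> x) p)"

text \<open>The transition map from the plaque of \<open>z\<close> in the chart at \<open>x\<close>, and its domain inside an
  open set \<open>V\<close>, read in the Euclidean coordinates.\<close>

definition leafwise_transition :: "'a \<Rightarrow> 'a \<Rightarrow> 'a \<Rightarrow> (nat \<Rightarrow> real) \<Rightarrow> (nat \<Rightarrow> real)" where
  "leafwise_transition x y z u = fst (transition x y (u, proj x z))"

definition leafwise_domain :: "'a \<Rightarrow> 'a set \<Rightarrow> 'a \<Rightarrow> (nat \<Rightarrow> real) set" where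
  "leafwise_domain x V z = fst ` \<phi> x ` (plaque_at x z \<inter> V)"

end

locale foliated_space = foliation_charts +
  assumes continuum: "continuum M"
    and model_metrizable: "metrizable_space X"
    and model_compact: "compact_space X"
    and model_separable: "separable_space X"
    and transversal_compact: "x \<in> topspace M \<Longrightarrow> compactin X (T x)"
    and nbhd_open: "x \<in> topspace M \<Longrightarrow> openin M (U x)"
    and nbhd_mem: "x \<in> topspace M \<Longrightarrow> x \<in> U x"
    and chart_homeomorphism: "x \<in> topspace M \<Longrightarrow>
      homeomorphic_map (subtopology M (M closure_of U x))
        (prod_topology (subtopology (Euclidean_space n) (cube n)) (subtopology X (T x))) (\<phi> x)"
    and chart_centre: "x \<in> topspace M \<Longrightarrow> \<exists>w \<in> X interior_of T x. \<phi> x x = (\<lambda>_. 0, w)"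
    and nbhd_eq: "x \<in> topspace M \<Longrightarrow>
      U x = {z \<in> M closure_of U x. \<phi> x z \<in> open_cube n \<times> (X interior_of T x)}"
    and plaques_compatible: "\<lbrakk>x \<in> topspace M; y \<in> topspace M; z \<in> U x \<inter> U y\<rbrakk> \<Longrightarrow>
      openin (subtopology M (plaque_at x z)) (plaque_interior_at x z \<inter> plaque_interior_at y z) \<and>
      openin (subtopology M (plaque_at y z)) (plaque_interior_at x z \<inter> plaque_interior_at y z)"

locale smooth_foliated_space = foliated_space +
  assumes smooth: "\<lbrakk>x \<in> topspace M; y \<in> topspace M; z \<in> U x \<inter> U y\<rbrakk> \<Longrightarrow>
    \<exists>V. openin M V \<and> z \<in> V \<and> V \<subseteq> U x \<inter> U y \<and>
      connectedin M (plaque_at x z \<inter> V) \<and>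
      openin (subtopology M (plaque_at x z)) (plaque_at x z \<inter> V) \<and>
      connectedin M (plaque_at y z \<inter> V) \<and>
      openin (subtopology M (plaque_at y z)) (plaque_at y z \<inter> V) \<and>
      transition x y \<in> \<phi> x ` (plaque_at x z \<inter> V) \<rightarrow> \<phi> y ` (plaque_at y z \<inter> V) \<and>
      smooth_map_on n (leafwise_domain x V z) (leafwise_transition x y z) \<and>
      smooth_family_continuous n (subtopology M V)
        (leafwise_domain x V) (leafwise_transition x y)"

locale matchbox_manifold = smooth_foliated_space +
  assumes transversal_totally_disconnected:
    "x \<in> topspace M \<Longrightarrow> totally_disconnected_space (subtopology X (T x))"

end

theory Submission
  imports Defs
begin

text \<open>
  If an open set lies in a single plaque, homogeneity spreads the resulting Euclidean chart over
  the whole space. Suppose there is no such open set. In small boxes of the ambient manifold each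
  plaque separates two fixed points \<open>q1\<close>, \<open>q2\<close>: by the Jordan-Brouwer theorem for one plaque, and
  by a stability argument of Borsuk type for all nearby ones. A path from \<open>q1\<close> to \<open>q2\<close> orders the
  plaques by their first hits, and the resulting betweenness relation, being given by separation,
  does not depend on the box.

  By Effros' theorem nearby points are matched by homeomorphisms close to the identity, and by
  connectedness every path component is dense. Since transversals are totally disconnected, some
  plaques \<open>a\<close> and \<open>b\<close> are adjacent and close; let \<open>h\<close> be a small homeomorphism with
  \<open>h a = b\<close>. The path component of \<open>a\<close> returns near \<open>a\<close> at a point \<open>p\<close> such that \<open>a\<close> lies between
  \<open>p\<close> and \<open>h p\<close>. Let \<open>g\<close> be a tiny homeomorphism with \<open>g p = a\<close>. Betweenness of \<open>x\<close>, \<open>g x\<close>, \<open>h x\<close> is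
  constant as \<open>x\<close> runs through a path component, hence \<open>g a\<close> lies between the adjacent
  \<open>a\<close> and \<open>b\<close>, a contradiction.
\<close>

section \<open>Small homeomorphisms of a homogeneous compact space\<close>

text \<open>The foliation does not extend to the ambient manifold, so the order between plaques has
  to come from separation alone. One plaque separates a box adapted to it, but ordering needs two
  points that all nearby plaques separate at once; hence a quantitative stability statement instead
  of a separation theorem used plaque by plaque. Hitting times depend on the path and its direction;
  betweenness does not, and it survives a change of box and transport along paths even where no
  global transverse order exists. The contradiction involves three scales. The scale on which boxes
  agree bounds the displacement of \<open>h\<close>. The gap above \<open>a\<close> holds only in a
  neighbourhood \<open>V\<close> of \<open>a\<close>, so the displacement of \<open>g\<close> is
  chosen afterwards, small enough that \<open>g a\<close> stays in \<open>V\<close>. The return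
  point \<open>p\<close> is taken within the Effros radius of that second displacement. That
  \<open>p\<close> can lie strictly below \<open>a\<close> while \<open>h p\<close> lies above it
  comes from \<open>a\<close> being the lower end of a gap: points near \<open>a\<close> have height
  at most that of \<open>a\<close>, and heights are constant on no open set.\<close>

lemma homeomorphic_map_inverse_obtain:
  assumes "homeomorphic_map X Y h"
  obtains k where "homeomorphic_map Y X k" "\<And>x. x \<in> topspace X \<Longrightarrow> k (h x) = x"
    "\<And>y. y \<in> topspace Y \<Longrightarrow> h (k y) = y"
proof -
  obtain k where "homeomorphic_maps X Y h k" using assms unfolding homeomorphic_map_maps by blast
  then show ?thesis using that unfolding homeomorphic_maps_map by metis
qed

context Metric_space
begin

section \<open>Homeomorphisms of a compact metric space and their uniform displacement\<close>

definition homeos :: "('a \<Rightarrow> 'a) set" where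
  "homeos = {h. homeomorphic_map mtopology mtopology h}"

text \<open>Strict pointwise bounds add under composition and pass to inverses, so they can stand in
  for a uniform metric on the homeomorphism group.\<close>

definition displacement_less :: "('a \<Rightarrow> 'a) \<Rightarrow> real \<Rightarrow> bool" where
  "displacement_less h e \<longleftrightarrow> (\<forall>p\<in>M. d (h p) p < e)"

lemma homeos_mem: "h \<in> homeos \<Longrightarrow> p \<in> M \<Longrightarrow> h p \<in> M"
  unfolding homeos_def
  by (metis homeomorphic_imp_surjective_map image_eqI mem_Collect_eq topspace_mtopology)

lemma homeos_comp: "g \<in> homeos \<Longrightarrow> h \<in> homeos \<Longrightarrow> g \<circ> h \<in> homeos"
  unfolding homeos_def by (auto intro: homeomorphic_map_compose)

lemma homeos_id: "id \<in> homeos"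
  by (simp add: homeos_def homeomorphic_map_id)

lemma homeos_inverse:
  assumes "h \<in> homeos"
  obtains k where "k \<in> homeos" "\<And>p. p \<in> M \<Longrightarrow> k (h p) = p" "\<And>p. p \<in> M \<Longrightarrow> h (k p) = p"
proof -
  obtain k where "homeomorphic_map mtopology mtopology k"
    "\<And>x. x \<in> topspace mtopology \<Longrightarrow> k (h x) = x" "\<And>y. y \<in> topspace mtopology \<Longrightarrow> h (k y) = y"
    using homeomorphic_map_inverse_obtain[of mtopology mtopology h] assms unfolding homeos_def by blast
  then show ?thesis using that unfolding homeos_def by simp
qed

lemma homeos_continuous: "h \<in> homeos \<Longrightarrow> continuous_map mtopology mtopology h"
  by (simp add: homeos_def homeomorphic_imp_continuous_map)

lemma displacement_less_comp:
  assumes "displacement_less g a" "displacement_less h b" "g \<in> homeos" "h \<in> homeos"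
  shows "displacement_less (g \<circ> h) (a + b)"
  unfolding displacement_less_def
proof
  fix p assume p: "p \<in> M"
  have "d (g (h p)) p \<le> d (g (h p)) (h p) + d (h p) p"
    using assms p homeos_mem triangle by metis
  also have "\<dots> < a + b"
    using assms p homeos_mem unfolding displacement_less_def by (meson add_strict_mono)
  finally show "d ((g \<circ> h) p) p < a + b" by simp
qed

lemma displacement_less_inverse:
  assumes "displacement_less g a" "g \<in> homeos" "k \<in> homeos" "\<And>p. p \<in> M \<Longrightarrow> g (k p) = p"
  shows "displacement_less k a"
  unfolding displacement_less_def
proof
  fix p assume p: "p \<in> M"
  have "d (g (k p)) (k p) < a"
    using assms p homeos_mem unfolding displacement_less_def by blast
  then show "d (k p) p < a" using assms(4)[OF p] commute by metis
qed

text \<open>Lebesgue number of the cover by preimages of balls of radius \<open>e/2\<close>: two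
  points in one preimage have images within \<open>e\<close> of each other.\<close>

lemma uniformly_continuous_compact:
  assumes "compact_space mtopology" "continuous_map mtopology mtopology h" "0 < e"
  obtains r where "0 < r" "\<And>p q. p \<in> M \<Longrightarrow> q \<in> M \<Longrightarrow> d p q < r \<Longrightarrow> d (h p) (h q) < e"
proof -
  define C where "C = (\<lambda>y. {x \<in> M. h x \<in> mball y (e/2)}) ` M"
  have hM: "h x \<in> M" if "x \<in> M" for x
    using assms(2) that unfolding continuous_map_def by auto
  have "openin mtopology U" if U: "U \<in> C" for U
  proof -
    obtain y where "U = {x \<in> topspace mtopology. h x \<in> mball y (e/2)}" using U unfolding C_def by auto
    then show ?thesis using openin_continuous_map_preimage[OF assms(2) openin_mball] by metis
  qed
  moreover have "M \<subseteq> \<Union>C"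
  proof
    fix x assume "x \<in> M"
    then show "x \<in> \<Union>C"
      unfolding C_def UN_iff using hM[of x] assms(3) by (intro bexI[of _ "h x"]) simp_all
  qed
  moreover have "compactin mtopology M"
    using assms(1) by (simp add: compact_space_def)
  ultimately obtain r where r: "r > 0" "\<And>x. x \<in> M \<Longrightarrow> \<exists>U\<in>C. mball x r \<subseteq> U"
    using lebesgue_number by meson
  show ?thesis
  proof
    fix p q assume pq: "p \<in> M" "q \<in> M" "d p q < r"
    then obtain y where y: "y \<in> M" "mball p r \<subseteq> {x \<in> M. h x \<in> mball y (e/2)}"
      using r(2)[of p] unfolding C_def by auto
    have "p \<in> mball p r" "q \<in> mball p r" using pq r(1) by auto
    then have "p \<in> {x \<in> M. h x \<in> mball y (e/2)}" "q \<in> {x \<in> M. h x \<in> mball y (e/2)}" using y(2) by blast+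
    then have "d y (h p) < e/2" "d y (h q) < e/2" by auto
    then show "d (h p) (h q) < e"
      using triangle''[of "h p" y "h q"] hM pq y(1) by force
  qed (use r in auto)
qed

text \<open>Separability of the homeomorphism group in the uniform metric. A homeomorphism is coded
  by a mesh \<open>1 / Suc n\<close> below which it oscillates by less than \<open>e/4\<close>, and
  by the finite relation recording which points of a finite net \<open>B\<close> lie close to the
  images of the points of the net \<open>A n\<close>. There are countably many codes, and two
  homeomorphisms sharing a code are uniformly \<open>e\<close>-close.\<close>

lemma homeos_countable_net:
  assumes cs: "compact_space mtopology" and e: "0 < e"
  obtains S where "countable S" "S \<subseteq> homeos"
    "\<And>h. h \<in> homeos \<Longrightarrow> \<exists>s\<in>S. \<forall>p\<in>M. d (h p) (s p) < e"
proof -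
  have tb: "mtotally_bounded M"
    using cs compact_space_eq_mcomplete_mtotally_bounded by auto
  have "\<exists>A. finite A \<and> A \<subseteq> M \<and> M \<subseteq> (\<Union>a\<in>A. mball a r)" if "r > 0" for r
    using tb that unfolding mtotally_bounded_def by blast
  then have "\<forall>n. \<exists>A. finite A \<and> A \<subseteq> M \<and> M \<subseteq> (\<Union>a\<in>A. mball a (1 / real (Suc n)))"
    by simp
  then obtain A where A: "\<And>n. finite (A n)" "\<And>n. A n \<subseteq> M" "\<And>n. M \<subseteq> (\<Union>a\<in>A n. mball a (1 / real (Suc n)))"
    by metis
  obtain B where B: "finite B" "B \<subseteq> M" "M \<subseteq> (\<Union>a\<in>B. mball a (e/4))"
    using tb e unfolding mtotally_bounded_def by (metis divide_pos_pos zero_less_numeral)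
  define R where "R h c \<longleftrightarrow> h \<in> homeos \<and>
      (\<forall>p\<in>M. \<forall>q\<in>M. d p q < 1 / real (Suc (fst c)) \<longrightarrow> d (h p) (h q) < e/4) \<and>
      (\<forall>a\<in>A (fst c). \<exists>b. (a,b) \<in> snd c) \<and> (\<forall>(a,b)\<in>snd c. d (h a) b < e/4)" for h and c :: "nat \<times> ('a \<times> 'a) set"
  define K where "K = (SIGMA n:UNIV. Pow (A n \<times> B))"
  have cK: "countable K"
    unfolding K_def using A(1) B(1) by (intro countable_SIGMA) (auto intro: countable_finite)
  define S where "S = (\<lambda>c. SOME h. R h c) ` {c \<in> K. \<exists>h. R h c}"
  show ?thesis
  proof
    show "countable S" unfolding S_def using cK by auto
    show "S \<subseteq> homeos"
    proof
      fix s assume "s \<in> S"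
      then obtain c where "\<exists>h. R h c" "s = (SOME h. R h c)" unfolding S_def by blast
      then have "R s c" by (metis someI_ex)
      then show "s \<in> homeos" unfolding R_def by blast
    qed
    fix h assume h: "h \<in> homeos"
    obtain r where r: "r > 0" "\<And>p q. p \<in> M \<Longrightarrow> q \<in> M \<Longrightarrow> d p q < r \<Longrightarrow> d (h p) (h q) < e/4"
      using uniformly_continuous_compact[OF cs homeos_continuous[OF h], of "e/4"] e by auto
    obtain n where n: "1 / real (Suc n) < r" using r(1) nat_approx_posE by blast
    define G where "G = {(a,b). a \<in> A n \<and> b \<in> B \<and> d (h a) b < e/4}"
    have "(n,G) \<in> K" unfolding K_def G_def by auto
    moreover have "R h (n,G)"
      unfolding R_def
    proof (intro conjI ballI impI)
      show "d (h p) (h q) < e/4" if "p \<in> M" "q \<in> M" "d p q < 1 / real (Suc (fst (n,G)))" for p q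
        using r n that by auto
      show "\<exists>b. (a,b) \<in> snd (n,G)" if "a \<in> A (fst (n,G))" for a
      proof -
        have "a \<in> M" using A(2) that by auto
        then have "h a \<in> M" using homeos_mem[OF h] by simp
        then obtain b where "b \<in> B" "d b (h a) < e/4" using B(3) by auto
        then show ?thesis using that by (auto simp: G_def commute)
      qed
    qed (use h in \<open>auto simp: G_def\<close>)
    ultimately have s: "R (SOME h. R h (n,G)) (n,G)" "(SOME h. R h (n,G)) \<in> S"
      unfolding S_def by (auto intro: someI[of "\<lambda>h. R h (n,G)"])
    let ?s = "SOME h. R h (n,G)"
    \<comment> \<open>Four quarters of \<open>e\<close> along \<open>h p\<close>,
      \<open>h a\<close>, \<open>b\<close>, \<open>?s a\<close>, \<open>?s p\<close>: the common
      mesh gives the outer two, the common pair \<open>(a,b)\<close> the inner two.\<close>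
    have "d (h p) (?s p) < e" if p: "p \<in> M" for p
    proof -
      obtain a where a: "a \<in> A n" "a \<in> M" "d a p < 1 / real (Suc n)" using A(3)[of n] p by auto
      obtain b where ab: "(a,b) \<in> G" using s(1) a unfolding R_def by auto
      then have bM: "b \<in> M" using B(2) unfolding G_def by auto
      have 1: "d (h p) (h a) < e/4" using a p n r(2)[of p a] by (simp add: commute)
      have 2: "d (h a) b < e/4" using ab unfolding G_def by auto
      have 3: "d (?s a) b < e/4" "d (?s a) (?s p) < e/4" and sh: "?s \<in> homeos"
        using s(1) ab a p unfolding R_def by auto
      have mem: "h p \<in> M" "h a \<in> M" "?s a \<in> M" "?s p \<in> M" using p a h sh homeos_mem by auto
      have "d (h p) b < e/2" using 1 2 triangle[of "h p" "h a" b] mem bM by linarith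
      moreover have "d b (?s p) < e/2" using 3 triangle''[of b "?s a" "?s p"] mem bM by linarith
      ultimately show ?thesis using triangle[of "h p" b "?s p"] mem bM by linarith
    qed
    then show "\<exists>s\<in>S. \<forall>p\<in>M. d (h p) (s p) < e" using s(2) by blast
  qed
qed

section \<open>Effros' theorem\<close>

lemma homogeneous_homeos:
  assumes "homogeneous_space mtopology" "x \<in> M" "y \<in> M"
  obtains h where "h \<in> homeos" "h x = y"
  using assms unfolding homogeneous_space_def homeos_def by auto

text \<open>Baire category. The preimages \<open>V s\<close> of the closure of a small orbit, for
  \<open>s\<close> in a countable net, are closed and cover the space, because some \<open>s\<close>
  approximates the inverse of a homeomorphism carrying \<open>x\<close> to a given \<open>y\<close>.
  One of them has interior, so the closure of the orbit contains an open set; this meets the orbit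
  at some \<open>g x\<close>, and the inverse of \<open>g\<close> moves it to a neighbourhood of
  \<open>x\<close> at the price of doubling the displacement.\<close>

lemma small_orbit_closure_nbhd:
  assumes cs: "compact_space mtopology" and hom: "homogeneous_space mtopology"
    and x: "x \<in> M" and e: "0 < e"
  obtains r where "0 < r"
    "mball x r \<subseteq> mtopology closure_of {h x |h. h \<in> homeos \<and> displacement_less h e}"
proof -
  let ?O = "{h x |h. h \<in> homeos \<and> displacement_less h (e/2)}"
  obtain S where S: "countable S" "S \<subseteq> homeos"
    "\<And>h. h \<in> homeos \<Longrightarrow> \<exists>s\<in>S. \<forall>p\<in>M. d (h p) (s p) < e/2"
    using homeos_countable_net[OF cs, of "e/2"] e by auto
  define V where "V s = {p \<in> M. s p \<in> mtopology closure_of ?O}" for s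
  have Oin: "?O \<subseteq> M" using x homeos_mem by auto
  have Vcl: "closedin mtopology (V s)" if "s \<in> S" for s
    using closedin_continuous_map_preimage[OF homeos_continuous[of s] closedin_closure_of] that S(2)
    unfolding V_def by auto
  have cover: "M \<subseteq> \<Union>(V ` S)"
  proof
    fix y assume y: "y \<in> M"
    obtain h where h: "h \<in> homeos" "h x = y" using homogeneous_homeos[OF hom x y] by blast
    obtain k where k: "k \<in> homeos" "\<And>p. p \<in> M \<Longrightarrow> k (h p) = p" "\<And>p. p \<in> M \<Longrightarrow> h (k p) = p"
      using homeos_inverse[OF h(1)] by blast
    obtain s where s: "s \<in> S" "\<forall>p\<in>M. d (k p) (s p) < e/2" using S(3)[OF k(1)] by auto
    have sh: "s \<in> homeos" using s S by auto
    have "displacement_less (s \<circ> h) (e/2)"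
      unfolding displacement_less_def
    proof
      fix p assume p: "p \<in> M"
      have "d (k (h p)) (s (h p)) < e/2" using s(2) homeos_mem[OF h(1) p] by auto
      then show "d ((s \<circ> h) p) p < e/2" using k(2)[OF p] by (simp add: commute)
    qed
    then have "s y \<in> ?O" using h homeos_comp[OF sh h(1)] by (auto intro!: exI[of _ "s \<circ> h"])
    then have "s y \<in> mtopology closure_of ?O"
      using Oin closure_of_subset[of ?O mtopology] by auto
    then show "y \<in> \<Union>(V ` S)" using s(1) y unfolding V_def by auto
  qed
  have "\<exists>s\<in>S. mtopology interior_of (V s) \<noteq> {}"
  proof (rule ccontr)
    assume "\<not> ?thesis"
    then have "mtopology interior_of \<Union>(V ` S) = {}"
      using metric_Baire_category_alt[OF compact_space_imp_mcomplete[OF cs], of "V ` S"] Vcl S(1) by auto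
    moreover have "\<Union>(V ` S) = M" using cover unfolding V_def by auto
    ultimately show False using x interior_of_topspace[of mtopology] by auto
  qed
  then obtain s where s: "s \<in> S" "mtopology interior_of (V s) \<noteq> {}" by auto
  have sh: "s \<in> homeos" using s S by auto
  then have hs: "homeomorphic_map mtopology mtopology s" unfolding homeos_def by simp
  define W where "W = s ` (mtopology interior_of (V s))"
  have W: "openin mtopology W" "W \<noteq> {}" "W \<subseteq> mtopology closure_of ?O"
  proof -
    show "openin mtopology W" unfolding W_def
      by (metis openin_interior_of homeomorphic_map_openness_eq[OF hs])
    show "W \<noteq> {}" using s unfolding W_def by auto
    show "W \<subseteq> mtopology closure_of ?O" using interior_of_subset[of mtopology "V s"] unfolding W_def V_def by auto
  qed
  then have "W \<inter> ?O \<noteq> {}" using openin_Int_closure_of_eq_empty[OF W(1), of ?O] by auto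
  then obtain g where g: "g \<in> homeos" "displacement_less g (e/2)" "g x \<in> W" by auto
  obtain k where k: "k \<in> homeos" "\<And>p. p \<in> M \<Longrightarrow> k (g p) = p" "\<And>p. p \<in> M \<Longrightarrow> g (k p) = p"
    using homeos_inverse[OF g(1)] by blast
  have hk: "homeomorphic_map mtopology mtopology k" using k unfolding homeos_def by simp
  have kd: "displacement_less k (e/2)" using displacement_less_inverse[OF g(2,1) k(1,3)] .
  have "openin mtopology (k ` W)" using W(1) by (metis homeomorphic_map_openness_eq[OF hk])
  moreover have "x \<in> k ` W" using g(3) k(2)[OF x] by force
  ultimately obtain r where r: "r > 0" "mball x r \<subseteq> k ` W"
    unfolding openin_mtopology by auto
  have "k ` W \<subseteq> k ` (mtopology closure_of ?O)" using W(3) by auto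
  also have "\<dots> = mtopology closure_of (k ` ?O)"
    using homeomorphic_map_closure_of[OF hk] Oin by auto
  also have "\<dots> \<subseteq> mtopology closure_of {h x |h. h \<in> homeos \<and> displacement_less h e}"
  proof (rule closure_of_mono, safe)
    fix h assume h: "h \<in> homeos" "displacement_less h (e/2)"
    show "\<exists>h'. k (h x) = h' x \<and> h' \<in> homeos \<and> displacement_less h' e"
      using homeos_comp[OF k(1) h(1)] displacement_less_comp[OF kd h(2) k(1) h(1)]
      by (intro exI[of _ "k \<circ> h"]) auto
  qed
  finally show ?thesis using that r by blast
qed

text \<open>Each \<open>g k\<close> keeps points at distance at least \<open>(1/2)^k\<close> at
  least \<open>a k\<close> apart, while all later changes together move a point by at most
  \<open>a k / 4\<close>; so the limit cannot identify two points. It is surjective because its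
  image is compact and dense.\<close>

lemma homeos_uniform_limit:
  assumes cs: "compact_space mtopology"
    and g: "\<And>k. g k \<in> homeos" and a: "\<And>k. 0 < a k" "\<And>k. a (Suc k) \<le> a k / 2"
    and step: "\<And>k p. p \<in> M \<Longrightarrow> d (g (Suc k) p) (g k p) < a k / 8"
    and modulus: "\<And>k p q. p \<in> M \<Longrightarrow> q \<in> M \<Longrightarrow> d (g k p) (g k q) < a k \<Longrightarrow> d p q < (1/2)^k"
  obtains G where "G \<in> homeos" "\<And>k p. p \<in> M \<Longrightarrow> d (G p) (g k p) \<le> a k / 4"
proof -
  have gM: "g k p \<in> M" if "p \<in> M" for k p using homeos_mem[OF g that] .
  \<comment> \<open>The remaining tolerance is subtracted so that the induction closes: a step of
    one eighth of \<open>a (k+j)\<close> is paid for by the halving of \<open>a\<close>.\<close>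
  have tail: "d (g (k + j) p) (g k p) \<le> a k / 4 - a (k+j) / 4" if p: "p \<in> M" for k j p
  proof (induction j)
    case 0
    then show ?case using gM p by simp
  next
    case (Suc j)
    have "d (g (k + Suc j) p) (g k p) \<le> d (g (Suc (k + j)) p) (g (k+j) p) + d (g (k+j) p) (g k p)"
      using triangle gM p by simp
    also have "\<dots> \<le> a (k+j) / 8 + (a k / 4 - a (k+j) / 4)"
      using step[OF p, of "k+j"] Suc by linarith
    also have "\<dots> \<le> a k / 4 - a (k + Suc j) / 4"
      using a(2)[of "k+j"] by simp
    finally show ?case .
  qed
  have tail': "d (g m p) (g k p) \<le> a k / 4" if p: "p \<in> M" and "k \<le> m" for k m p
    using tail[OF p, of k "m-k"] that(2) a(1)[of m] by simp
  have alim: "a k \<le> a 0 * (1/2)^k" for k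
  proof (induction k)
    case (Suc k)
    then show ?case using a(2)[of k] by simp
  qed simp
  have small: "\<exists>k. a k < e" if "e > 0" for e
  proof -
    have "(\<lambda>k. a 0 * (1/2)^k) \<longlonglongrightarrow> 0"
      by (intro tendsto_mult_right_zero LIMSEQ_power_zero) auto
    then have "\<forall>\<^sub>F k in sequentially. a 0 * (1/2)^k < e"
      using that order_tendstoD(2) by blast
    then show ?thesis using alim by (meson eventually_sequentially le_less_trans order_refl)
  qed
  have cauchy: "MCauchy (\<lambda>k. g k p)" if p: "p \<in> M" for p
    unfolding MCauchy_def
  proof (intro conjI strip)
    show "range (\<lambda>k. g k p) \<subseteq> M" using gM p by auto
    fix e :: real assume "e > 0"
    then obtain N where N: "a N < e" using small by blast
    show "\<exists>N. \<forall>n n'. N \<le> n \<longrightarrow> N \<le> n' \<longrightarrow> d (g n p) (g n' p) < e"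
    proof (intro exI[of _ N] strip)
      fix n n' assume "N \<le> n" "N \<le> n'"
      then have "d (g n p) (g N p) \<le> a N / 4" "d (g n' p) (g N p) \<le> a N / 4" using tail' p by auto
      moreover have "d (g n p) (g n' p) \<le> d (g n p) (g N p) + d (g n' p) (g N p)"
        using triangle' gM[OF p] by blast
      ultimately show "d (g n p) (g n' p) < e"
        using N a(1)[of N] by linarith
    qed
  qed
  have "\<exists>l. limitin mtopology (\<lambda>k. g k p) l sequentially" if p: "p \<in> M" for p
    using compact_space_imp_mcomplete[OF cs] cauchy[OF p] unfolding mcomplete_def by blast
  then obtain G where G: "\<And>p. p \<in> M \<Longrightarrow> limitin mtopology (\<lambda>k. g k p) (G p) sequentially"
    by metis
  have GM: "G p \<in> M" if "p \<in> M" for p using G[OF that] limitin_mspace by blast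
  have close: "d (G p) (g k p) \<le> a k / 4" if p: "p \<in> M" for k p
  proof (rule field_le_epsilon)
    fix e :: real assume "e > 0"
    then obtain m where m: "m \<ge> k" "d (g m p) (G p) < e"
      using G[OF p] unfolding limit_metric_sequentially by (meson linorder_le_cases)
    show "d (G p) (g k p) \<le> a k / 4 + e"
      using triangle''[of "G p" "g m p" "g k p"] m tail'[OF p m(1)] gM p GM by force
  qed
  have contG: "continuous_map mtopology mtopology G"
  proof (rule continuous_map_uniform_limit_alt[where f = g and F = sequentially])
    show "\<forall>\<^sub>F k in sequentially. continuous_map mtopology mtopology (g k)"
      using g homeos_continuous by auto
    show "G \<in> topspace mtopology \<rightarrow> M" using GM by auto
    fix e :: real assume "e > 0"
    then obtain N where N: "a N < e" using small by blast
    have "d (g k p) (G p) < e" if "k \<ge> N" "p \<in> M" for k p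
    proof -
      have "a k \<le> a N" using that(1)
      proof (induction rule: dec_induct)
        case (step n)
        then show ?case using a(1)[of n] a(2)[of n] by linarith
      qed simp
      then show ?thesis using close[OF that(2), of k] N a(1)[of k] commute[of "G p" "g k p"] by linarith
    qed
    then show "\<forall>\<^sub>F k in sequentially. \<forall>x\<in>topspace mtopology. d (g k x) (G x) < e"
      unfolding eventually_sequentially by auto
  qed auto
  have inj: "inj_on G M"
  proof (rule inj_onI, rule ccontr)
    fix p q assume pq: "p \<in> M" "q \<in> M" "G p = G q" "p \<noteq> q"
    then have "d p q > 0" by simp
    then obtain k where k: "(1/2)^k < d p q" using real_arch_pow_inv[of "d p q" "1/2"] by auto
    have "d (g k p) (g k q) \<le> d (G p) (g k p) + d (G p) (g k q)"
      using triangle''[of "g k p" "G p" "g k q"] gM GM pq by auto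
    also have "\<dots> \<le> a k / 2" using close[OF pq(1), of k] close[OF pq(2), of k] unfolding pq(3) by linarith
    also have "\<dots> < a k" using a(1) by simp
    finally show False using modulus[OF pq(1,2), of k] k by linarith
  qed
  have surj: "M \<subseteq> G ` M"
  proof
    fix y assume y: "y \<in> M"
    have "compactin mtopology (G ` M)"
      using image_compactin[OF _ contG, of M] cs[unfolded compact_space_def] by simp
    then have "closedin mtopology (G ` M)"
      using compactin_imp_closedin Hausdorff_space_mtopology by blast
    moreover have "y \<in> mtopology closure_of (G ` M)"
      unfolding metric_closure_of
    proof (clarsimp simp: y)
      fix r :: real assume "0 < r"
      then obtain k where k: "a k < r" using small by blast
      obtain u where u: "u \<in> homeos" "\<And>p. p \<in> M \<Longrightarrow> u (g k p) = p" "\<And>p. p \<in> M \<Longrightarrow> g k (u p) = p"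
        using homeos_inverse[OF g[of k]] by metis
      have uM: "u y \<in> M" using homeos_mem u y by blast
      \<comment> \<open>\<open>u\<close> inverts \<open>g k\<close>, so the limit map sends
        \<open>u y\<close> almost to \<open>g k (u y) = y\<close>.\<close>
      have "d y (G (u y)) \<le> a k / 4" using close[OF uM, of k] u(3)[OF y] by (simp add: commute)
      then have "d y (G (u y)) < r" using k a(1)[of k] by linarith
      then show "\<exists>z\<in>M. G z \<in> M \<and> d y (G z) < r" using uM GM by blast
    qed
    ultimately show "y \<in> G ` M" by (simp add: closure_of_closedin)
  qed
  have "homeomorphic_map mtopology mtopology G"
    using continuous_imp_homeomorphic_map[OF contG cs Hausdorff_space_mtopology] inj surj GM by auto
  then show ?thesis using that close unfolding homeos_def by blast
qed

text \<open>Density of small orbits is not transitivity, so both points are moved. Homeomorphisms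
  \<open>g k\<close> and \<open>f k\<close> are corrected alternately, bringing \<open>g k x\<close>
  and \<open>f k y\<close> together by displacements too small to spoil the moduli reached so far.
  The limits satisfy \<open>G x = H y\<close>, and \<open>G\<close> followed by the inverse of
  \<open>H\<close> carries \<open>x\<close> to \<open>y\<close>.\<close>

lemma effros_pointwise:
  assumes cs: "compact_space mtopology" and hom: "homogeneous_space mtopology"
    and x: "x \<in> M" and e: "0 < e"
  obtains r where "0 < r"
    "\<And>y. y \<in> M \<Longrightarrow> d x y < r \<Longrightarrow> \<exists>h\<in>homeos. h x = y \<and> displacement_less h e"
proof -
  define Orb where "Orb p c = {h p |h. h \<in> homeos \<and> displacement_less h c}" for p c
  have "\<exists>r. 0 < r \<and> mball p r \<subseteq> mtopology closure_of (Orb p c)" if "p \<in> M" "0 < c" for p c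
    unfolding Orb_def by (rule small_orbit_closure_nbhd[OF cs hom that]) blast
  then obtain \<rho> where \<rho>: "\<And>p c. p \<in> M \<Longrightarrow> 0 < c \<Longrightarrow> 0 < \<rho> p c"
    "\<And>p c. p \<in> M \<Longrightarrow> 0 < c \<Longrightarrow> mball p (\<rho> p c) \<subseteq> mtopology closure_of (Orb p c)"
    by metis
  have approx: "\<exists>h\<in>homeos. displacement_less h c \<and> d (h p) q < s"
    if that5: "p \<in> M" "q \<in> M" "d p q < \<rho> p c" "0 < c" "0 < s" for p q c s
  proof -
    have "q \<in> mtopology closure_of (Orb p c)"
      using \<rho>(2)[OF that5(1,4)] that5 by auto
    then obtain z where "z \<in> Orb p c" "d q z < s"
      using that5(5) unfolding metric_closure_of by auto
    then show ?thesis unfolding Orb_def by (auto simp: commute)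
  qed
  have modulus: "\<exists>b. 0 < b \<and> b \<le> c \<and> (\<forall>p\<in>M. \<forall>q\<in>M. d (h p) (h q) < b \<longrightarrow> d p q < s)"
    if m: "h \<in> homeos" "0 < c" "0 < s" for h c s
  proof -
    obtain k where k: "k \<in> homeos" "\<And>p. p \<in> M \<Longrightarrow> k (h p) = p" "\<And>p. p \<in> M \<Longrightarrow> h (k p) = p"
      using homeos_inverse[OF m(1)] by blast
    obtain r where r: "0 < r" "\<And>p q. p \<in> M \<Longrightarrow> q \<in> M \<Longrightarrow> d p q < r \<Longrightarrow> d (k p) (k q) < s"
      using uniformly_continuous_compact[OF cs homeos_continuous[OF k(1)] m(3)] by blast
    show ?thesis
    proof (intro exI[of _ "min c r"] conjI ballI impI)
      fix p q assume "p \<in> M" "q \<in> M" "d (h p) (h q) < min c r"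
      then show "d p q < s" using r(2)[of "h p" "h q"] homeos_mem[OF m(1)] k(2) by simp
    qed (use r m in auto)
  qed
  \<comment> \<open>The cap at 1 makes the identity with tolerance \<open>c\<close> a legal initial
    state, since the modulus at stage 0 asks for distance below \<open>(1/2)^0\<close>. It also
    bounds the tolerances of stage \<open>k\<close> by \<open>(1/2)^k\<close>.\<close>
  define c where "c = min e 1"
  have c: "0 < c" "c \<le> 1" "c \<le> e" using e by (auto simp: c_def)
  have main: "\<exists>h\<in>homeos. h x = y \<and> displacement_less h e" if y: "y \<in> M" and near: "d x y < \<rho> x (c/8)" for y
  proof -
    \<comment> \<open>\<open>a\<close> and \<open>b\<close> are the tolerances within which
      \<open>g\<close> and \<open>f\<close> may still change. The last clause puts
      \<open>f y\<close> into the ball around \<open>g x\<close> in which the orbit of displacement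
      \<open>a/8\<close> is dense, so that the next correction is possible.\<close>
    define P where "P k s \<longleftrightarrow> (case s of (g, f, a, b) \<Rightarrow> g \<in> homeos \<and> f \<in> homeos \<and> 0 < a \<and> 0 < b \<and>
        (\<forall>p\<in>M. \<forall>q\<in>M. d (g p) (g q) < a \<longrightarrow> d p q < (1/2)^k) \<and>
        (\<forall>p\<in>M. \<forall>q\<in>M. d (f p) (f q) < b \<longrightarrow> d p q < (1/2)^k) \<and>
        d (g x) (f y) < \<rho> (g x) (a/8))" for k :: nat and s :: "('a \<Rightarrow> 'a) \<times> ('a \<Rightarrow> 'a) \<times> real \<times> real"
    define Q where "Q k s s' \<longleftrightarrow> (case s of (g, f, a, b) \<Rightarrow> case s' of (g', f', a', b') \<Rightarrow>
        (\<forall>p\<in>M. d (g' p) (g p) < a/8) \<and> (\<forall>p\<in>M. d (f' p) (f p) < b/8) \<and>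
        a' \<le> a/2 \<and> b' \<le> b/2 \<and> d (f' y) (g' x) < (1/2)^k)"
        for k :: nat and s s' :: "('a \<Rightarrow> 'a) \<times> ('a \<Rightarrow> 'a) \<times> real \<times> real"
    have "\<exists>F. F 0 = (id, id, c, c) \<and> (\<forall>k. P k (F k)) \<and> (\<forall>k. Q k (F k) (F (Suc k)))"
    proof (rule dependent_nat_choice[where P = "\<lambda>k s. P k s \<and> (k = 0 \<longrightarrow> s = (id, id, c, c))" and Q = Q, THEN exE])
      show "\<exists>s. P 0 s \<and> ((0::nat) = 0 \<longrightarrow> s = (id, id, c, c))"
        unfolding P_def using c near homeos_id by auto
      fix s and k :: nat
      assume "P k s \<and> (k = 0 \<longrightarrow> s = (id, id, c, c))"
      then obtain g f a b where s: "s = (g,f,a,b)" and gf: "g \<in> homeos" "f \<in> homeos" "0 < a" "0 < b"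
        and near: "d (g x) (f y) < \<rho> (g x) (a/8)"
        unfolding P_def by (cases s) auto
      have gx: "g x \<in> M" and fy: "f y \<in> M" using homeos_mem gf x y by auto
      obtain u where u: "u \<in> homeos" "displacement_less u (a/8)" "d (u (g x)) (f y) < \<rho> (f y) (b/8)"
        using approx[OF gx fy near] \<rho>(1)[OF fy, of "b/8"] gf by auto
      define g' where "g' = u \<circ> g"
      have g': "g' \<in> homeos" unfolding g'_def using homeos_comp u gf by blast
      have g'x: "g' x \<in> M" using homeos_mem g' x by auto
      obtain a' where a': "0 < a'" "a' \<le> a/2" "\<forall>p\<in>M. \<forall>q\<in>M. d (g' p) (g' q) < a' \<longrightarrow> d p q < (1/2)^(Suc k)"
        using modulus[OF g', of "a/2" "(1/2)^(Suc k)"] gf by auto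
      have "d (f y) (g' x) < \<rho> (f y) (b/8)" using u(3) by (simp add: g'_def commute)
      \<comment> \<open>Of the two bounds in the minimum, one restores the invariant for the next
        round and the other forces the two limits to agree.\<close>
      then obtain v where v: "v \<in> homeos" "displacement_less v (b/8)"
        "d (v (f y)) (g' x) < min (\<rho> (g' x) (a'/8)) ((1/2)^k)"
        using approx[OF fy g'x, of "b/8" "min (\<rho> (g' x) (a'/8)) ((1/2)^k)"] \<rho>(1)[OF g'x, of "a'/8"] gf a' by auto
      define f' where "f' = v \<circ> f"
      have f': "f' \<in> homeos" unfolding f'_def using homeos_comp v gf by blast
      obtain b' where b': "0 < b'" "b' \<le> b/2" "\<forall>p\<in>M. \<forall>q\<in>M. d (f' p) (f' q) < b' \<longrightarrow> d p q < (1/2)^(Suc k)"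
        using modulus[OF f', of "b/2" "(1/2)^(Suc k)"] gf by auto
      have 1: "P (Suc k) (g',f',a',b')"
        unfolding P_def using g' f' a' b' v(3) commute[of "g' x" "f' y"] by (auto simp: f'_def)
      have 2: "Q k s (g',f',a',b')"
        unfolding Q_def s using u v a' b' homeos_mem gf
        by (auto simp: f'_def g'_def displacement_less_def)
      show "\<exists>s'. (P (Suc k) s' \<and> (Suc k = 0 \<longrightarrow> s' = (id, id, c, c))) \<and> Q k s s'"
        using 1 2 by blast
    qed blast
    then obtain F where F: "F 0 = (id, id, c, c)" "\<And>k. P k (F k)" "\<And>k. Q k (F k) (F (Suc k))" by blast
    define g where "g k = fst (F k)" for k
    define f where "f k = fst (snd (F k))" for k
    define a where "a k = fst (snd (snd (F k)))" for k
    define b where "b k = snd (snd (snd (F k)))" for k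
    have Fk: "F k = (g k, f k, a k, b k)" for k by (simp add: g_def f_def a_def b_def)
    have P: "g k \<in> homeos" "f k \<in> homeos" "0 < a k" "0 < b k"
        "\<And>p q. p \<in> M \<Longrightarrow> q \<in> M \<Longrightarrow> d (g k p) (g k q) < a k \<Longrightarrow> d p q < (1/2)^k"
        "\<And>p q. p \<in> M \<Longrightarrow> q \<in> M \<Longrightarrow> d (f k p) (f k q) < b k \<Longrightarrow> d p q < (1/2)^k" for k
      using F(2)[of k] unfolding P_def Fk by auto
    have Q: "\<And>p. p \<in> M \<Longrightarrow> d (g (Suc k) p) (g k p) < a k/8" "\<And>p. p \<in> M \<Longrightarrow> d (f (Suc k) p) (f k p) < b k/8"
        "a (Suc k) \<le> a k/2" "b (Suc k) \<le> b k/2" "d (f (Suc k) y) (g (Suc k) x) < (1/2)^k" for k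
      using F(3)[of k] unfolding Q_def Fk by auto
    have z: "g 0 = id" "f 0 = id" "a 0 = c" "b 0 = c" using F(1) unfolding Fk by auto
    obtain G where G: "G \<in> homeos" "\<And>k p. p \<in> M \<Longrightarrow> d (G p) (g k p) \<le> a k / 4"
      using homeos_uniform_limit[OF cs, of g a] P Q by blast
    obtain H where H: "H \<in> homeos" "\<And>k p. p \<in> M \<Longrightarrow> d (H p) (f k p) \<le> b k / 4"
      using homeos_uniform_limit[OF cs, of f b] P Q by blast
    have ab: "a k \<le> (1/2)^k" "b k \<le> (1/2)^k" for k
    proof (induction k)
      case (Suc k)
      { case 1 show ?case using Q(3)[of k] Suc(1) by simp }
      { case 2 show ?case using Q(4)[of k] Suc(2) by simp }
    qed (use z c in auto)
    have GH: "G x = H y"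
    proof (rule ccontr)
      have mem: "G x \<in> M" "H y \<in> M" "g k x \<in> M" "f k y \<in> M" for k
        using homeos_mem G(1) H(1) P(1,2) x y by auto
      assume "G x \<noteq> H y"
      then have pos: "0 < d (G x) (H y)" using mem by simp
      then obtain k where k: "(1/2)^k < d (G x) (H y) / 4" using real_arch_pow_inv[of "d (G x) (H y) / 4" "1/2"] by auto
      let ?k = "Suc k"
      have "d (G x) (H y) \<le> d (G x) (g ?k x) + d (g ?k x) (H y)" using triangle mem by blast
      also have "d (g ?k x) (H y) \<le> d (f ?k y) (g ?k x) + d (H y) (f ?k y)"
        using triangle[of "g ?k x" "f ?k y" "H y"] mem by (simp add: commute)
      finally have "d (G x) (H y) < a ?k / 4 + (1/2)^k + b ?k / 4"
        using G(2)[OF x, of ?k] H(2)[OF y, of ?k] Q(5)[of k] by linarith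
      moreover have "(1/2::real)^?k \<le> (1/2)^k" by simp
      ultimately show False using ab[of ?k] k pos by linarith
    qed
    obtain K where K: "K \<in> homeos" "\<And>p. p \<in> M \<Longrightarrow> K (H p) = p" "\<And>p. p \<in> M \<Longrightarrow> H (K p) = p"
      using homeos_inverse[OF H(1)] by blast
    show ?thesis
    proof (intro bexI[of _ "K \<circ> G"] conjI)
      show "K \<circ> G \<in> homeos" using homeos_comp K(1) G(1) by blast
      show "(K \<circ> G) x = y" using GH K(2) y by simp
      show "displacement_less (K \<circ> G) e"
        unfolding displacement_less_def
      proof
        fix p assume p: "p \<in> M"
        have Gp: "G p \<in> M" using homeos_mem G(1) p by auto
        then have q: "K (G p) \<in> M" using homeos_mem K(1) by auto
        have 1: "d (G p) p \<le> c/4" using G(2)[OF p, of 0] z by simp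
        have 2: "d (G p) (K (G p)) \<le> c/4" using H(2)[OF q, of 0] z K(3)[OF Gp] by simp
        have "d (K (G p)) p \<le> d (G p) (K (G p)) + d (G p) p" using triangle'' Gp p q by blast
        then show "d ((K \<circ> G) p) p < e" using 1 2 c by simp
      qed
    qed
  qed
  show ?thesis
    by (rule that[of "\<rho> x (c/8)"]) (use main \<rho>(1)[OF x, of "c/8"] c in auto)
qed

text \<open>A Lebesgue number makes the radius uniform: nearby \<open>x\<close> and \<open>y\<close>
  lie in one ball around some \<open>p\<close> and are both images of \<open>p\<close> under
  homeomorphisms of displacement \<open>e/2\<close>; one of these composed with the inverse of the
  other costs \<open>e\<close>.\<close>

theorem effros:
  assumes cs: "compact_space mtopology" and hom: "homogeneous_space mtopology" and e: "0 < e"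
  obtains r where "0 < r"
    "\<And>x y. x \<in> M \<Longrightarrow> y \<in> M \<Longrightarrow> d x y < r \<Longrightarrow> \<exists>h\<in>homeos. h x = y \<and> displacement_less h e"
proof -
  have "\<exists>r. 0 < r \<and> (\<forall>y\<in>M. d x y < r \<longrightarrow> (\<exists>h\<in>homeos. h x = y \<and> displacement_less h (e/2)))" if "x \<in> M" for x
    using effros_pointwise[OF cs hom that, of "e/2"] e by (metis half_gt_zero)
  then obtain \<rho> where \<rho>: "\<And>x. x \<in> M \<Longrightarrow> 0 < \<rho> x"
    "\<And>x y. x \<in> M \<Longrightarrow> y \<in> M \<Longrightarrow> d x y < \<rho> x \<Longrightarrow> \<exists>h\<in>homeos. h x = y \<and> displacement_less h (e/2)"
    by metis
  have "compactin mtopology M" using cs unfolding compact_space_def by simp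
  moreover have "M \<subseteq> \<Union>((\<lambda>x. mball x (\<rho> x)) ` M)" using \<rho>(1) by force
  moreover have "openin mtopology U" if "U \<in> (\<lambda>x. mball x (\<rho> x)) ` M" for U using that by auto
  ultimately obtain r where r: "0 < r" "\<And>x. x \<in> M \<Longrightarrow> \<exists>U\<in>(\<lambda>x. mball x (\<rho> x)) ` M. mball x r \<subseteq> U"
    using lebesgue_number by meson
  show ?thesis
  proof
    fix x y assume xy: "x \<in> M" "y \<in> M" "d x y < r"
    obtain p where p: "p \<in> M" "mball x r \<subseteq> mball p (\<rho> p)" using r(2)[OF xy(1)] by blast
    have "x \<in> mball x r" "y \<in> mball x r" using xy r(1) by auto
    then have "x \<in> mball p (\<rho> p)" "y \<in> mball p (\<rho> p)" using p(2) by blast+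
    then have "d p x < \<rho> p" "d p y < \<rho> p" by auto
    then obtain g h where g: "g \<in> homeos" "g p = x" "displacement_less g (e/2)"
      and h: "h \<in> homeos" "h p = y" "displacement_less h (e/2)"
      using \<rho>(2)[OF p(1)] xy by meson
    obtain k where k: "k \<in> homeos" "\<And>q. q \<in> M \<Longrightarrow> k (g q) = q" "\<And>q. q \<in> M \<Longrightarrow> g (k q) = q"
      using homeos_inverse[OF g(1)] by blast
    have "displacement_less k (e/2)" using displacement_less_inverse[OF g(3,1) k(1,3)] .
    then have "displacement_less (h \<circ> k) e"
      using displacement_less_comp[OF h(3) _ h(1) k(1), of "e/2"] by simp
    moreover have "(h \<circ> k) x = y" using g(2) h(2) k(2)[OF p(1)] by auto
    moreover have "h \<circ> k \<in> homeos" using homeos_comp h k by blast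
    ultimately show "\<exists>h\<in>homeos. h x = y \<and> displacement_less h e" by blast
  qed (rule r(1))
qed

end

section \<open>Ordered box atlases\<close>

text \<open>Symmetric in the outer arguments and unchanged when \<open>\<tau>\<close> is replaced by
  its negative, so heights increasing in opposite directions define the same relation.\<close>

definition btw :: "('a \<Rightarrow> real) \<Rightarrow> 'a \<Rightarrow> 'a \<Rightarrow> 'a \<Rightarrow> bool" where
  "btw \<tau> x y w \<longleftrightarrow> \<tau> x < \<tau> y \<and> \<tau> y < \<tau> w \<or> \<tau> w < \<tau> y \<and> \<tau> y < \<tau> x"

context Metric_space
begin

section \<open>Recurrence of path components\<close>

lemma homeos_path_component:
  assumes "h \<in> homeos" "path_component_of mtopology x y"
  shows "path_component_of mtopology (h x) (h y)"
proof -
  obtain g where g: "pathin mtopology g" "g 0 = x" "g 1 = y" using assms(2) unfolding path_component_of_def by blast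
  have "pathin mtopology (h \<circ> g)" using g(1) homeos_continuous[OF assms(1)] unfolding pathin_def
    by (rule continuous_map_compose)
  then show ?thesis unfolding path_component_of_def using g by (intro exI[of _ "h \<circ> g"]) simp
qed

lemma compactin_collar:
  assumes "compactin mtopology Z" "Z \<subseteq> W" "openin mtopology W"
  obtains e where "0 < e" "\<And>z. z \<in> Z \<Longrightarrow> mball z e \<subseteq> W"
proof -
  have "\<exists>e>0. \<forall>x\<in>Z. \<exists>U\<in>{W}. mball x e \<subseteq> U"
    using lebesgue_number[OF assms(1), of "{W}"] assms by auto
  then show ?thesis using that by auto
qed

text \<open>The saturation by path components of an open set is open, by Effros. If all path components
  that meet the set already meet a compact part of it, the saturation is closed as well.\<close>

lemma path_component_meets_open:
  assumes cs: "compact_space mtopology" and con: "connected_space mtopology"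
    and hom: "homogeneous_space mtopology"
    and W: "openin mtopology W" "W \<noteq> {}" and Z: "compactin mtopology Z" "Z \<subseteq> W"
    and WZ: "\<And>x. x \<in> W \<Longrightarrow> \<exists>y\<in>Z. path_component_of mtopology x y"
    and a: "a \<in> M"
  obtains p where "p \<in> W" "path_component_of mtopology a p"
proof -
  define S where "S = {x \<in> M. \<exists>p\<in>W. path_component_of mtopology x p}"
  have WM: "W \<subseteq> M" using W(1) openin_subset by fastforce
  have "openin mtopology S"
    unfolding openin_mtopology
  proof (intro conjI strip)
    fix x assume "x \<in> S"
    then obtain p where x: "x \<in> M" and p: "p \<in> W" "path_component_of mtopology x p" unfolding S_def by auto
    then obtain e where e: "0 < e" "mball p e \<subseteq> W" using W(1) unfolding openin_mtopology by blast
    obtain r where r: "0 < r" "\<And>x y. x \<in> M \<Longrightarrow> y \<in> M \<Longrightarrow> d x y < r \<Longrightarrow> \<exists>h\<in>homeos. h x = y \<and> displacement_less h e"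
      using effros[OF cs hom e(1)] by blast
    have "mball x r \<subseteq> S"
    proof
      fix y assume y: "y \<in> mball x r"
      then obtain h where h: "h \<in> homeos" "h x = y" "displacement_less h e" using r(2)[of x y] by auto
      have pM: "p \<in> M" using p WM by auto
      then have "h p \<in> mball p e" using h(3) homeos_mem[OF h(1)] unfolding displacement_less_def
        by (simp add: commute)
      then have "h p \<in> W" using e by auto
      moreover have "path_component_of mtopology y (h p)" using homeos_path_component[OF h(1) p(2)] h(2) by simp
      ultimately show "y \<in> S" unfolding S_def using y by auto
    qed
    then show "\<exists>r>0. mball x r \<subseteq> S" using r(1) by blast
  qed (auto simp: S_def)
  moreover have "closedin mtopology S"
  proof -
    obtain e where e: "0 < e" "\<And>z. z \<in> Z \<Longrightarrow> mball z e \<subseteq> W" using compactin_collar[OF Z W(1)] by blast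
    obtain r where r: "0 < r" "\<And>x y. x \<in> M \<Longrightarrow> y \<in> M \<Longrightarrow> d x y < r \<Longrightarrow> \<exists>h\<in>homeos. h x = y \<and> displacement_less h e"
      using effros[OF cs hom e(1)] by blast
    have "x \<in> S" if x: "x \<in> mtopology closure_of S" for x
    proof -
      obtain y where xM: "x \<in> M" and y: "y \<in> S" "y \<in> mball x r" using x r(1) unfolding metric_closure_of by auto
      then obtain h where h: "h \<in> homeos" "h y = x" "displacement_less h e"
        using r(2)[of y x] by (auto simp: commute)
      obtain q where "q \<in> W" "path_component_of mtopology y q" using y(1) unfolding S_def by auto
      \<comment> \<open>The point is moved along its path component into \<open>Z\<close>, where one
        collar width serves for all points; from an arbitrary \<open>q\<close> a displacement below
        \<open>e\<close> might leave \<open>W\<close>.\<close>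
      moreover obtain p where p: "p \<in> Z" "path_component_of mtopology q p" using WZ \<open>q \<in> W\<close> by blast
      ultimately have "path_component_of mtopology y p" by (blast intro: path_component_of_trans)
      then have "path_component_of mtopology x (h p)" using homeos_path_component[OF h(1)] h(2) by blast
      moreover have "p \<in> M" using p(1) Z(2) WM by auto
      then have "h p \<in> mball p e" using h(3) homeos_mem[OF h(1)] unfolding displacement_less_def
        by (simp add: commute)
      ultimately show ?thesis using e(2)[OF p(1)] xM unfolding S_def by blast
    qed
    then have "mtopology closure_of S \<subseteq> S" by blast
    moreover have "S \<subseteq> topspace mtopology" unfolding S_def by auto
    ultimately show ?thesis using closure_of_subset_eq by blast
  qed
  moreover have "S \<noteq> {}"
  proof -
    obtain x where "x \<in> W" using W(2) by auto
    then have "x \<in> S" unfolding S_def using WM path_component_of_refl[of mtopology x] by auto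
    then show ?thesis by auto
  qed
  ultimately have "S = M" using con unfolding connected_space_clopen_in by auto
  then show ?thesis using a that unfolding S_def by auto
qed

text \<open>Agreement of two heights is known only near each point. A point outside the intersection
  of two closed balls has a neighbourhood missing it, which is why \<open>C\<close> is defined with
  closed balls; its Lebesgue number is a scale valid for all pairs of the finite family.\<close>

lemma coherent_scale:
  assumes cs: "compact_space mtopology" and I: "finite I" "I \<subseteq> M"
    and W: "\<And>i. i \<in> I \<Longrightarrow> mball i (2 * r i) \<subseteq> W i" and r: "\<And>i. i \<in> I \<Longrightarrow> 0 < r i"
    and coh: "\<And>i j z. i \<in> I \<Longrightarrow> j \<in> I \<Longrightarrow> z \<in> W i \<Longrightarrow> z \<in> W j \<Longrightarrow>
       \<exists>Q. openin mtopology Q \<and> z \<in> Q \<and> (\<forall>x\<in>Q. \<forall>y\<in>Q. \<forall>w\<in>Q. btw (\<tau> i) x y w \<longleftrightarrow> btw (\<tau> j) x y w)"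
  obtains e where "0 < e"
    "\<And>i x. i \<in> I \<Longrightarrow> x \<in> mball i (r i) \<Longrightarrow> mball x e \<subseteq> W i"
    "\<And>i j x y w. i \<in> I \<Longrightarrow> j \<in> I \<Longrightarrow> x \<in> mball i (r i) \<Longrightarrow> x \<in> mball j (r j) \<Longrightarrow> y \<in> mball x e \<Longrightarrow> w \<in> mball x e
        \<Longrightarrow> btw (\<tau> i) x y w \<longleftrightarrow> btw (\<tau> j) x y w"
proof -
  define C where "C = {V. openin mtopology V \<and> (\<forall>i\<in>I. \<forall>j\<in>I. V \<inter> mcball i (r i) \<inter> mcball j (r j) \<noteq> {} \<longrightarrow>
     (\<forall>x\<in>V. \<forall>y\<in>V. \<forall>w\<in>V. btw (\<tau> i) x y w \<longleftrightarrow> btw (\<tau> j) x y w))}"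
  have cW: "mcball i (r i) \<subseteq> W i" if "i \<in> I" for i
    using W[OF that] r[OF that] mcball_subset_mball_concentric[of "r i" "2 * r i" i] by force
  have "M \<subseteq> \<Union>C"
  proof
    fix z assume z: "z \<in> M"
    have "\<exists>V. openin mtopology V \<and> z \<in> V \<and> (V \<inter> mcball i (r i) \<inter> mcball j (r j) \<noteq> {} \<longrightarrow>
     (\<forall>x\<in>V. \<forall>y\<in>V. \<forall>w\<in>V. btw (\<tau> i) x y w \<longleftrightarrow> btw (\<tau> j) x y w))" if ij: "i \<in> I" "j \<in> I" for i j
    proof (cases "z \<in> mcball i (r i) \<inter> mcball j (r j)")
      case True
      then show ?thesis using coh[OF ij, of z] cW ij by blast
    next
      case False
      have "openin mtopology (M - (mcball i (r i) \<inter> mcball j (r j)))"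
        using openin_diff[OF open_in_mspace closedin_Int[OF closedin_mcball closedin_mcball]] .
      then show ?thesis using False z by blast
    qed
    then obtain V where V: "\<And>i j. i \<in> I \<Longrightarrow> j \<in> I \<Longrightarrow> openin mtopology (V i j) \<and> z \<in> V i j \<and> (V i j \<inter> mcball i (r i) \<inter> mcball j (r j) \<noteq> {} \<longrightarrow>
     (\<forall>x\<in>V i j. \<forall>y\<in>V i j. \<forall>w\<in>V i j. btw (\<tau> i) x y w \<longleftrightarrow> btw (\<tau> j) x y w))" by metis
    define V0 where "V0 = (\<Inter>p\<in>I\<times>I. V (fst p) (snd p)) \<inter> M"
    have "openin mtopology (\<Inter>(insert M ((\<lambda>p. V (fst p) (snd p)) ` (I\<times>I))))"
      by (rule openin_Inter) (use I V in auto)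
    then have "openin mtopology V0" by (simp add: V0_def Int_commute)
    moreover have sub: "V0 \<subseteq> V i j" if "i \<in> I" "j \<in> I" for i j unfolding V0_def using that by force
    have "(\<forall>x\<in>V0. \<forall>y\<in>V0. \<forall>w\<in>V0. btw (\<tau> i) x y w \<longleftrightarrow> btw (\<tau> j) x y w)"
      if "i \<in> I" "j \<in> I" "V0 \<inter> mcball i (r i) \<inter> mcball j (r j) \<noteq> {}" for i j
    proof -
      have "V i j \<inter> mcball i (r i) \<inter> mcball j (r j) \<noteq> {}" using sub[OF that(1,2)] that(3) by blast
      then show ?thesis using V[OF that(1,2)] sub[OF that(1,2)] by (meson subsetD)
    qed
    ultimately have "V0 \<in> C" unfolding C_def by blast
    moreover have "z \<in> V0" unfolding V0_def using V z by auto
    ultimately show "z \<in> \<Union>C" by blast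
  qed
  moreover have "compactin mtopology M" using cs unfolding compact_space_def by simp
  moreover have "\<And>U. U \<in> C \<Longrightarrow> openin mtopology U" unfolding C_def by auto
  ultimately obtain e where e: "0 < e" "\<And>x. x \<in> M \<Longrightarrow> \<exists>U\<in>C. mball x e \<subseteq> U"
    using lebesgue_number by meson
  \<comment> \<open>The radii enter the minimum so that a ball of radius \<open>e'\<close> around a
    point of \<open>mball i (r i)\<close> stays in the ball of twice the radius, hence in
    \<open>W i\<close>.\<close>
  define e' where "e' = Min (insert e (r ` I))"
  have e': "0 < e'" "e' \<le> e" "\<And>i. i \<in> I \<Longrightarrow> e' \<le> r i"
    unfolding e'_def using I(1) e(1) r by auto
  show ?thesis
  proof
    fix i x assume i: "i \<in> I" "x \<in> mball i (r i)"
    have "mball x e' \<subseteq> mball i (2 * r i)"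
    proof (rule mball_subset)
      show "d x i + e' \<le> 2 * r i" using i e'(3)[OF i(1)] by (simp add: commute)
    qed (use i in auto)
    then show "mball x e' \<subseteq> W i" using W[OF i(1)] by blast
  next
    fix i j x y w assume i: "i \<in> I" "j \<in> I" "x \<in> mball i (r i)" "x \<in> mball j (r j)" "y \<in> mball x e'" "w \<in> mball x e'"
    then have xM: "x \<in> M" by auto
    then obtain U where U: "U \<in> C" "mball x e \<subseteq> U" using e by blast
    have "x \<in> mball x e" using xM e(1) by simp
    then have x: "x \<in> U" using U(2) by blast
    have "y \<in> mball x e" "w \<in> mball x e" using i(5,6) e'(2) by auto
    then have yw: "y \<in> U" "w \<in> U" using U(2) by blast+
    have "x \<in> mcball i (r i)" "x \<in> mcball j (r j)" using i by auto
    then have "U \<inter> mcball i (r i) \<inter> mcball j (r j) \<noteq> {}" using x by blast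
    then show "btw (\<tau> i) x y w \<longleftrightarrow> btw (\<tau> j) x y w" using U(1) i(1,2) x yw unfolding C_def by blast
  qed (rule e'(1))
qed

text \<open>The contradiction with the foliation and the ambient manifold stripped away. Only
  betweenness has to agree between boxes (\<open>A8\<close>), so heights may be reversed or
  reparametrised from one box to the next. \<open>A3\<close> keeps betweenness constant along paths,
  \<open>A5\<close> makes path components return, \<open>A6\<close> supplies the adjacent pair, and
  \<open>A7\<close> the points strictly below its lower member.\<close>

theorem no_ordered_box_atlas:
  fixes BB :: "('a set \<times> ('a \<Rightarrow> real)) set"
  assumes cs: "compact_space mtopology" and con: "connected_space mtopology"
    and hom: "homogeneous_space mtopology" and ne: "M \<noteq> {}"
    and A1: "\<And>W \<tau>. (W, \<tau>) \<in> BB \<Longrightarrow> openin mtopology W"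
    and A2: "\<And>V z. openin mtopology V \<Longrightarrow> z \<in> V \<Longrightarrow> \<exists>W \<tau>. (W, \<tau>) \<in> BB \<and> z \<in> W \<and> W \<subseteq> V"
    and A3: "\<And>W \<tau> S x y. (W, \<tau>) \<in> BB \<Longrightarrow> connectedin mtopology S \<Longrightarrow> S \<subseteq> W \<Longrightarrow> x \<in> S \<Longrightarrow> y \<in> S \<Longrightarrow> \<tau> x = \<tau> y"
    and A4: "\<And>W \<tau> v. (W, \<tau>) \<in> BB \<Longrightarrow> v \<in> W \<Longrightarrow> openin mtopology {x \<in> W. \<tau> x < \<tau> v}"
            "\<And>W \<tau> v. (W, \<tau>) \<in> BB \<Longrightarrow> v \<in> W \<Longrightarrow> openin mtopology {x \<in> W. \<tau> v < \<tau> x}"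
    and A5: "\<And>W \<tau>. (W, \<tau>) \<in> BB \<Longrightarrow> \<exists>Z. compactin mtopology Z \<and> Z \<subseteq> W \<and> (\<forall>x\<in>W. \<exists>y\<in>Z. path_component_of mtopology x y)"
    and A6: "\<And>W \<tau> Q. (W, \<tau>) \<in> BB \<Longrightarrow> openin mtopology Q \<Longrightarrow> Q \<noteq> {} \<Longrightarrow> Q \<subseteq> W \<Longrightarrow>
       \<exists>a\<in>Q. \<exists>b\<in>Q. \<exists>V. openin mtopology V \<and> a \<in> V \<and> \<tau> a < \<tau> b \<and> (\<forall>v\<in>V. \<not> (\<tau> a < \<tau> v \<and> \<tau> v < \<tau> b))"
    and A7: "\<And>W \<tau> Q. (W, \<tau>) \<in> BB \<Longrightarrow> openin mtopology Q \<Longrightarrow> Q \<noteq> {} \<Longrightarrow> Q \<subseteq> W \<Longrightarrow> \<exists>x\<in>Q. \<exists>y\<in>Q. \<tau> x \<noteq> \<tau> y"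
    and A8: "\<And>W \<tau> W' \<tau>' z. (W, \<tau>) \<in> BB \<Longrightarrow> (W', \<tau>') \<in> BB \<Longrightarrow> z \<in> W \<Longrightarrow> z \<in> W' \<Longrightarrow>
       \<exists>Q. openin mtopology Q \<and> z \<in> Q \<and> (\<forall>x\<in>Q. \<forall>y\<in>Q. \<forall>w\<in>Q. btw \<tau> x y w \<longleftrightarrow> btw \<tau>' x y w)"
  shows False
proof -
  have "\<exists>W \<tau> r. (W, \<tau>) \<in> BB \<and> 0 < r \<and> mball z (2*r) \<subseteq> W" if zM: "z \<in> M" for z
  proof -
    obtain W \<tau> where W: "(W, \<tau>) \<in> BB" "z \<in> W" using A2[OF open_in_mspace zM] by blast
    then obtain r where "0 < r" "mball z r \<subseteq> W" using A1[OF W(1)] unfolding openin_mtopology by blast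
    then have "0 < r/2" "mball z (2*(r/2)) \<subseteq> W" by auto
    then show ?thesis using W(1) by blast
  qed
  then obtain W \<tau> r where W: "\<And>z. z \<in> M \<Longrightarrow> (W z, \<tau> z) \<in> BB" "\<And>z. z \<in> M \<Longrightarrow> 0 < r z" "\<And>z. z \<in> M \<Longrightarrow> mball z (2 * r z) \<subseteq> W z"
    by metis
  have "compactin mtopology M" using cs unfolding compact_space_def by simp
  moreover have "\<And>U. U \<in> (\<lambda>z. mball z (r z)) ` M \<Longrightarrow> openin mtopology U" by auto
  moreover have "M \<subseteq> \<Union>((\<lambda>z. mball z (r z)) ` M)" using W(2) by force
  ultimately obtain F where F: "finite F" "F \<subseteq> (\<lambda>z. mball z (r z)) ` M" "M \<subseteq> \<Union>F"
    unfolding compactin_def by meson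
  obtain I where I: "finite I" "I \<subseteq> M" "F = (\<lambda>z. mball z (r z)) ` I" using finite_subset_image[OF F(1,2)] by blast
  have cover: "\<exists>i\<in>I. x \<in> mball i (r i)" if "x \<in> M" for x using F(3) I(3) that by blast
  obtain e where e: "0 < e"
    "\<And>i x. i \<in> I \<Longrightarrow> x \<in> mball i (r i) \<Longrightarrow> mball x e \<subseteq> W i"
    "\<And>i j x y w. i \<in> I \<Longrightarrow> j \<in> I \<Longrightarrow> x \<in> mball i (r i) \<Longrightarrow> x \<in> mball j (r j) \<Longrightarrow> y \<in> mball x e \<Longrightarrow> w \<in> mball x e
        \<Longrightarrow> btw (\<tau> i) x y w \<longleftrightarrow> btw (\<tau> j) x y w"
    using coherent_scale[OF cs I(1,2), of r W \<tau>] W A8 I(2) by (smt (verit, best) subsetD)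
  \<comment> \<open>A relation free of the choice of a box: by the choice of \<open>e\<close>, every
    index whose small ball contains \<open>x\<close> gives the same answer for \<open>y\<close> and
    \<open>w\<close> within \<open>e\<close> of \<open>x\<close>.\<close>
  define T where "T x y w \<longleftrightarrow> (\<exists>i\<in>I. x \<in> mball i (r i) \<and> btw (\<tau> i) x y w)" for x y w
  have T: "T x y w \<longleftrightarrow> btw (\<tau> i) x y w" if "i \<in> I" "x \<in> mball i (r i)" "y \<in> mball x e" "w \<in> mball x e" for i x y w
    unfolding T_def using e(3) that by blast
  have disp: "g p \<in> mball p e" if "g \<in> homeos" "displacement_less g e" "p \<in> M" for g p
    using that homeos_mem unfolding displacement_less_def by (simp add: commute)
  \<comment> \<open>For a short time the path and its images under \<open>g\<close> and
    \<open>h\<close> stay in one box and, being connected, keep their heights there. So the truth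
    value is locally constant on the unit interval.\<close>
  have transport: "T (\<gamma> 1) (g (\<gamma> 1)) (h (\<gamma> 1)) \<longleftrightarrow> T (\<gamma> 0) (g (\<gamma> 0)) (h (\<gamma> 0))"
    if \<gamma>: "pathin mtopology \<gamma>" and g: "g \<in> homeos" "displacement_less g e"
      and h: "h \<in> homeos" "displacement_less h e" for \<gamma> g h
  proof -
    have \<gamma>M: "\<gamma> t \<in> M" if "t \<in> {0..1}" for t
      using \<gamma> that unfolding pathin_def continuous_map_def by auto
    have "\<forall>s\<in>{0..1}. \<forall>\<^sub>F t in at s within {0..1}.
        T (\<gamma> s) (g (\<gamma> s)) (h (\<gamma> s)) = T (\<gamma> t) (g (\<gamma> t)) (h (\<gamma> t))"
    proof
      fix s :: real assume s: "s \<in> {0..1}"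
      obtain i where i: "i \<in> I" "\<gamma> s \<in> mball i (r i)" using cover[OF \<gamma>M[OF s]] by blast
      have iM: "i \<in> M" using i I by auto
      have "openin (top_of_set {0..1}) {t \<in> topspace (top_of_set {0..1}). \<gamma> t \<in> mball i (r i)}"
        using openin_continuous_map_preimage \<gamma> openin_mball unfolding pathin_def by blast
      then obtain c where c: "0 < c" "\<And>t. t \<in> {0..1} \<Longrightarrow> dist t s < c \<Longrightarrow> \<gamma> t \<in> mball i (r i)"
        using s i(2) unfolding openin_euclidean_subtopology_iff by (auto simp del: in_mball)
      define J where "J = ball s c \<inter> {0..1}"
      have "connected J" unfolding J_def by (intro convex_connected convex_Int convex_ball convex_real_interval)
      then have J: "connectedin (top_of_set {0..1}) J"
        unfolding connectedin_subtopology by (auto simp: J_def)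
      have Jb: "\<gamma> t \<in> mball i (r i)" if "t \<in> J" for t using c(2)[of t] that by (auto simp: J_def dist_commute)
      have "connectedin mtopology (\<gamma> ` J)"
        using connectedin_continuous_map_image[OF \<gamma>[unfolded pathin_def] J] .
      then have con1: "connectedin mtopology (f ` \<gamma> ` J)" if "continuous_map mtopology mtopology f" for f
        using connectedin_continuous_map_image[OF that] by blast
      have eq: "\<tau> i (f (\<gamma> t)) = \<tau> i (f (\<gamma> s))" if f: "f \<in> homeos" "displacement_less f e" and t: "t \<in> J" for f t
      proof (rule A3[OF W(1)[OF iM] con1[of f]])
        show "continuous_map mtopology mtopology f" using homeos_continuous[OF f(1)] .
        show "f ` \<gamma> ` J \<subseteq> W i"
        proof (safe)
          fix u assume u: "u \<in> J"
          then have "\<gamma> u \<in> M" using Jb by auto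
          then show "f (\<gamma> u) \<in> W i" using disp[OF f] e(2)[OF i(1) Jb[OF u]] by blast
        qed
      qed (use t s c in \<open>auto simp: J_def\<close>)
      have id: "\<tau> i (\<gamma> t) = \<tau> i (\<gamma> s)" if "t \<in> J" for t
        using eq[of id t] homeos_id e(1) that unfolding displacement_less_def by auto
      have same: "T (\<gamma> s) (g (\<gamma> s)) (h (\<gamma> s)) = T (\<gamma> t) (g (\<gamma> t)) (h (\<gamma> t))" if t: "t \<in> J" for t
      proof -
        have "T (\<gamma> u) (g (\<gamma> u)) (h (\<gamma> u)) = btw (\<tau> i) (\<gamma> u) (g (\<gamma> u)) (h (\<gamma> u))" if "u \<in> J" for u
          using T[OF i(1) Jb[OF that]] disp[OF g] disp[OF h] Jb[OF that] by auto
        moreover have "s \<in> J" using s c(1) by (auto simp: J_def)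
        ultimately show ?thesis using t eq[OF g t] eq[OF h t] id[OF t] unfolding btw_def by auto
      qed
      show "\<forall>\<^sub>F t in at s within {0..1}. T (\<gamma> s) (g (\<gamma> s)) (h (\<gamma> s)) = T (\<gamma> t) (g (\<gamma> t)) (h (\<gamma> t))"
        unfolding eventually_at using c(1) same by (intro exI[of _ c]) (auto simp: J_def dist_commute)
    qed
    then show ?thesis
      using connected_local_const[of "{0..1}" 1 0 "\<lambda>t. T (\<gamma> t) (g (\<gamma> t)) (h (\<gamma> t))"] by auto
  qed
  obtain \<delta> where \<delta>: "0 < \<delta>" "\<And>x y. x \<in> M \<Longrightarrow> y \<in> M \<Longrightarrow> d x y < \<delta> \<Longrightarrow> \<exists>h\<in>homeos. h x = y \<and> displacement_less h e"
    using effros[OF cs hom e(1)] by blast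
  obtain i where i: "i \<in> I" using ne cover by blast
  have iM: "i \<in> M" using i I by auto
  note ib = W(1)[OF iM]
  \<comment> \<open>The radius \<open>\<delta>/2\<close> keeps the adjacent pair less than
    \<open>\<delta>\<close> apart, so that a homeomorphism of displacement below \<open>e\<close>
    matches its members.\<close>
  define Q where "Q = mball i (min (r i) (\<delta>/2))"
  have QW: "mball i (r i) \<subseteq> W i" using e(2)[OF i] e(1) by force
  have Q: "Q \<subseteq> W i" "openin mtopology Q" "Q \<noteq> {}"
    using QW W(2)[OF iM] \<delta>(1) iM unfolding Q_def mball_eq_empty by auto
  obtain a b V where ab: "a \<in> Q" "b \<in> Q" "openin mtopology V" "a \<in> V" "\<tau> i a < \<tau> i b"
    and gap: "\<And>v. v \<in> V \<Longrightarrow> \<not> (\<tau> i a < \<tau> i v \<and> \<tau> i v < \<tau> i b)"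
    using A6[OF ib Q(2,3,1)] by blast
  have abb: "a \<in> mball i (r i)" "b \<in> mball i (r i)" "d i a < \<delta>/2" "d i b < \<delta>/2" using ab(1,2) unfolding Q_def by auto
  then have abM: "a \<in> M" "b \<in> M" by auto
  have abW: "a \<in> W i" "b \<in> W i" using abb QW by auto
  have "d a b < \<delta>" using abb(3,4) triangle''[OF abM(1) iM abM(2)] by linarith
  then obtain h where h: "h \<in> homeos" "h a = b" "displacement_less h e" using \<delta>(2) abM by blast
  define Q1 where "Q1 = V \<inter> mball i (r i) \<inter> {v \<in> W i. \<tau> i v < \<tau> i b}"
  have Q1: "openin mtopology Q1" "a \<in> Q1" unfolding Q1_def using A4(1)[OF ib abW(2)] ab abW abb by auto
  define Q2 where "Q2 = {v \<in> W i. \<tau> i a < \<tau> i v}"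
  have Q2: "openin mtopology Q2" "b \<in> Q2" unfolding Q2_def using A4(2)[OF ib abW(1)] ab abW by auto
  obtain \<eta> where \<eta>: "0 < \<eta>" "\<eta> \<le> e" "mball a \<eta> \<subseteq> V"
  proof -
    obtain c where "0 < c" "mball a c \<subseteq> V" using ab(3,4) unfolding openin_mtopology by blast
    then show ?thesis using that[of "min c e"] e(1) by (auto simp: subset_iff)
  qed
  obtain \<delta>' where \<delta>': "0 < \<delta>'" "\<And>x y. x \<in> M \<Longrightarrow> y \<in> M \<Longrightarrow> d x y < \<delta>' \<Longrightarrow> \<exists>h\<in>homeos. h x = y \<and> displacement_less h \<eta>"
    using effros[OF cs hom \<eta>(1)] by blast
  \<comment> \<open>Demands on the return point: close to \<open>a\<close> and below
    \<open>b\<close>, sent by \<open>h\<close> above \<open>a\<close>, and carried to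
    \<open>a\<close> by some homeomorphism of displacement below \<open>\<eta>\<close>.\<close>
  define Q3 where "Q3 = Q1 \<inter> {x \<in> topspace mtopology. h x \<in> Q2} \<inter> mball a \<delta>'"
  have Q3: "openin mtopology Q3" "a \<in> Q3"
  proof -
    show "openin mtopology Q3" unfolding Q3_def
      using openin_continuous_map_preimage[OF homeos_continuous[OF h(1)] Q2(1)] Q1(1) by blast
    show "a \<in> Q3" unfolding Q3_def using Q1 Q2 h abM \<delta>' by auto
  qed
  have Q3W: "Q3 \<subseteq> W i" unfolding Q3_def Q1_def by auto
  \<comment> \<open>Points of \<open>Q3\<close> lie in \<open>V\<close> and below \<open>b\<close>,
    and the gap leaves them no room above \<open>a\<close>.\<close>
  have le: "\<tau> i v \<le> \<tau> i a" if "v \<in> Q3" for v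
    using gap[of v] that unfolding Q3_def Q1_def by auto
  have "\<exists>v\<in>Q3. \<tau> i v < \<tau> i a"
    using A7[OF ib Q3(1) _ Q3W] Q3(2) le by (metis empty_iff order_le_less)
  then have Q4ne: "Q3 \<inter> {v \<in> W i. \<tau> i v < \<tau> i a} \<noteq> {}" using Q3W by auto
  have Q4: "openin mtopology (Q3 \<inter> {v \<in> W i. \<tau> i v < \<tau> i a})" using A4(1)[OF ib abW(1)] Q3(1) by blast
  obtain z where "z \<in> Q3 \<inter> {v \<in> W i. \<tau> i v < \<tau> i a}" using Q4ne by auto
  then obtain W' \<tau>' where W': "(W', \<tau>') \<in> BB" "W' \<noteq> {}" "W' \<subseteq> Q3 \<inter> {v \<in> W i. \<tau> i v < \<tau> i a}"
    using A2[OF Q4] by blast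
  obtain Z where Z: "compactin mtopology Z" "Z \<subseteq> W'" "\<And>x. x \<in> W' \<Longrightarrow> \<exists>y\<in>Z. path_component_of mtopology x y"
    using A5[OF W'(1)] by blast
  obtain p where p: "p \<in> W'" "path_component_of mtopology a p"
    using path_component_meets_open[OF cs con hom A1[OF W'(1)] W'(2) Z abM(1)] by blast
  then obtain \<gamma> where \<gamma>: "pathin mtopology \<gamma>" "\<gamma> 0 = a" "\<gamma> 1 = p" unfolding path_component_of_def by blast
  have p3: "p \<in> Q3" "\<tau> i p < \<tau> i a" using p(1) W'(3) by auto
  then have pM: "p \<in> M" "d p a < \<delta>'" "p \<in> mball i (r i)" "\<tau> i a < \<tau> i (h p)"
    unfolding Q3_def Q1_def Q2_def by (auto simp: commute)
  obtain g where g: "g \<in> homeos" "g p = a" "displacement_less g \<eta>" using \<delta>'(2) pM abM by blast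
  have ge: "displacement_less g e" using g(3) \<eta>(2) unfolding displacement_less_def by force
  \<comment> \<open>Here \<open>g p = a\<close>, with \<open>p\<close> strictly below
    \<open>a\<close> and \<open>h p\<close> strictly above.\<close>
  have "T p (g p) (h p)"
    using T[OF i pM(3) disp[OF g(1) ge pM(1)] disp[OF h(1,3) pM(1)]] g(2) p3(2) pM(4)
    unfolding btw_def by auto
  \<comment> \<open>Transported along the path to \<open>a\<close>, where \<open>h a = b\<close>,
    the relation pushes \<open>g a\<close> into the gap.\<close>
  then have "T a (g a) (h a)" using transport[OF \<gamma>(1) g(1) ge h(1,3)] \<gamma> by simp
  then have "btw (\<tau> i) a (g a) b"
    using T[OF i abb(1) disp[OF g(1) ge abM(1)] disp[OF h(1,3) abM(1)]] h(2) by simp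
  then have "\<tau> i a < \<tau> i (g a)" "\<tau> i (g a) < \<tau> i b" using ab(5) unfolding btw_def by auto
  moreover have "g a \<in> V" using \<eta>(3) g(1,3) abM(1) homeos_mem
    unfolding displacement_less_def by (auto simp: commute subset_iff)
  ultimately show False using gap by blast
qed

end

section \<open>Complements of graphs\<close>

lemma Euclidean_space_eq_top_of_set: "Euclidean_space m = top_of_set {x. \<forall>i\<ge>m. x i = 0}"
  by (simp add: Euclidean_space_def euclidean_product_topology)

lemma pathin_top_of_set: "pathin (top_of_set S) g \<longleftrightarrow> path g \<and> path_image g \<subseteq> S"
  unfolding pathin_def path_def path_image_def by (auto simp: continuous_map_in_subtopology)

lemma path_component_of_top_of_set: "path_component_of (top_of_set S) x y \<longleftrightarrow> path_component S x y"
  unfolding path_component_of_def path_component_def pathin_top_of_set pathstart_def pathfinish_def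
  by auto

lemma path_connectedin_top_of_set: "path_connectedin (top_of_set T) S \<longleftrightarrow> S \<subseteq> T \<and> path_connected S"
proof -
  have "S \<subseteq> T \<Longrightarrow> subtopology (top_of_set T) S = top_of_set S"
    by (simp add: subtopology_subtopology Int_absorb1)
  then show ?thesis
    unfolding path_connectedin_def path_connected_space_iff_path_component path_connected_component
    by (auto simp: path_component_of_top_of_set Int_absorb1)
qed

lemma path_component_segment:
  fixes x y :: "nat \<Rightarrow> real"
  assumes "\<And>t. 0 \<le> t \<Longrightarrow> t \<le> 1 \<Longrightarrow> (\<lambda>i. (1 - t) * x i + t * y i) \<in> S"
  shows "path_component S x y"
  unfolding path_component_def
proof (intro exI conjI)
  show "path (\<lambda>t i. (1 - t) * x i + t * y i)"
    unfolding path_def by (intro continuous_on_coordinatewise_then_product continuous_intros)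
qed (use assms in \<open>auto simp: path_image_def pathstart_def pathfinish_def\<close>)

section \<open>Euclidean space as real sequences vanishing from index \<open>m\<close> on, and
  graphs in it\<close>

abbreviation Esp :: "nat \<Rightarrow> (nat \<Rightarrow> real) set" where
  "Esp m \<equiv> {x. \<forall>i\<ge>m. x i = 0}"

lemma closed_Esp: "closed (Esp m)"
  using closedin_Euclidean_space_iff[of m "Esp m"] closedin_topspace[of "Euclidean_space m"]
  by (simp add: topspace_Euclidean_space)

lemma continuous_on_coord [continuous_intros]: "continuous_on S (\<lambda>x::nat \<Rightarrow> real. x i)"
  by (rule continuous_on_subset[OF continuous_on_product_coordinates]) simp

lemma continuous_on_fun_upd:
  fixes f :: "'a::topological_space \<Rightarrow> nat \<Rightarrow> real"
  assumes "continuous_on S f" "continuous_on S h"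
  shows "continuous_on S (\<lambda>x. (f x)(n := h x))"
proof (rule continuous_on_coordinatewise_then_product)
  fix i show "continuous_on S (\<lambda>x. ((f x)(n := h x)) i)"
    using assms by (cases "i = n") (auto intro: continuous_on_product_then_coordinatewise)
qed

text \<open>Closed sublevel sets mean that \<open>\<theta>\<close> blows up at the frontier of
  \<open>G\<close>, so its graph is closed in the space one dimension higher although
  \<open>G\<close> itself need not be closed. The complement of a graph can be examined by hand;
  \<open>path_connectedin_Euclidean_complements\<close> later carries the outcome to any closed set
  homeomorphic to it.\<close>

locale graph_over_open =
  fixes n :: nat and G :: "(nat \<Rightarrow> real) set" and \<theta> :: "(nat \<Rightarrow> real) \<Rightarrow> real"
  assumes G_open: "openin (top_of_set (Esp n)) G"
    and G_ne: "G \<noteq> {}"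
    and \<theta>_cont: "continuous_on G \<theta>"
    and \<theta>_proper: "\<And>C. closed {x \<in> G. \<theta> x \<le> C}"
begin

text \<open>Coordinate \<open>n\<close> is the vertical one; \<open>y(n := 0)\<close> recovers the
  base point, since points of \<open>G\<close> vanish there.\<close>

definition graph_set :: "(nat \<Rightarrow> real) set \<Rightarrow> (nat \<Rightarrow> real) set" where
  "graph_set H = (\<lambda>x. x(n := \<theta> x)) ` H"

lemma G_sub: "G \<subseteq> Esp n" using G_open openin_imp_subset by blast

lemma G_coord: "x \<in> G \<Longrightarrow> x(n := 0) = x" using G_sub by (auto simp: fun_eq_iff)

lemma in_graph_set:
  assumes "H \<subseteq> G"
  shows "y \<in> graph_set H \<longleftrightarrow> y(n := 0) \<in> H \<and> y n = \<theta> (y(n := 0))"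
proof
  assume "y \<in> graph_set H"
  then obtain x where "x \<in> H" "y = x(n := \<theta> x)" unfolding graph_set_def by auto
  then show "y(n := 0) \<in> H \<and> y n = \<theta> (y(n := 0))" using assms G_coord by auto
next
  assume r: "y(n := 0) \<in> H \<and> y n = \<theta> (y(n := 0))"
  then have "y = (y(n := 0))(n := \<theta> (y(n := 0)))" by (auto simp: fun_eq_iff)
  then show "y \<in> graph_set H" unfolding graph_set_def using r by blast
qed

lemma graph_set_sub: "H \<subseteq> G \<Longrightarrow> graph_set H \<subseteq> Esp (Suc n)"
  unfolding graph_set_def using G_sub by force

lemma base_tendsto:
  fixes y :: "nat \<Rightarrow> nat \<Rightarrow> real"
  assumes "y \<longlonglongrightarrow> l" shows "(\<lambda>k. (y k)(n := 0)) \<longlonglongrightarrow> l(n := 0)" "(\<lambda>k. y k i) \<longlonglongrightarrow> l i"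
proof -
  have 1: "continuous_on UNIV (\<lambda>y::nat\<Rightarrow>real. y(n := 0))"
    by (intro continuous_on_fun_upd continuous_on_id continuous_on_const)
  then show "(\<lambda>k. (y k)(n := 0)) \<longlonglongrightarrow> l(n := 0)"
    using continuous_on_tendsto_compose[OF 1 assms] by simp
  have 2: "continuous_on UNIV (\<lambda>y::nat\<Rightarrow>real. y i)" by (intro continuous_intros)
  then show "(\<lambda>k. y k i) \<longlonglongrightarrow> l i"
    using continuous_on_tendsto_compose[OF 2 assms] by simp
qed

text \<open>Convergence bounds the heights, hence the values of \<open>\<theta>\<close> below them,
  and a closed sublevel set catches the limit of the base points.\<close>

lemma limit_base:
  fixes y :: "nat \<Rightarrow> nat \<Rightarrow> real"
  assumes lim: "y \<longlonglongrightarrow> l" and y: "\<And>k. (y k)(n := 0) \<in> G" "\<And>k. \<theta> ((y k)(n := 0)) \<le> y k n"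
  shows "l(n := 0) \<in> G" "(\<lambda>k. \<theta> ((y k)(n := 0))) \<longlonglongrightarrow> \<theta> (l(n := 0))"
proof -
  note base = base_tendsto(1)[OF lim] and coord = base_tendsto(2)[OF lim, of n]
  obtain C where C: "\<And>k. y k n \<le> C"
    using convergent_imp_Bseq[OF convergentI[OF coord]] unfolding Bseq_def real_norm_def
    by (meson abs_le_D1)
  have "(y k)(n := 0) \<in> {x \<in> G. \<theta> x \<le> C}" for k using y C order_trans by blast
  have "l(n := 0) \<in> {x \<in> G. \<theta> x \<le> C}"
    by (rule closed_sequentially[OF \<theta>_proper[of C] _ base]) fact
  then show lG: "l(n := 0) \<in> G" by simp
  show "(\<lambda>k. \<theta> ((y k)(n := 0))) \<longlonglongrightarrow> \<theta> (l(n := 0))"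
    using continuous_on_tendsto_compose[OF \<theta>_cont base lG] y(1) by simp
qed

lemma closed_graph_set:
  assumes H: "H \<subseteq> G" "closedin (top_of_set G) H"
  shows "closed (graph_set H)"
  unfolding closed_sequential_limits
proof (intro strip)
  fix y :: "nat \<Rightarrow> nat \<Rightarrow> real" and l assume "(\<forall>k. y k \<in> graph_set H) \<and> y \<longlonglongrightarrow> l"
  then have y: "\<And>k. (y k)(n := 0) \<in> H" "\<And>k. y k n = \<theta> ((y k)(n := 0))" and lim: "y \<longlonglongrightarrow> l"
    using in_graph_set[OF H(1)] by auto
  have *: "l(n := 0) \<in> G" "(\<lambda>k. \<theta> ((y k)(n := 0))) \<longlonglongrightarrow> \<theta> (l(n := 0))"
    using limit_base[OF lim] y H(1) by (auto simp: subset_iff)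
  obtain K where K: "closed K" "H = G \<inter> K" using H(2) unfolding closedin_closed by blast
  have "l(n := 0) \<in> K"
    by (rule closed_sequentially[OF K(1) _ base_tendsto(1)[OF lim]]) (use y(1) K(2) in blast)
  then have "l(n := 0) \<in> H" using K * by blast
  moreover have "l n = \<theta> (l(n := 0))"
    using LIMSEQ_unique[OF base_tendsto(2)[OF lim, of n]] *(2) y(2) by simp
  ultimately show "l \<in> graph_set H" using in_graph_set[OF H(1)] by blast
qed

text \<open>The open region above the graph is also closed in the complement, since off the graph
  \<open>\<le>\<close> and \<open><\<close> agree. It contains a point above the graph and misses
  one below.\<close>

lemma complement_not_path_connected: "\<not> path_connected (Esp (Suc n) - graph_set G)"
proof
  let ?S = "Esp (Suc n) - graph_set G"
  define A where "A = {y \<in> Esp (Suc n). y(n := 0) \<in> G \<and> \<theta> (y(n := 0)) < y n}"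
  have AS: "A \<subseteq> ?S" unfolding A_def using in_graph_set[of G] by auto
  assume "path_connected ?S"
  then have con: "connected ?S" by (rule path_connected_imp_connected)
  define F where "F = {y \<in> Esp (Suc n). y(n := 0) \<in> G \<and> \<theta> (y(n := 0)) \<le> y n}"
  have "closed F"
    unfolding closed_sequential_limits
  proof (intro strip)
    fix y :: "nat \<Rightarrow> nat \<Rightarrow> real" and l assume a: "(\<forall>k. y k \<in> F) \<and> y \<longlonglongrightarrow> l"
    then have y: "\<And>k. (y k)(n := 0) \<in> G" "\<And>k. \<theta> ((y k)(n := 0)) \<le> y k n" "\<And>k. y k \<in> Esp (Suc n)" and lim: "y \<longlonglongrightarrow> l"
      unfolding F_def by auto
    have *: "l(n := 0) \<in> G" "(\<lambda>k. \<theta> ((y k)(n := 0))) \<longlonglongrightarrow> \<theta> (l(n := 0))"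
      using limit_base[OF lim y(1,2)] by auto
    have "\<theta> (l(n := 0)) \<le> l n"
      using LIMSEQ_le[OF *(2) base_tendsto(2)[OF lim, of n]] y(2) by blast
    moreover have "l \<in> Esp (Suc n)" using closed_Esp[of "Suc n"] y(3) lim unfolding closed_sequential_limits by blast
    ultimately show "l \<in> F" unfolding F_def using * by auto
  qed
  moreover have "A = ?S \<inter> F" unfolding A_def F_def using in_graph_set[of G] by auto
  ultimately have "closedin (top_of_set ?S) A" using closedin_closed_Int by metis
  moreover have "openin (top_of_set ?S) A"
  proof -
    define S where "S = {y \<in> Esp (Suc n). y(n := 0) \<in> G}"
    obtain U where U: "open U" "G = Esp n \<inter> U" using G_open unfolding openin_open by blast
    have cb: "continuous_on T (\<lambda>y::nat\<Rightarrow>real. y(n := 0))" for T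
      by (intro continuous_on_fun_upd continuous_on_id continuous_on_const)
    have "S = Esp (Suc n) \<inter> (\<lambda>y. y(n := 0)) -` U"
      unfolding S_def U(2) by (auto simp: Suc_le_eq)
    then have S: "openin (top_of_set (Esp (Suc n))) S"
      using continuous_openin_preimage_gen[OF cb U(1)] by simp
    have "continuous_on S (\<lambda>y. \<theta> (y(n := 0)))"
      by (rule continuous_on_compose2[OF \<theta>_cont cb]) (auto simp: S_def)
    then have "continuous_on S (\<lambda>y. y n - \<theta> (y(n := 0)))"
      by (rule continuous_on_diff[OF continuous_on_coord])
    then have "openin (top_of_set S) (S \<inter> (\<lambda>y. y n - \<theta> (y(n := 0))) -` {0<..})"
      using continuous_openin_preimage_gen[OF _ open_greaterThan] by blast
    moreover have "S \<inter> (\<lambda>y. y n - \<theta> (y(n := 0))) -` {0<..} = A" unfolding S_def A_def by auto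
    ultimately have "openin (top_of_set S) A" by simp
    then have "openin (top_of_set (Esp (Suc n))) A" using S by (rule openin_trans)
    then show ?thesis using AS by (rule openin_subset_trans) auto
  qed
  moreover obtain x where x: "x \<in> G" using G_ne by auto
  have "x(n := \<theta> x + 1) \<in> A" unfolding A_def using x G_coord[OF x] G_sub by auto
  moreover have "x(n := \<theta> x - 1) \<in> ?S - A" unfolding A_def using x G_coord[OF x] G_sub in_graph_set[of G] by auto
  ultimately show False using con unfolding connected_clopen by blast
qed

text \<open>Points above the graph escape through the hole left by \<open>V\<close>: they rise above
  the values of \<open>\<theta>\<close> along a path in \<open>G\<close> leading to a point of
  \<open>V\<close>, follow that path at constant height, and descend there.\<close>

lemma punctured_complement_path_connected:
  assumes pos: "\<And>x. x \<in> G \<Longrightarrow> 0 < \<theta> x" and pc: "path_connected G" and V: "V \<subseteq> G" "V \<noteq> {}"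
  shows "path_connected (Esp (Suc n) - graph_set (G - V))"
proof -
  let ?S = "Esp (Suc n) - graph_set (G - V)"
  have in_S: "y \<in> ?S \<longleftrightarrow> y \<in> Esp (Suc n) \<and> (y(n := 0) \<in> G - V \<longrightarrow> y n \<noteq> \<theta> (y(n := 0)))" for y
    using in_graph_set[of "G - V" y] by auto
  \<comment> \<open>Height -1 is below the whole graph because \<open>\<theta>\<close> is positive;
    every point is joined to \<open>p\<close> through this level.\<close>
  define p where "p = (\<lambda>i::nat. if i = n then -1 else 0::real)"
  have low: "path_component ?S y p" if "y \<in> Esp (Suc n)" "y n = -1" for y
  proof (rule path_component_segment)
    fix t :: real assume t: "0 \<le> t" "t \<le> 1"
    let ?z = "\<lambda>i. (1 - t) * y i + t * p i"
    have "?z n = -1" using that by (simp add: p_def)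
    moreover have "?z \<in> Esp (Suc n)" using that by (simp add: p_def)
    ultimately show "?z \<in> ?S" unfolding in_S using pos[of "?z(n := 0)"] by force
  qed
  have down: "path_component ?S y p" if y: "y \<in> Esp (Suc n)" and "y(n := 0) \<in> G - V \<Longrightarrow> y n < \<theta> (y(n := 0))" for y
  proof -
    have "path_component ?S y (y(n := -1))"
    proof (rule path_component_segment)
      fix t :: real assume t: "0 \<le> t" "t \<le> 1"
      let ?z = "\<lambda>i. (1 - t) * y i + t * (y(n := -1)) i"
      have z: "?z(n := 0) = y(n := 0)" by (auto simp: fun_eq_iff algebra_simps)
      have "?z \<in> Esp (Suc n)" using y by auto
      moreover have "?z n < \<theta> (?z(n := 0))" if g: "?z(n := 0) \<in> G - V"
      proof -
        have 1: "y n < \<theta> (y(n := 0))" "-1 < \<theta> (y(n := 0))"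
          using g \<open>y(n := 0) \<in> G - V \<Longrightarrow> y n < \<theta> (y(n := 0))\<close> pos[of "y(n := 0)"] unfolding z by auto
        have "(1 - t) * y n + t * (-1) < \<theta> (y(n := 0))"
          by (rule convex_bound_lt[OF 1]) (use t in auto)
        then show ?thesis unfolding z by simp
      qed
      ultimately show "?z \<in> ?S" unfolding in_S by fastforce
    qed
    moreover have "path_component ?S (y(n := -1)) p" using low[of "y(n := -1)"] y by auto
    ultimately show ?thesis by (rule path_component_trans)
  qed
  have "path_component ?S y p" if y: "y \<in> ?S" for y
  proof (cases "y(n := 0) \<in> G - V \<and> \<theta> (y(n := 0)) \<le> y n")
    case False
    then show ?thesis using down y by auto
  next
    case True
    let ?x = "y(n := 0)"
    have yE: "y \<in> Esp (Suc n)" and xG: "?x \<in> G" and gt: "\<theta> ?x < y n" using True y unfolding in_S by auto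
    obtain v where v: "v \<in> V" using V by auto
    obtain \<gamma> where \<gamma>: "path \<gamma>" "path_image \<gamma> \<subseteq> G" "pathstart \<gamma> = ?x" "pathfinish \<gamma> = v"
      using pc xG v V(1) unfolding path_connected_def by blast
    have cg: "continuous_on {0..1} (\<theta> \<circ> \<gamma>)"
      using \<gamma>(1,2) \<theta>_cont unfolding path_def path_image_def
      by (intro continuous_on_compose) (auto intro: continuous_on_subset)
    then have "bounded ((\<theta> \<circ> \<gamma>) ` {0..1})" using compact_continuous_image compact_Icc compact_imp_bounded by blast
    then obtain C where "\<forall>z\<in>(\<theta> \<circ> \<gamma>) ` {0..1}. norm z \<le> C" unfolding bounded_iff by blast
    then have C: "\<theta> (\<gamma> t) \<le> C" if "t \<in> {0..1}" for t
      using that abs_le_D1[of "\<theta> (\<gamma> t)" C] by simp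
    define c where "c = max (y n) (C + 1)"
    have "path_component ?S y (?x(n := c))"
    proof (rule path_component_segment)
      fix t :: real assume t: "0 \<le> t" "t \<le> 1"
      let ?z = "\<lambda>i. (1 - t) * y i + t * (?x(n := c)) i"
      have z: "?z(n := 0) = ?x" by (auto simp: fun_eq_iff algebra_simps)
      have "?z n = y n + t * (c - y n)" by (simp add: algebra_simps)
      then have "y n \<le> ?z n" using t by (simp add: c_def)
      then have "\<theta> (?z(n := 0)) < ?z n" unfolding z using gt by linarith
      moreover have "?z \<in> Esp (Suc n)" using yE by auto
      ultimately show "?z \<in> ?S" unfolding in_S by fastforce
    qed
    moreover have "path_component ?S (?x(n := c)) (v(n := c))"
      unfolding path_component_def
    proof (intro exI conjI)
      show "path (\<lambda>t. (\<gamma> t)(n := c))" using \<gamma>(1) unfolding path_def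
        by (intro continuous_on_fun_upd continuous_on_const)
      show "path_image (\<lambda>t. (\<gamma> t)(n := c)) \<subseteq> ?S"
      proof
        fix z assume "z \<in> path_image (\<lambda>t. (\<gamma> t)(n := c))"
        then obtain t where t: "t \<in> {0..1}" "z = (\<gamma> t)(n := c)" unfolding path_image_def by auto
        have g: "\<gamma> t \<in> G" using \<gamma>(2) t unfolding path_image_def by auto
        then have "z(n := 0) = \<gamma> t" using t(2) G_coord by simp
        moreover have "z n = c" using t by simp
        moreover have "\<theta> (\<gamma> t) < c" using C[OF t(1)] unfolding c_def by linarith
        moreover have "z \<in> Esp (Suc n)" using g G_sub t(2) by auto
        ultimately show "z \<in> ?S" unfolding in_S by auto
      qed
      show "pathstart (\<lambda>t. (\<gamma> t)(n := c)) = ?x(n := c)" using \<gamma>(3) by (simp add: pathstart_def)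
      show "pathfinish (\<lambda>t. (\<gamma> t)(n := c)) = v(n := c)" using \<gamma>(4) by (simp add: pathfinish_def)
    qed
    moreover have "path_component ?S (v(n := c)) p"
    proof (rule down)
      have "v \<in> G" using v V by blast
      then have "(v(n := c))(n := 0) = v" "v \<in> Esp n" using G_coord[of v] G_sub by auto
      then show "v(n := c) \<in> Esp (Suc n)" "(v(n := c))(n := 0) \<in> G - V \<Longrightarrow> (v(n := c)) n < \<theta> ((v(n := c))(n := 0))"
        using v by auto
    qed
    ultimately show ?thesis using path_component_trans by blast
  qed
  then show ?thesis unfolding path_connected_component
    using path_component_sym path_component_trans by blast
qed

end

text \<open>Balls of the maximum norm: bounds are checked coordinate by coordinate, and the cubes of
  the charts are boxes of radius 1.\<close>

definition obx :: "nat \<Rightarrow> (nat \<Rightarrow> real) \<Rightarrow> real \<Rightarrow> (nat \<Rightarrow> real) set" where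
  "obx m p \<rho> = {x \<in> Esp m. \<forall>i<m. \<bar>x i - p i\<bar> < \<rho>}"

definition cbx :: "nat \<Rightarrow> (nat \<Rightarrow> real) \<Rightarrow> real \<Rightarrow> (nat \<Rightarrow> real) set" where
  "cbx m p \<rho> = {x \<in> Esp m. \<forall>i<m. \<bar>x i - p i\<bar> \<le> \<rho>}"

text \<open>In each coordinate the interval of radius \<open>\<rho>\<close> is stretched to the line
  by \<open>u / (\<rho> - \<bar>u\<bar>)\<close>, with inverse
  \<open>\<rho> * s / (1 + \<bar>s\<bar>)\<close>.\<close>

lemma obx_homeomorphism:
  assumes "0 < \<rho>"
  obtains \<beta> \<beta>' where "homeomorphism (obx m p \<rho>) (Esp m) \<beta> \<beta>'"
proof
  let ?b = "\<lambda>x i. if i < m then (x i - p i) / (\<rho> - \<bar>x i - p i\<bar>) else (0::real)"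
  let ?b' = "\<lambda>y i. if i < m then p i + \<rho> * y i / (1 + \<bar>y i\<bar>) else (0::real)"
  have 1: "?b' (?b x) = x" if x: "x \<in> obx m p \<rho>" for x
  proof
    fix i show "?b' (?b x) i = x i"
    proof (cases "i < m")
      case True
      define u where "u = x i - p i"
      have u: "\<bar>u\<bar> < \<rho>" using x True by (auto simp: obx_def u_def)
      have "1 + \<bar>u / (\<rho> - \<bar>u\<bar>)\<bar> = \<rho> / (\<rho> - \<bar>u\<bar>)"
        using u by (simp add: abs_divide field_simps)
      then have "\<rho> * (u / (\<rho> - \<bar>u\<bar>)) / (1 + \<bar>u / (\<rho> - \<bar>u\<bar>)\<bar>) = u"
        using u assms by (simp add: field_simps)
      then show ?thesis using True by (simp add: u_def)
    next
      case False
      then show ?thesis using x by (simp add: obx_def)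
    qed
  qed
  have bound: "\<bar>\<rho> * s / (1 + \<bar>s\<bar>)\<bar> = \<rho> - \<rho> / (1 + \<bar>s\<bar>)" for s :: real
    using assms by (simp add: abs_mult abs_divide field_simps add_pos_nonneg)
  have 2: "?b (?b' y) = y" if y: "y \<in> Esp m" for y
  proof
    fix i show "?b (?b' y) i = y i"
    proof (cases "i < m")
      case True
      have "\<rho> * y i / (1 + \<bar>y i\<bar>) / (\<rho> - \<bar>\<rho> * y i / (1 + \<bar>y i\<bar>)\<bar>) = y i"
        unfolding bound using assms by (simp add: add_pos_nonneg)
      then show ?thesis using True by simp
    next
      case False
      then show ?thesis using y by simp
    qed
  qed
  have 3: "?b' y \<in> obx m p \<rho>" for y
  proof -
    have "\<bar>\<rho> * s / (1 + \<bar>s\<bar>)\<bar> < \<rho>" for s unfolding bound using assms by (simp add: add_pos_nonneg)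
    then show ?thesis unfolding obx_def by auto
  qed
  show "homeomorphism (obx m p \<rho>) (Esp m) ?b ?b'"
  proof (rule homeomorphismI)
    show "continuous_on (obx m p \<rho>) ?b"
    proof (rule continuous_on_coordinatewise_then_product)
      fix i show "continuous_on (obx m p \<rho>) (\<lambda>x. ?b x i)"
      proof (cases "i < m")
        case True
        then have "\<forall>x\<in>obx m p \<rho>. \<rho> - \<bar>x i - p i\<bar> \<noteq> 0" unfolding obx_def by fastforce
        then show ?thesis using True by (auto intro!: continuous_intros)
      qed auto
    qed
    show "continuous_on (Esp m) ?b'"
    proof (rule continuous_on_coordinatewise_then_product)
      fix i
      have "\<forall>x\<in>Esp m. 1 + \<bar>x i\<bar> \<noteq> 0" by (auto simp: add_pos_nonneg less_imp_neq[THEN not_sym])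
      then show "continuous_on (Esp m) (\<lambda>x. ?b' x i)"
        by (cases "i < m") (auto intro!: continuous_intros)
    qed
    show "?b ` obx m p \<rho> \<subseteq> Esp m" by auto
    show "?b' ` Esp m \<subseteq> obx m p \<rho>" using 3 by blast
    show "?b' (?b x) = x" if "x \<in> obx m p \<rho>" for x using 1[OF that] .
    show "?b (?b' y) = y" if "y \<in> Esp m" for y using 2[OF that] .
  qed
qed

section \<open>Separation of a box by a disc of codimension one\<close>

lemma nsphere_eq_top_of_set: "nsphere n = top_of_set {x \<in> Esp (Suc n). (\<Sum>i\<le>n. (x i)\<^sup>2) = 1}"
  unfolding nsphere_def Euclidean_space_eq_top_of_set
  by (simp add: subtopology_subtopology Collect_conj_eq)

text \<open>Normalising \<open>K\<close> on the spheres of radius between 0 and \<open>R\<close>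
  around \<open>q\<close> gives a homotopy from a constant map to the identity, which would make the
  sphere contractible.\<close>

lemma no_nonvanishing_translation_extension:
  fixes q :: "nat \<Rightarrow> real"
  assumes K: "continuous_on (Esp (Suc n)) K" "K ` Esp (Suc n) \<subseteq> Esp (Suc n)"
    and nz: "\<And>x. x \<in> Esp (Suc n) \<Longrightarrow> \<exists>i\<le>n. K x i \<noteq> 0" and q: "q \<in> Esp (Suc n)" and R: "0 < R"
    and far: "\<And>x. x \<in> Esp (Suc n) \<Longrightarrow> (\<Sum>i\<le>n. (x i - q i)\<^sup>2) = R\<^sup>2 \<Longrightarrow> K x = (\<lambda>i. x i - q i)"
  shows False
proof -
  define S where "S = {x \<in> Esp (Suc n). (\<Sum>i\<le>n. (x i)\<^sup>2) = 1}"
  define N where "N v = (\<lambda>i::nat. v i / sqrt (\<Sum>j\<le>n. (v j)\<^sup>2))" for v :: "nat \<Rightarrow> real"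
  define X where "X = (\<lambda>z i. q i + fst z * (R * snd z i))"
  define h where "h z = N (K (X z))" for z :: "real \<times> (nat \<Rightarrow> real)"
  have X: "X z \<in> Esp (Suc n)" if "z \<in> {0..1::real} \<times> S" for z using that q unfolding X_def S_def by auto
  have pos: "0 < (\<Sum>j\<le>n. (K x j)\<^sup>2)" if x: "x \<in> Esp (Suc n)" for x
  proof -
    obtain i where "i \<le> n" "K x i \<noteq> 0" using nz[OF x] by blast
    then show ?thesis by (intro sum_pos2[of _ i]) auto
  qed
  have contX: "continuous_on ({0..1} \<times> S) X"
    unfolding X_def
    by (intro continuous_on_coordinatewise_then_product continuous_intros
        continuous_on_product_then_coordinatewise[OF continuous_on_snd[OF continuous_on_id]])
  have contK: "continuous_on ({0..1} \<times> S) (\<lambda>z. K (X z))"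
    by (rule continuous_on_compose2[OF K(1) contX]) (use X in blast)
  have "continuous_on ({0..1} \<times> S) h"
    unfolding h_def N_def
  proof (rule continuous_on_coordinatewise_then_product)
    fix i
    have "\<forall>z\<in>{0..1} \<times> S. sqrt (\<Sum>j\<le>n. (K (X z) j)\<^sup>2) \<noteq> 0"
      using pos[OF X] by (metis less_irrefl real_sqrt_eq_zero_cancel_iff)
    then show "continuous_on ({0..1} \<times> S) (\<lambda>z. K (X z) i / sqrt (\<Sum>j\<le>n. (K (X z) j)\<^sup>2))"
      by (intro continuous_on_divide continuous_on_real_sqrt continuous_on_sum continuous_on_power
          continuous_on_product_then_coordinatewise[OF contK])
  qed
  moreover have "h ` ({0..1} \<times> S) \<subseteq> S"
  proof (rule image_subsetI)
    fix z :: "real \<times> (nat \<Rightarrow> real)" assume z: "z \<in> {0..1} \<times> S"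
    have "K (X z) \<in> Esp (Suc n)" using K(2) X[OF z] by blast
    then have "h z \<in> Esp (Suc n)" unfolding h_def N_def by simp
    moreover have "(\<Sum>i\<le>n. (h z i)\<^sup>2) = 1"
      unfolding h_def N_def power_divide using pos[OF X[OF z]] by (simp flip: sum_divide_distrib)
    ultimately show "h z \<in> S" unfolding S_def by blast
  qed
  ultimately have "continuous_map (prod_topology (top_of_set {0..1}) (nsphere n)) (nsphere n) h"
    unfolding nsphere_eq_top_of_set S_def[symmetric] by (simp add: image_subset_iff_funcset)
  moreover have "h (1, x) = x" if x: "x \<in> S" for x
  proof -
    have n: "(\<Sum>i\<le>n. (R * x i)\<^sup>2) = R\<^sup>2"
      using x by (simp add: S_def power_mult_distrib flip: sum_distrib_left)
    have "(\<Sum>i\<le>n. (X (1,x) i - q i)\<^sup>2) = R\<^sup>2" using n by (simp add: X_def)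
    then have "K (X (1,x)) = (\<lambda>i. R * x i)" using far[OF X[of "(1,x)"]] x by (simp add: X_def)
    then show ?thesis unfolding h_def N_def using n R by simp
  qed
  moreover have "h (0, x) = N (K q)" for x by (simp add: h_def X_def)
  ultimately have "homotopic_with (\<lambda>x. True) (nsphere n) (nsphere n) (\<lambda>x. N (K q)) id"
    unfolding nsphere_eq_top_of_set S_def[symmetric]
    by (intro iffD2[OF homotopic_with] exI[of _ h]) auto
  then have "contractible_space (nsphere n)"
    unfolding contractible_space_def using homotopic_with_symD by blast
  then show False using non_contractible_space_nsphere by blast
qed

section \<open>Convexity and topology of boxes\<close>

lemma obx_segment:
  assumes "x \<in> obx m p r" "y \<in> obx m p r" "0 \<le> t" "t \<le> 1"
  shows "(\<lambda>i. (1 - t) * x i + t * y i) \<in> obx m p r"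
proof -
  have "\<bar>(1 - t) * x i + t * y i - p i\<bar> < r" if "i < m" for i
  proof -
    have 1: "\<bar>x i - p i\<bar> < r" "\<bar>y i - p i\<bar> < r" using assms that unfolding obx_def by auto
    have "\<bar>(1 - t) * x i + t * y i - p i\<bar> = \<bar>(1 - t) * (x i - p i) + t * (y i - p i)\<bar>" by (simp add: algebra_simps)
    also have "\<dots> \<le> (1 - t) * \<bar>x i - p i\<bar> + t * \<bar>y i - p i\<bar>"
      using assms(3,4) by (intro order_trans[OF abs_triangle_ineq]) (simp add: abs_mult)
    also have "\<dots> < r" by (rule convex_bound_lt[OF 1]) (use assms in auto)
    finally show ?thesis .
  qed
  then show ?thesis using assms unfolding obx_def by auto
qed

lemma obx_path_component:
  assumes "x \<in> obx m p r" "y \<in> obx m p r" shows "path_component (obx m p r) x y"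
  by (rule path_component_segment) (rule obx_segment[OF assms])

lemma closed_coord_le: "closed {x::nat \<Rightarrow> real. \<bar>x i - c\<bar> \<le> r}" "open {x::nat \<Rightarrow> real. \<bar>x i - c\<bar> < r}"
proof -
  have "continuous_on UNIV (\<lambda>x::nat \<Rightarrow> real. \<bar>x i - c\<bar>)" by (intro continuous_intros)
  then show "closed {x::nat \<Rightarrow> real. \<bar>x i - c\<bar> \<le> r}" "open {x::nat \<Rightarrow> real. \<bar>x i - c\<bar> < r}"
    by (auto intro: closed_Collect_le open_Collect_less)
qed

lemma closed_cbx: "closed (cbx m p r)"
proof -
  have "cbx m p r = Esp m \<inter> (\<Inter>i\<in>{..<m}. {x. \<bar>x i - p i\<bar> \<le> r})" unfolding cbx_def by auto
  then show ?thesis using closed_Esp closed_coord_le(1) by (auto intro!: closed_Int closed_INT)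
qed

lemma openin_obx: "openin (top_of_set (Esp m)) (obx m p r)"
proof -
  have "obx m p r = Esp m \<inter> (\<Inter>i\<in>{..<m}. {x. \<bar>x i - p i\<bar> < r})" unfolding obx_def by auto
  then show ?thesis using closed_coord_le(2) by (auto intro!: openin_open_Int open_INT)
qed

lemma compact_cbx: "compact (cbx m p r)"
proof -
  have "compactin (product_topology (\<lambda>i. euclideanreal) UNIV) (PiE UNIV (\<lambda>i. if i < m then {p i - r..p i + r} else {0::real}))"
    by (auto simp: compactin_PiE)
  moreover have "(PiE UNIV (\<lambda>i. if i < m then {p i - r..p i + r} else {0::real})) = cbx m p r"
  proof (rule Set.set_eqI)
    fix x :: "nat \<Rightarrow> real"
    have "x i \<in> (if i < m then {p i - r..p i + r} else {0}) \<longleftrightarrow> (i < m \<longrightarrow> \<bar>x i - p i\<bar> \<le> r) \<and> (m \<le> i \<longrightarrow> x i = 0)" for i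
      by (cases "i < m") auto
    then show "x \<in> (PiE UNIV (\<lambda>i. if i < m then {p i - r..p i + r} else {0::real})) \<longleftrightarrow> x \<in> cbx m p r"
      unfolding cbx_def PiE_iff by auto
  qed
  ultimately show ?thesis by (simp add: euclidean_product_topology)
qed

lemma obx_mono: "r \<le> s \<Longrightarrow> obx m p r \<subseteq> obx m p s" and obx_sub_cbx: "obx m p r \<subseteq> cbx m p r"
  unfolding obx_def cbx_def by fastforce+

text \<open>Whether the complement of a closed set in Euclidean space is path connected depends only
  on the homeomorphism type of the set. The box is stretched to the whole space, and
  \<open>g\<close> is a homeomorphism on \<open>H\<close> because \<open>D\<close> is compact; so
  the image of \<open>H\<close> may be traded for the graph.\<close>

lemma path_connected_complement_graph_iff:
  assumes c: "closedin (top_of_set G) H" "H \<subseteq> G" and gr: "graph_over_open n G \<theta>" and m: "m = Suc n" and \<rho>: "0 < \<rho>"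
    and D: "compact D" "continuous_on D g" "inj_on g D" "G \<subseteq> D" and gH: "closedin (top_of_set (obx m p \<rho>)) (g ` H)"
  shows "path_connected (obx m p \<rho> - g ` H) \<longleftrightarrow> path_connected (Esp m - graph_over_open.graph_set n \<theta> H)"
proof -
  interpret graph_over_open n G \<theta> by (rule gr)
  obtain \<beta> \<beta>' where \<beta>: "homeomorphism (obx m p \<rho>) (Esp m) \<beta> \<beta>'" using obx_homeomorphism[OF \<rho>] by blast
  have sub: "g ` H \<subseteq> obx m p \<rho>" using gH closedin_imp_subset by blast
  have 1: "closedin (top_of_set (Esp m)) (\<beta> ` g ` H)" using homeomorphism_imp_closed_map[OF \<beta> gH] .
  have 2: "closedin (top_of_set (Esp m)) (graph_set H)"
    using closed_graph_set[OF c(2,1)] graph_set_sub[OF c(2)] m by (simp add: closed_subset)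
  have "homeomorphism H (graph_set H) (\<lambda>x. x(n := \<theta> x)) (\<lambda>y. y(n := 0))"
  proof (rule homeomorphismI)
    show "continuous_on H (\<lambda>x. x(n := \<theta> x))"
      by (intro continuous_on_fun_upd continuous_on_id continuous_on_subset[OF \<theta>_cont c(2)])
    show "continuous_on (graph_set H) (\<lambda>y. y(n := 0))"
      by (intro continuous_on_fun_upd continuous_on_id continuous_on_const)
    show "(\<lambda>x. x(n := \<theta> x)) ` H \<subseteq> graph_set H" unfolding graph_set_def by blast
    show "(\<lambda>y. y(n := 0)) ` graph_set H \<subseteq> H" using in_graph_set[OF c(2)] by blast
    show "(x(n := \<theta> x))(n := 0) = x" if "x \<in> H" for x using G_coord c(2) that by auto
    show "(y(n := 0))(n := \<theta> (y(n := 0))) = y" if "y \<in> graph_set H" for y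
      using in_graph_set[OF c(2), of y] that by (auto simp: fun_eq_iff)
  qed
  then have h1: "graph_set H homeomorphic H" unfolding homeomorphic_def using homeomorphism_symD by blast
  obtain g' where "homeomorphism D (g ` D) g g'" using homeomorphism_compact[OF D(1,2) refl D(3)] by blast
  then have "homeomorphism H (g ` H) g g'"
    by (rule homeomorphism_of_subsets) (use D(4) c(2) in auto)
  then have h2: "H homeomorphic g ` H" unfolding homeomorphic_def by blast
  have "homeomorphism (g ` H) (\<beta> ` g ` H) \<beta> \<beta>'"
    using homeomorphism_of_subsets[OF \<beta> sub] sub homeomorphism_image1[OF \<beta>] by blast
  then have h3: "g ` H homeomorphic \<beta> ` g ` H" unfolding homeomorphic_def by blast
  have "graph_set H homeomorphic \<beta> ` g ` H"
    using homeomorphic_trans[OF homeomorphic_trans[OF h1 h2] h3] .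
  moreover have "subtopology (top_of_set (Esp m)) (graph_set H) = top_of_set (graph_set H)"
    "subtopology (top_of_set (Esp m)) (\<beta> ` g ` H) = top_of_set (\<beta> ` g ` H)"
    using closedin_imp_subset[OF 1] closedin_imp_subset[OF 2]
    by (simp_all add: subtopology_subtopology Int_absorb1)
  ultimately have "path_connectedin (Euclidean_space m) (topspace (Euclidean_space m) - graph_set H) \<longleftrightarrow>
      path_connectedin (Euclidean_space m) (topspace (Euclidean_space m) - \<beta> ` g ` H)"
    using 1 2 by (intro path_connectedin_Euclidean_complements) (simp_all add: Euclidean_space_eq_top_of_set)
  then have "path_connected (Esp m - graph_set H) \<longleftrightarrow> path_connected (Esp m - \<beta> ` g ` H)"
    unfolding Euclidean_space_eq_top_of_set path_connectedin_top_of_set by simp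
  moreover have "path_connected (Esp m - \<beta> ` g ` H) \<longleftrightarrow> path_connected (obx m p \<rho> - g ` H)"
  proof -
    have inj: "inj_on \<beta> (obx m p \<rho>)" using homeomorphism_apply1[OF \<beta>] by (metis inj_onI)
    have e1: "\<beta> ` (obx m p \<rho> - g ` H) = Esp m - \<beta> ` g ` H"
      using inj_on_image_set_diff[OF inj Diff_subset sub] unfolding homeomorphism_image1[OF \<beta>] .
    have "\<beta>' ` \<beta> ` (obx m p \<rho> - g ` H) = (\<lambda>x. x) ` (obx m p \<rho> - g ` H)"
      unfolding image_image by (rule image_cong[OF refl]) (simp add: homeomorphism_apply1[OF \<beta>])
    then have e2: "\<beta>' ` (Esp m - \<beta> ` g ` H) = obx m p \<rho> - g ` H" unfolding e1 by simp
    have c1: "continuous_on (obx m p \<rho> - g ` H) \<beta>"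
      by (rule continuous_on_subset[OF homeomorphism_cont1[OF \<beta>]]) blast
    have c2: "continuous_on (Esp m - \<beta> ` g ` H) \<beta>'"
      by (rule continuous_on_subset[OF homeomorphism_cont2[OF \<beta>]]) blast
    show ?thesis
      using path_connected_continuous_image[OF c1] path_connected_continuous_image[OF c2] unfolding e1 e2 by blast
  qed
  ultimately show ?thesis by simp
qed

text \<open>The function \<open>\<theta>\<close> sums the reciprocal distances from
  \<open>g u\<close> to the nearest face in each direction, so it blows up where the image of
  \<open>G\<close> leaves the box. Its graph is a closed copy of \<open>G\<close> for which
  separation, and the failure of separation after an open piece is deleted, are elementary.\<close>

lemma box_jordan:
  assumes m: "m = Suc n" and \<rho>: "0 < \<rho>" and D: "compact D" "continuous_on D g" "inj_on g D" "G \<subseteq> D"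
    and gE: "g ` D \<subseteq> Esp m"
    and G: "openin (top_of_set (Esp n)) G" "G \<noteq> {}" "path_connected G" "g ` G \<subseteq> obx m p \<rho>"
    and closed_in_box: "\<And>u. u \<in> closure G \<Longrightarrow> g u \<in> obx m p \<rho> \<Longrightarrow> u \<in> G"
  shows "closedin (top_of_set (obx m p \<rho>)) (g ` G)"
    and "\<not> path_connected (obx m p \<rho> - g ` G)"
    and "\<And>V. V \<subseteq> G \<Longrightarrow> V \<noteq> {} \<Longrightarrow> openin (top_of_set (Esp n)) V \<Longrightarrow> path_connected (obx m p \<rho> - g ` (G - V))"
proof -
  define \<theta> where "\<theta> u = (\<Sum>i<m. 1 / (\<rho> - \<bar>g u i - p i\<bar>))" for u
  have clD: "closure G \<subseteq> D" using D(4) compact_imp_closed[OF D(1)] by (simp add: closure_minimal)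
  have gpos: "0 < \<rho> - \<bar>g u i - p i\<bar>" if "u \<in> G" "i < m" for u i
    using G(4) that unfolding obx_def by force
  have term_pos: "0 < 1 / (\<rho> - \<bar>g u i - p i\<bar>)" if "u \<in> G" "i < m" for u i
    using gpos[OF that] by simp
  have pos: "0 < \<theta> u" if "u \<in> G" for u
    unfolding \<theta>_def using term_pos[OF that] m by (intro sum_pos) auto
  have term_le: "1 / (\<rho> - \<bar>g u i - p i\<bar>) \<le> \<theta> u" if "u \<in> G" "i < m" for u i
    unfolding \<theta>_def using term_pos[OF that(1)] that(2)
    by (intro member_le_sum) (auto intro: less_imp_le)
  have gi: "continuous_on D (\<lambda>u. g u i)" for i by (rule continuous_on_product_then_coordinatewise[OF D(2)])
  have \<theta>c: "continuous_on G \<theta>"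
    unfolding \<theta>_def
  proof (rule continuous_on_sum)
    fix i assume "i \<in> {..<m}"
    then have "\<forall>u\<in>G. \<rho> - \<bar>g u i - p i\<bar> \<noteq> 0" using gpos by fastforce
    then show "continuous_on G (\<lambda>u. 1 / (\<rho> - \<bar>g u i - p i\<bar>))"
      by (intro continuous_on_divide continuous_on_const continuous_on_diff continuous_on_rabs
          continuous_on_subset[OF gi D(4)])
  qed
  have proper: "closed {u \<in> G. \<theta> u \<le> C}" for C
    unfolding closed_sequential_limits
  proof (intro strip)
    fix u :: "nat \<Rightarrow> nat \<Rightarrow> real" and l assume a: "(\<forall>k. u k \<in> {u \<in> G. \<theta> u \<le> C}) \<and> u \<longlonglongrightarrow> l"
    then have uG: "\<And>k. u k \<in> G" and uC: "\<And>k. \<theta> (u k) \<le> C" and lim: "u \<longlonglongrightarrow> l" by auto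
    have Cpos: "0 < C" using pos[OF uG[of 0]] uC[of 0] by linarith
    have lcl: "l \<in> closure G" using uG lim unfolding closure_sequential by blast
    then have lD: "l \<in> D" using clD by blast
    have ev: "\<forall>\<^sub>F k in sequentially. u k \<in> D" using uG D(4) by (intro always_eventually) blast
    have "\<bar>g l i - p i\<bar> < \<rho>" if i: "i < m" for i
    proof -
      have "(\<lambda>k. \<bar>g (u k) i - p i\<bar>) \<longlonglongrightarrow> \<bar>g l i - p i\<bar>"
        by (intro tendsto_intros continuous_on_tendsto_compose[OF gi lim lD ev])
      \<comment> \<open>A bound on \<open>\<theta>\<close> keeps the image at distance at least
        \<open>1 / C\<close> from the faces, so the limit is still inside the open box.\<close>
      moreover have "\<bar>g (u k) i - p i\<bar> \<le> \<rho> - 1 / C" for k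
      proof -
        have "1 / (\<rho> - \<bar>g (u k) i - p i\<bar>) \<le> C" using term_le[OF uG i] uC order_trans by blast
        then show ?thesis using gpos[OF uG[of k] i] Cpos by (simp add: field_simps)
      qed
      ultimately have "\<bar>g l i - p i\<bar> \<le> \<rho> - 1 / C" by (simp add: LIMSEQ_le_const2)
      then show ?thesis using Cpos by (smt (verit) divide_pos_pos)
    qed
    then have "g l \<in> obx m p \<rho>" using gE lD unfolding obx_def by blast
    then have lG: "l \<in> G" using closed_in_box[OF lcl] by blast
    have "(\<lambda>k. \<theta> (u k)) \<longlonglongrightarrow> \<theta> l"
      using continuous_on_tendsto_compose[OF \<theta>c lim lG] uG by simp
    then have "\<theta> l \<le> C" using uC by (simp add: LIMSEQ_le_const2)
    then show "l \<in> {u \<in> G. \<theta> u \<le> C}" using lG by blast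
  qed
  interpret graph_over_open n G \<theta>
    by unfold_locales (use G \<theta>c proper in auto)
  have closed_img: "closedin (top_of_set (obx m p \<rho>)) (g ` (G - V))"
    if V: "openin (top_of_set (Esp n)) V" for V
  proof -
    obtain O' where O': "open O'" "V = Esp n \<inter> O'" using V unfolding openin_open by blast
    have GE: "G \<subseteq> Esp n" using G(1) openin_imp_subset by blast
    have "compact (D \<inter> closure G \<inter> - O')"
      using D(1) O'(1) by (intro compact_Int_closed) auto
    then have "compact (g ` (D \<inter> closure G \<inter> - O'))"
      by (rule compact_continuous_image[OF continuous_on_subset[OF D(2)], rotated]) blast
    then have "closed (g ` (D \<inter> closure G \<inter> - O'))" by (rule compact_imp_closed)
    \<comment> \<open>Inside the box, \<open>closed_in_box\<close> allows \<open>G\<close> to be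
      replaced by its compact closure.\<close>
    moreover have "g ` (G - V) = obx m p \<rho> \<inter> g ` (D \<inter> closure G \<inter> - O')"
    proof
      show "g ` (G - V) \<subseteq> obx m p \<rho> \<inter> g ` (D \<inter> closure G \<inter> - O')"
        using G(4) D(4) closure_subset[of G] GE O'(2) by fastforce
      show "obx m p \<rho> \<inter> g ` (D \<inter> closure G \<inter> - O') \<subseteq> g ` (G - V)"
        using closed_in_box O'(2) by fastforce
    qed
    ultimately show ?thesis using closedin_closed_Int by metis
  qed
  show cl: "closedin (top_of_set (obx m p \<rho>)) (g ` G)" using closed_img[of "{}"] by simp
  show "\<not> path_connected (obx m p \<rho> - g ` G)"
    using path_connected_complement_graph_iff[OF closedin_self subset_refl graph_over_open_axioms m \<rho> D cl]
      complement_not_path_connected m by simp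
  fix V assume V: "V \<subseteq> G" "V \<noteq> {}" "openin (top_of_set (Esp n)) V"
  have "openin (top_of_set G) V" using V(1,3) G_sub openin_subset_trans by blast
  then have "closedin (top_of_set G) (G - V)" by (simp add: closedin_diff)
  then show "path_connected (obx m p \<rho> - g ` (G - V))"
    using path_connected_complement_graph_iff[OF _ Diff_subset graph_over_open_axioms m \<rho> D closed_img[OF V(3)]]
      punctured_complement_path_connected[OF pos G(3) V(1,2)] m by simp
qed

text \<open>A homotopy from the translation by \<open>q1\<close> to the translation by \<open>q2\<close>, passing through the
  perturbation by \<open>\<delta>\<close>, has no zero over the frontier of \<open>U\<close>. Following it only over the points
  where it vanishes at some time yields a nowhere vanishing map that agrees with the
  translation by \<open>q1\<close> outside \<open>U\<close>, although \<open>q1\<close> lies in \<open>U\<close>.\<close>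

lemma perturbed_frontier_separates:
  fixes U P :: "(nat \<Rightarrow> real) set" and \<delta> :: "(nat \<Rightarrow> real) \<Rightarrow> nat \<Rightarrow> real"
    and e :: "real \<Rightarrow> nat \<Rightarrow> real"
  assumes m: "m = Suc n"
    and U: "openin (top_of_set (Esp m)) U" "closure U \<subseteq> cbx m p \<rho>'" "q1 \<in> U" "q2 \<in> Esp m" "q2 \<notin> closure U"
    and q: "q1 \<in> obx m p \<rho>" "q2 \<in> obx m p \<rho>"
    and Fr: "\<And>x. x \<in> closure U \<Longrightarrow> x \<notin> U \<Longrightarrow> x \<in> P \<or> (\<exists>i<m. \<rho>' \<le> \<bar>x i - p i\<bar>)"
    and \<mu>: "\<And>x. x \<in> P \<Longrightarrow> \<exists>i<m. \<mu> \<le> \<bar>x i - q1 i\<bar>" "\<And>x. x \<in> P \<Longrightarrow> \<exists>i<m. \<mu> \<le> \<bar>x i - q2 i\<bar>"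
    and \<delta>: "continuous_on UNIV \<delta>" "\<And>x. \<delta> x \<in> Esp m" "\<And>x i. \<bar>\<delta> x i\<bar> \<le> \<eta>" "\<eta> < \<mu>" "\<eta> < \<rho>' - \<rho>" "0 < \<rho>"
    and e: "continuous_on {0..1} e" "e 0 = q1" "e 1 = q2" "\<And>t. t \<in> {0..1} \<Longrightarrow> e t \<in> obx m p \<rho>"
    and avoid: "\<And>x t. x \<in> P \<Longrightarrow> t \<in> {0..1} \<Longrightarrow> (\<lambda>i. x i + \<delta> x i) \<noteq> e t"
  shows False
proof -
  \<comment> \<open>Time runs over \<open>{0..3}\<close>: during the first unit the perturbation is
    switched on, during the second the target travels along \<open>e\<close> from \<open>q1\<close>
    to \<open>q2\<close>, during the third the perturbation is switched off. Before and after
    travelling, \<open>E\<close> rests at an endpoint.\<close>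
  define c :: "real \<Rightarrow> real" where "c s = min 1 (min s (3 - s))" for s
  define E where "E s = e (max 0 (min 1 (s - 1)))" for s :: real
  define \<Phi> where "\<Phi> x s = (\<lambda>i. x i + c s * \<delta> x i - E s i)" for x s
  have Eb: "E s \<in> obx m p \<rho>" for s unfolding E_def using e(4) by simp
  have UE: "closure U \<subseteq> Esp m" using U(2) unfolding cbx_def by blast
  have \<eta>: "0 \<le> \<eta>" using \<delta>(3)[of p 0] by linarith
  have \<Phi>0: "\<Phi> x 0 = (\<lambda>i. x i - q1 i)" for x unfolding \<Phi>_def c_def E_def using e(2) by simp
  have \<Phi>3: "\<Phi> x 3 = (\<lambda>i. x i - q2 i)" for x unfolding \<Phi>_def c_def E_def using e(3) by simp
  have \<Phi>E: "\<Phi> x s \<in> Esp m" if "x \<in> Esp m" for x s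
    using that \<delta>(2)[of x] Eb[of s] unfolding \<Phi>_def obx_def by auto
  \<comment> \<open>At the sides of the large box a perturbation below
    \<open>\<rho>' - \<rho>\<close> cannot bring a point to the target, which stays within radius
    \<open>\<rho>\<close>. On \<open>P\<close> the resting phases are safe because
    \<open>\<eta> < \<mu>\<close>, the travelling phase by \<open>avoid\<close>.\<close>
  have frontier_nz: "\<exists>i<m. \<Phi> x s i \<noteq> 0" if x: "x \<in> closure U" "x \<notin> U" and s: "s \<in> {0..3}" for x s
  proof -
    have cs: "\<bar>c s\<bar> \<le> 1" using s unfolding c_def by auto
    have cd: "\<bar>c s * \<delta> x i\<bar> \<le> \<eta>" for i
      unfolding abs_mult using mult_mono[OF cs \<delta>(3)[of x i]] \<eta> by simp
    consider "x \<in> P" | i where "i < m" "\<rho>' \<le> \<bar>x i - p i\<bar>" using Fr[OF x] by blast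
    then show ?thesis
    proof cases
      case 2
      have "\<bar>E s i - p i\<bar> < \<rho>" using Eb[of s] 2 unfolding obx_def by blast
      then have "\<Phi> x s i \<noteq> 0" using cd[of i] 2(2) \<delta>(5) unfolding \<Phi>_def by linarith
      then show ?thesis using 2 by blast
    next
      case 1
      consider "s \<le> 1" | "1 \<le> s" "s \<le> 2" | "2 \<le> s" by linarith
      then show ?thesis
      proof cases
        case a: 1
        then have "E s = q1" unfolding E_def using e(2) by simp
        moreover obtain i where "i < m" "\<mu> \<le> \<bar>x i - q1 i\<bar>" using \<mu>(1)[OF 1] by blast
        ultimately show ?thesis using cd[of i] \<delta>(4) unfolding \<Phi>_def by (intro exI[of _ i]) auto
      next
        case b: 2
        then have c1: "c s = 1" unfolding c_def by simp
        have "(\<lambda>i. x i + \<delta> x i) \<noteq> E s" unfolding E_def using avoid[OF 1] by simp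
        then obtain i where i: "x i + \<delta> x i \<noteq> E s i" by (auto simp: fun_eq_iff)
        have "i < m"
        proof (rule ccontr)
          assume "\<not> i < m"
          then have "x i = 0" "\<delta> x i = 0" "E s i = 0"
            using UE x(1) \<delta>(2)[of x] Eb[of s] unfolding obx_def by auto
          then show False using i by simp
        qed
        then show ?thesis using i c1 unfolding \<Phi>_def by auto
      next
        case c: 3
        then have "E s = q2" unfolding E_def using e(3) by simp
        moreover obtain i where "i < m" "\<mu> \<le> \<bar>x i - q2 i\<bar>" using \<mu>(2)[OF 1] by blast
        ultimately show ?thesis using cd[of i] \<delta>(4) unfolding \<Phi>_def by (intro exI[of _ i]) auto
      qed
    qed
  qed
  have contE: "continuous_on UNIV E"
    unfolding E_def by (rule continuous_on_compose2[OF e(1)]) (auto intro!: continuous_intros)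
  have cont\<Phi>: "continuous_on UNIV (\<lambda>z. \<Phi> (fst z) (snd z))"
    unfolding \<Phi>_def
  proof (rule continuous_on_coordinatewise_then_product)
    fix i
    have "continuous_on UNIV (\<lambda>z::(nat\<Rightarrow>real)\<times>real. fst z i)"
      by (rule continuous_on_product_then_coordinatewise[OF continuous_on_fst[OF continuous_on_id]])
    moreover have "continuous_on UNIV (\<lambda>z::(nat\<Rightarrow>real)\<times>real. \<delta> (fst z) i)"
      by (rule continuous_on_compose2[OF continuous_on_product_then_coordinatewise[OF \<delta>(1)]])
        (auto intro!: continuous_on_fst continuous_on_id)
    moreover have "continuous_on UNIV (\<lambda>z::(nat\<Rightarrow>real)\<times>real. E (snd z) i)"
      by (rule continuous_on_compose2[OF continuous_on_product_then_coordinatewise[OF contE]])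
        (auto intro!: continuous_on_snd continuous_on_id)
    moreover have "continuous_on UNIV (\<lambda>z::(nat\<Rightarrow>real)\<times>real. c (snd z))"
      unfolding c_def by (intro continuous_intros)
    ultimately show "continuous_on UNIV (\<lambda>z. fst z i + c (snd z) * \<delta> (fst z) i - E (snd z) i)"
      by (intro continuous_on_diff continuous_on_add continuous_on_mult)
  qed
  have compU: "compact (closure U)"
    using compact_Int_closed[OF compact_cbx closed_closure, of m p \<rho>' U] U(2) by (simp add: Int_absorb1)
  \<comment> \<open>The points over which the homotopy vanishes at some time. Both this set and the
    frontier are closed, and they are disjoint, so an Urysohn function can serve as a clock.\<close>
  define Z where "Z = fst ` {z \<in> closure U \<times> {0..3}. \<Phi> (fst z) (snd z) = (\<lambda>i. 0)}"
  have "compact Z"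
  proof -
    have "closed {z. \<Phi> (fst z) (snd z) = (\<lambda>i. 0)}"
      by (rule closed_Collect_eq[OF cont\<Phi> continuous_on_const])
    then have "compact ((closure U \<times> {0..3}) \<inter> {z. \<Phi> (fst z) (snd z) = (\<lambda>i. 0)})"
      using compU by (intro compact_Int_closed compact_Times) auto
    then show ?thesis unfolding Z_def
      by (intro compact_continuous_image continuous_on_fst continuous_on_id) (simp add: Collect_conj_eq)
  qed
  then have clZ: "closed Z" by (rule compact_imp_closed)
  have clFr: "closed (closure U - U)"
  proof -
    obtain O' where O': "open O'" "U = Esp m \<inter> O'" using U(1) unfolding openin_open by blast
    then have "closure U - U = closure U \<inter> - O'" using UE by blast
    then show ?thesis using O'(1) by auto
  qed
  have "disjnt (closure U - U) Z"
    unfolding disjnt_def Z_def using frontier_nz by fastforce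
  then obtain l :: "(nat \<Rightarrow> real) \<Rightarrow> real" where l: "continuous_on UNIV l" "l ` (closure U - U) \<subseteq> {0}" "l ` Z \<subseteq> {3}"
    using Urysohn_lemma_alt[of "euclidean :: (nat \<Rightarrow> real) topology" "closure U - U" Z 0 3]
      metrizable_imp_normal_space[OF metrizable_space_euclidean] clFr clZ by auto
  define \<kappa> where "\<kappa> x = max 0 (min 3 (l x))" for x
  \<comment> \<open>At a zero of \<open>k\<close> the point lies in \<open>Z\<close>, where the
    clock shows 3 and \<open>k\<close> is the translation by \<open>q2\<close>; its only zero
    \<open>q2\<close> is outside the closure of \<open>U\<close>.\<close>
  define k where "k x = \<Phi> x (\<kappa> x)" for x
  have contk: "continuous_on S k" for S
  proof -
    have "continuous_on S (\<lambda>x. (x, \<kappa> x))"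
      unfolding \<kappa>_def by (intro continuous_intros continuous_on_subset[OF l(1)]) auto
    then show ?thesis
      using continuous_on_compose2[OF cont\<Phi>, of S "\<lambda>x. (x, \<kappa> x)"] unfolding k_def by simp
  qed
  have k_nz: "\<exists>i\<le>n. k x i \<noteq> 0" if x: "x \<in> closure U" for x
  proof (rule ccontr)
    assume "\<not> ?thesis"
    moreover have "k x \<in> Esp m" unfolding k_def using \<Phi>E UE x by blast
    ultimately have "k x i = 0" for i using m by (cases "i \<le> n") auto
    then have z: "k x = (\<lambda>i. 0)" by blast
    have "\<kappa> x \<in> {0..3}" unfolding \<kappa>_def by auto
    then have "(x, \<kappa> x) \<in> {z \<in> closure U \<times> {0..3}. \<Phi> (fst z) (snd z) = (\<lambda>i. 0)}"
      using z x unfolding k_def by simp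
    then have "x \<in> Z" unfolding Z_def by (metis (no_types, lifting) fst_conv imageI)
    then have "l x = 3" using l(3) by blast
    then have "k x = (\<lambda>i. x i - q2 i)" unfolding k_def \<kappa>_def using \<Phi>3 by simp
    then have "x = q2" using z by (auto simp: fun_eq_iff)
    then show False using x U(5) by simp
  qed
  \<comment> \<open>On the frontier the clock shows 0, where the homotopy is the translation by
    \<open>q1\<close>, so the two pieces fit together.\<close>
  define K where "K x = (if x \<in> closure U then k x else (\<lambda>i. x i - q1 i))" for x
  have k_Fr: "k x = (\<lambda>i. x i - q1 i)" if "x \<in> closure U" "x \<notin> U" for x
  proof -
    have "l x = 0" using l(2) that by blast
    then show ?thesis unfolding k_def \<kappa>_def using \<Phi>0 by simp
  qed
  have contK: "continuous_on (closure U \<union> (Esp m - U)) K"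
    unfolding K_def
  proof (rule continuous_on_cases)
    show "closed (Esp m - U)"
    proof -
      obtain O' where O': "open O'" "U = Esp m \<inter> O'" using U(1) unfolding openin_open by blast
      then have "Esp m - U = Esp m \<inter> - O'" by blast
      then show ?thesis using closed_Int[OF closed_Esp closed_Compl[OF O'(1)]] by simp
    qed
    show "continuous_on (Esp m - U) (\<lambda>x i. x i - q1 i)"
      by (intro continuous_on_coordinatewise_then_product continuous_intros)
    show "\<forall>x. x \<in> closure U \<and> x \<notin> closure U \<or> x \<in> Esp m - U \<and> x \<in> closure U \<longrightarrow> k x = (\<lambda>i. x i - q1 i)"
      using k_Fr by blast
  qed (use contk in auto)
  have un: "closure U \<union> (Esp m - U) = Esp m" using UE closure_subset[of U] by blast
  have q1E: "q1 \<in> Esp m" using q(1) unfolding obx_def by blast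
  \<comment> \<open>More than the Euclidean distance from \<open>q1\<close> to any point of
    \<open>closure U\<close>, since each of the \<open>m\<close> coordinates differs by at most
    \<open>2 * \<rho>'\<close>.\<close>
  define R where "R = sqrt (real m * (2 * \<rho>')\<^sup>2 + 1)"
  have R2: "R\<^sup>2 = real m * (2 * \<rho>')\<^sup>2 + 1" unfolding R_def by (simp add: add_nonneg_nonneg)
  show False
  proof (rule no_nonvanishing_translation_extension[of n K q1 R])
    show "continuous_on (Esp (Suc n)) K" using contK un m by simp
    show "K ` Esp (Suc n) \<subseteq> Esp (Suc n)"
      unfolding K_def k_def using \<Phi>E q1E m by auto
    show "q1 \<in> Esp (Suc n)" using q1E m by simp
    show "0 < R" unfolding R_def by (simp add: add_nonneg_pos)
    show "\<exists>i\<le>n. K x i \<noteq> 0" if x: "x \<in> Esp (Suc n)" for x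
    proof (cases "x \<in> closure U")
      case True
      then show ?thesis using k_nz K_def by simp
    next
      case False
      then have "x \<noteq> q1" using U(3) closure_subset by blast
      then obtain i where i: "x i \<noteq> q1 i" by (auto simp: fun_eq_iff)
      then have "i \<le> n" using x q1E m by (cases "i \<le> n") auto
      then show ?thesis using i False unfolding K_def by auto
    qed
    show "K x = (\<lambda>i. x i - q1 i)" if x: "x \<in> Esp (Suc n)" "(\<Sum>i\<le>n. (x i - q1 i)\<^sup>2) = R\<^sup>2" for x
    proof -
      have "x \<notin> closure U"
      proof
        assume "x \<in> closure U"
        then have "x \<in> cbx m p \<rho>'" using U(2) by blast
        then have "(x i - q1 i)\<^sup>2 \<le> (2 * \<rho>')\<^sup>2" if "i \<le> n" for i
        proof -
          have "\<bar>x i - p i\<bar> \<le> \<rho>'" "\<bar>q1 i - p i\<bar> < \<rho>"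
            using \<open>x \<in> cbx m p \<rho>'\<close> q(1) that m unfolding cbx_def obx_def by auto
          then have "\<bar>x i - q1 i\<bar> \<le> \<bar>2 * \<rho>'\<bar>" using \<delta>(5) \<eta> by linarith
          then show ?thesis by (simp only: abs_le_square_iff)
        qed
        then have "(\<Sum>i\<le>n. (x i - q1 i)\<^sup>2) \<le> (\<Sum>i\<le>n. (2 * \<rho>')\<^sup>2)" by (intro sum_mono) auto
        also have "\<dots> = real m * (2 * \<rho>')\<^sup>2" using m by simp
        finally show False using x(2) R2 by simp
      qed
      then show ?thesis unfolding K_def by simp
    qed
  qed
qed

section \<open>Two points separated by a disc and by all its small perturbations\<close>

lemma openin_path_component_Esp:
  assumes S: "openin (top_of_set (Esp m)) S"
  shows "openin (top_of_set (Esp m)) {y. path_component S x y}"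
proof -
  have "locally_path_connected_space (top_of_set (Esp m))"
    using locally_path_connected_Euclidean_space[of m] unfolding Euclidean_space_eq_top_of_set .
  then have "locally_path_connected_space (subtopology (top_of_set (Esp m)) S)"
    using S by (rule locally_path_connected_space_open_subset)
  moreover have "subtopology (top_of_set (Esp m)) S = top_of_set S"
    using openin_imp_subset[OF S] by (simp add: subtopology_subtopology Int_absorb1)
  ultimately have "openin (top_of_set S) (Collect (path_component_of (top_of_set S) x))"
    using openin_path_component_of_locally_path_connected_space by metis
  then show ?thesis unfolding path_component_of_top_of_set using openin_trans[OF _ S] by blast
qed

text \<open>The sum of the coordinate distances to \<open>q\<close> has a positive minimum over
  \<open>D\<close>. If all \<open>m\<close> coordinate distances were below that minimum divided by
  \<open>m + 1\<close>, their sum would fall short of it.\<close>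

lemma coordinate_gap:
  assumes D: "compact D" "continuous_on D g" "g ` D \<subseteq> Esp m" and q: "q \<in> Esp m" "q \<notin> g ` D"
  obtains \<mu> where "0 < \<mu>" "\<And>x. x \<in> g ` D \<Longrightarrow> \<exists>i<m. \<mu> \<le> \<bar>x i - q i\<bar>"
proof (cases "D = {}")
  case True
  then show ?thesis using that[of 1] by auto
next
  case False
  define s where "s u = (\<Sum>i<m. \<bar>g u i - q i\<bar>)" for u
  have "continuous_on D s"
    unfolding s_def
    by (intro continuous_on_sum continuous_on_rabs continuous_on_diff continuous_on_const
        continuous_on_product_then_coordinatewise[OF D(2)])
  then obtain u where u: "u \<in> D" "\<And>v. v \<in> D \<Longrightarrow> s u \<le> s v"
    using continuous_attains_inf[OF D(1) False] by metis
  have "0 < s u"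
  proof -
    have "g u \<noteq> q" using u q by blast
    then obtain i where i: "g u i \<noteq> q i" by (auto simp: fun_eq_iff)
    have "g u \<in> Esp m" using D(3) u(1) by blast
    then have "i < m" using i q(1) by (cases "i < m") auto
    then show ?thesis unfolding s_def using i by (intro sum_pos2[of _ i]) auto
  qed
  show ?thesis
  proof (rule that[of "s u / (real m + 1)"])
    fix x assume "x \<in> g ` D"
    then obtain v where v: "v \<in> D" "x = g v" by auto
    show "\<exists>i<m. s u / (real m + 1) \<le> \<bar>x i - q i\<bar>"
    proof (rule ccontr)
      assume "\<not> ?thesis"
      then have "s v \<le> (\<Sum>i<m. s u / (real m + 1))"
        unfolding s_def v(2) by (intro sum_mono) (auto simp: not_le intro: less_imp_le)
      also have "\<dots> = real m * s u / (real m + 1)" by simp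
      also have "\<dots> < s u" using \<open>0 < s u\<close> by (simp add: field_simps)
      finally show False using u(2)[OF v(1)] by simp
    qed
  qed (use \<open>0 < s u\<close> in auto)
qed

text \<open>The points \<open>q1\<close> and \<open>q2\<close> are taken near \<open>p\<close> on the two sides of a connected piece of
  the disc; a Tietze extension of \<open>g' - g\<close> supplies the perturbation.\<close>

lemma stable_separation:
  fixes g :: "(nat \<Rightarrow> real) \<Rightarrow> nat \<Rightarrow> real"
  assumes m: "m = Suc n" and D: "D = cbx n u0 r" and u0: "u0 \<in> Esp n" and r: "0 < r0" "r0 \<le> r"
    and g: "continuous_on D g" "inj_on g D" "g ` D \<subseteq> Esp m"
    and \<rho>: "0 < \<rho>0" "\<rho>0 \<le> \<rho>" "\<rho> < \<rho>'"
    and core: "\<And>u. u \<in> D \<Longrightarrow> g u \<in> cbx m (g u0) \<rho>' \<Longrightarrow> u \<in> obx n u0 r"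
    and core0: "\<And>u. u \<in> D \<Longrightarrow> g u \<in> obx m (g u0) \<rho>0 \<Longrightarrow> u \<in> obx n u0 r0"
    and img0: "g ` obx n u0 r0 \<subseteq> obx m (g u0) \<rho>'"
  obtains q1 q2 \<eta> where "0 < \<eta>" "q1 \<in> obx m (g u0) \<rho>0" "q2 \<in> obx m (g u0) \<rho>0"
    "\<And>g'. continuous_on D g' \<Longrightarrow> g' ` D \<subseteq> Esp m \<Longrightarrow> (\<And>u i. u \<in> D \<Longrightarrow> i < m \<Longrightarrow> \<bar>g' u i - g u i\<bar> \<le> \<eta>) \<Longrightarrow>
       q1 \<notin> g' ` D \<and> q2 \<notin> g' ` D \<and> \<not> path_component (obx m (g u0) \<rho> - g' ` D) q1 q2"
proof -
  let ?p = "g u0"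
  let ?B = "obx m ?p \<rho>'"
  have \<rho>': "0 < \<rho>'" using \<rho> by linarith
  have compD: "compact D" unfolding D by (rule compact_cbx)
  have DE: "D \<subseteq> Esp n" unfolding D cbx_def by blast
  have obD: "obx n u0 r \<subseteq> D" unfolding D by (rule obx_sub_cbx)
  have ob0: "obx n u0 r0 \<subseteq> obx n u0 r" using obx_mono r by blast
  have u00: "u0 \<in> obx n u0 r0" unfolding obx_def using u0 r by simp
  have u0D: "u0 \<in> D" using u00 ob0 obD by blast
  have pE: "?p \<in> Esp m" using g(3) u0D by blast
  have p0: "?p \<in> obx m ?p \<rho>0" unfolding obx_def using pE \<rho> by simp
  have pre: "openin (top_of_set (Esp n)) {u \<in> obx n u0 r. g u \<in> obx m ?p s}" for s
  proof -
    obtain O' where O': "open O'" "obx m ?p s = Esp m \<inter> O'" using openin_obx[of m ?p s] unfolding openin_open by blast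
    have "continuous_on (obx n u0 r) g" by (rule continuous_on_subset[OF g(1) obD])
    then have "openin (top_of_set (obx n u0 r)) (obx n u0 r \<inter> g -` O')"
      using continuous_openin_preimage_gen O'(1) by blast
    moreover have "obx n u0 r \<inter> g -` O' = {u \<in> obx n u0 r. g u \<in> obx m ?p s}"
      using O'(2) g(3) obD by blast
    ultimately show ?thesis using openin_trans[OF _ openin_obx] by simp
  qed
  define G0 where "G0 = {u \<in> obx n u0 r. g u \<in> ?B}"
  \<comment> \<open>The disc may enter the box in several pieces, while \<open>box_jordan\<close>
    needs a path connected one; the piece through the centre is taken.\<close>
  define G where "G = {u. path_component G0 u0 u}"
  have G0o: "openin (top_of_set (Esp n)) G0" unfolding G0_def by (rule pre)
  have Go: "openin (top_of_set (Esp n)) G" unfolding G_def by (rule openin_path_component_Esp[OF G0o])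
  have GG0: "G \<subseteq> G0" unfolding G_def using path_component_mem(2) by blast
  have GD: "G \<subseteq> D" using GG0 obD unfolding G0_def by blast
  have ob0G: "obx n u0 r0 \<subseteq> G"
  proof
    fix u assume u: "u \<in> obx n u0 r0"
    have "obx n u0 r0 \<subseteq> G0" unfolding G0_def using img0 ob0 by blast
    then show "u \<in> G" unfolding G_def
      using path_component_of_subset obx_path_component[OF u00 u] by blast
  qed
  have Gne: "G \<noteq> {}" using u00 ob0G by blast
  have Gpc: "path_connected G"
    unfolding G_def by (rule path_connected_path_component)
  have Gimg: "g ` G \<subseteq> ?B" using GG0 unfolding G0_def by blast
  have closed_in_box: "u \<in> G" if u: "u \<in> closure G" "g u \<in> ?B" for u
  proof -
    have uD: "u \<in> D" using u(1) closure_minimal[OF GD compact_imp_closed[OF compD]] by blast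
    have "u \<in> obx n u0 r" using core[OF uD] u(2) obx_sub_cbx by blast
    then have uG0: "u \<in> G0" unfolding G0_def using u(2) by blast
    \<comment> \<open>The path component of the limit point in \<open>G0\<close> is open, so it
      meets \<open>G\<close> and is the same component.\<close>
    define G' where "G' = {v. path_component G0 u v}"
    have G'o: "openin (top_of_set (Esp n)) G'" unfolding G'_def by (rule openin_path_component_Esp[OF G0o])
    have uG': "u \<in> G'" unfolding G'_def using path_component_refl[OF uG0] by simp
    obtain O' where O': "open O'" "G' = Esp n \<inter> O'" using G'o unfolding openin_open by blast
    have "O' \<inter> G \<noteq> {}" using O' u(1) uG' open_Int_closure_eq_empty[OF O'(1), of G] by blast
    then obtain v where v: "v \<in> O'" "v \<in> G" by blast
    then have "v \<in> G'" using O'(2) GD DE by blast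
    then have "path_component G0 u v" "path_component G0 u0 v" using v(2) unfolding G_def G'_def by auto
    then show ?thesis unfolding G_def using path_component_trans path_component_sym by blast
  qed
  have J: "closedin (top_of_set ?B) (g ` G)" "\<not> path_connected (?B - g ` G)"
    "\<And>V. V \<subseteq> G \<Longrightarrow> V \<noteq> {} \<Longrightarrow> openin (top_of_set (Esp n)) V \<Longrightarrow> path_connected (?B - g ` (G - V))"
    using box_jordan[OF m \<rho>' compD g(1,2) GD g(3) Go Gne Gpc Gimg] closed_in_box by blast+
  define S where "S = ?B - g ` G"
  have BE: "?B \<subseteq> Esp m" unfolding obx_def by blast
  have So: "openin (top_of_set (Esp m)) S"
  proof -
    have "openin (top_of_set ?B) S" unfolding S_def using J(1) by (simp add: openin_diff)
    then show ?thesis using openin_trans openin_obx by blast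
  qed
  obtain z1 z2 where z: "z1 \<in> S" "z2 \<in> S" "\<not> path_component S z1 z2"
    using J(2) unfolding S_def path_connected_component by blast
  define U1 where "U1 = {y. path_component S z1 y}"
  \<comment> \<open>Not one component but the union of all others, so that \<open>U1\<close> and
    \<open>U2\<close> exhaust the complement.\<close>
  define U2 where "U2 = S - U1"
  have U1S: "U1 \<subseteq> S" unfolding U1_def using path_component_mem(2) by blast
  have U1o: "openin (top_of_set (Esp m)) U1" unfolding U1_def by (rule openin_path_component_Esp[OF So])
  have U2o: "openin (top_of_set (Esp m)) U2"
  proof -
    have "U2 = (\<Union>y\<in>U2. {w. path_component S y w})"
    proof
      show "U2 \<subseteq> (\<Union>y\<in>U2. {w. path_component S y w})"
        unfolding U2_def using path_component_refl by blast
      show "(\<Union>y\<in>U2. {w. path_component S y w}) \<subseteq> U2"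
        unfolding U2_def U1_def using path_component_trans path_component_sym path_component_mem(2) by blast
    qed
    moreover have "openin (top_of_set (Esp m)) (\<Union>y\<in>U2. {w. path_component S y w})"
      by (intro openin_Union) (auto intro: openin_path_component_Esp[OF So])
    ultimately show ?thesis by simp
  qed
  have ne: "z1 \<in> U1" "z2 \<in> U2" unfolding U2_def U1_def using z path_component_refl by auto
  define V where "V = {u \<in> obx n u0 r. g u \<in> obx m ?p \<rho>0}"
  have Vo: "openin (top_of_set (Esp n)) V" unfolding V_def by (rule pre)
  have VG: "V \<subseteq> G" unfolding V_def using core0 obD ob0G by blast
  have "u0 \<in> V" unfolding V_def using p0 u00 ob0 by blast
  \<comment> \<open>Opening the wall over \<open>V\<close>, whose image has radius below
    \<open>\<rho>0\<close>, makes the complement connected. Hence both sides reach into the inner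
    box, where \<open>q1\<close> and \<open>q2\<close> are chosen.\<close>
  define S' where "S' = ?B - g ` (G - V)"
  have "path_connected S'" unfolding S'_def using J(3)[OF VG _ Vo] \<open>u0 \<in> V\<close> by (metis empty_iff)
  then have conS': "connected S'" by (rule path_connected_imp_connected)
  have S'dec: "S' = U1 \<union> U2 \<union> g ` V"
  proof -
    have "inj_on g G" using g(2) GD inj_on_subset by blast
    then have "g ` (G - V) = g ` G - g ` V" using inj_on_image_set_diff VG by (metis Diff_subset)
    then have "S' = S \<union> g ` V" unfolding S'_def S_def using VG Gimg by blast
    then show ?thesis unfolding U2_def using U1S by blast
  qed
  have gV: "g ` V \<subseteq> obx m ?p \<rho>0" unfolding V_def by blast
  have touch: "U \<inter> obx m ?p \<rho>0 \<noteq> {}"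
    if UW: "openin (top_of_set (Esp m)) U" "openin (top_of_set (Esp m)) W" "U \<union> W \<union> g ` V = S'" "U \<noteq> {}" "W \<noteq> {}" "U \<inter> W = {}" for U W
  proof
    assume e: "U \<inter> obx m ?p \<rho>0 = {}"
    obtain OU where OU: "open OU" "U = Esp m \<inter> OU" using UW(1) unfolding openin_open by blast
    obtain OW where OW: "open OW" "W \<union> obx m ?p \<rho>0 = Esp m \<inter> OW"
      using openin_Un[OF UW(2) openin_obx] unfolding openin_open by blast
    have SE: "S' \<subseteq> Esp m" unfolding S'_def using BE by blast
    have sub: "U \<subseteq> OU" "W \<subseteq> OW" "g ` V \<subseteq> OW" "U \<subseteq> S'" "W \<subseteq> S'" using OU(2) OW(2) gV UW(3) by blast+
    have "OU \<inter> OW \<inter> S' \<subseteq> U \<inter> (W \<union> obx m ?p \<rho>0)" unfolding OU(2) OW(2) using SE by blast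
    then have "OU \<inter> OW \<inter> S' = {}" using e UW(6) by blast
    moreover have "S' \<subseteq> OU \<union> OW" using UW(3) sub(1-3) by blast
    ultimately have "OU \<inter> S' = {} \<or> OW \<inter> S' = {}" by (rule connectedD[OF conS' OU(1) OW(1)])
    then show False using sub UW(4,5) by blast
  qed
  obtain q1 where q1: "q1 \<in> U1" "q1 \<in> obx m ?p \<rho>0"
    using touch[OF U1o U2o] S'dec ne unfolding U2_def by blast
  obtain q2 where q2: "q2 \<in> U2" "q2 \<in> obx m ?p \<rho>0"
    using touch[OF U2o U1o] S'dec ne unfolding U2_def by blast
  \<comment> \<open>In the inner box the disc has no piece except the one over \<open>G\<close>, so
    a point off that piece avoids the whole disc.\<close>
  have gD0: "g ` D \<inter> obx m ?p \<rho>0 \<subseteq> g ` G" using core0 ob0G by blast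
  have q1D: "q1 \<notin> g ` D" and q2D: "q2 \<notin> g ` D"
    using gD0 q1 q2 U1S unfolding U2_def S_def by blast+
  have qE: "q1 \<in> Esp m" "q2 \<in> Esp m" using q1 q2 unfolding obx_def by auto
  obtain \<mu>1 where \<mu>1: "0 < \<mu>1" "\<And>x. x \<in> g ` D \<Longrightarrow> \<exists>i<m. \<mu>1 \<le> \<bar>x i - q1 i\<bar>"
    using coordinate_gap[OF compD g(1,3) qE(1) q1D] by blast
  obtain \<mu>2 where \<mu>2: "0 < \<mu>2" "\<And>x. x \<in> g ` D \<Longrightarrow> \<exists>i<m. \<mu>2 \<le> \<bar>x i - q2 i\<bar>"
    using coordinate_gap[OF compD g(1,3) qE(2) q2D] by blast
  define \<mu> where "\<mu> = min \<mu>1 \<mu>2"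
  have \<mu>: "0 < \<mu>" "\<And>x. x \<in> g ` D \<Longrightarrow> \<exists>i<m. \<mu> \<le> \<bar>x i - q1 i\<bar>" "\<And>x. x \<in> g ` D \<Longrightarrow> \<exists>i<m. \<mu> \<le> \<bar>x i - q2 i\<bar>"
    unfolding \<mu>_def using \<mu>1 \<mu>2 by (auto simp: min_le_iff_disj)
  \<comment> \<open>Less than the distance of \<open>q1\<close> and \<open>q2\<close> from the disc
    and less than the margin between the two boxes, as the homotopy requires.\<close>
  define \<eta> where "\<eta> = min (\<mu>/2) ((\<rho>' - \<rho>)/2)"
  have \<eta>: "0 < \<eta>" "\<eta> < \<mu>" "\<eta> < \<rho>' - \<rho>" unfolding \<eta>_def min_less_iff_disj using \<mu>(1) \<rho> by auto
  have clU: "closure U1 \<subseteq> cbx m ?p \<rho>'"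
    using U1S obx_sub_cbx closed_cbx unfolding S_def by (intro closure_minimal) blast+
  have disj: "x \<notin> closure U1" if "x \<in> U2" for x
  proof
    assume x: "x \<in> closure U1"
    obtain O' where O': "open O'" "U2 = Esp m \<inter> O'" using U2o unfolding openin_open by blast
    have "O' \<inter> U1 \<noteq> {}" using x that O'(2) open_Int_closure_eq_empty[OF O'(1), of U1] by blast
    moreover have "U1 \<subseteq> Esp m" using U1S BE unfolding S_def by blast
    ultimately show False using O'(2) unfolding U2_def by blast
  qed
  show ?thesis
  proof (rule that[OF \<eta>(1) q1(2) q2(2)])
    fix g' assume g': "continuous_on D g'" "g' ` D \<subseteq> Esp m" "\<And>u i. u \<in> D \<Longrightarrow> i < m \<Longrightarrow> \<bar>g' u i - g u i\<bar> \<le> \<eta>"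
    have notin: "q \<notin> g' ` D" if q: "\<And>x. x \<in> g ` D \<Longrightarrow> \<exists>i<m. \<mu> \<le> \<bar>x i - q i\<bar>" for q
    proof
      assume "q \<in> g' ` D"
      then obtain u where u: "u \<in> D" "q = g' u" by blast
      then obtain i where "i < m" "\<mu> \<le> \<bar>g u i - g' u i\<bar>" using q[of "g u"] by blast
      then show False using g'(3)[OF u(1), of i] \<eta>(2) by linarith
    qed
    have "\<not> path_component (obx m ?p \<rho> - g' ` D) q1 q2"
    proof
      assume "path_component (obx m ?p \<rho> - g' ` D) q1 q2"
      then obtain e where e: "path e" "path_image e \<subseteq> obx m ?p \<rho> - g' ` D" "e 0 = q1" "e 1 = q2"
        unfolding path_component_def pathstart_def pathfinish_def by blast
      obtain h where h: "homeomorphism D (g ` D) g h" using homeomorphism_compact[OF compD g(1) refl g(2)] by blast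
      have clgD: "closedin (top_of_set UNIV) (g ` D)"
        using compact_imp_closed[OF compact_continuous_image[OF g(1) compD]] by simp
      have "\<exists>\<Delta>. continuous_on UNIV \<Delta> \<and> (\<forall>x\<in>g ` D. \<Delta> x = g' (h x) i - x i) \<and> (\<forall>x. \<bar>\<Delta> x\<bar> \<le> \<eta>)" if "i < m" for i
      proof -
        have c1: "continuous_on (g ` D) (\<lambda>x. g' (h x) i - x i)"
        proof (intro continuous_on_diff continuous_on_coord)
          have "continuous_on (g ` D) (\<lambda>x. g' (h x))"
            by (rule continuous_on_compose2[OF g'(1) homeomorphism_cont2[OF h]])
              (use homeomorphism_image2[OF h] in blast)
          then show "continuous_on (g ` D) (\<lambda>x. g' (h x) i)" by (rule continuous_on_product_then_coordinatewise)
        qed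
        have c2: "norm (g' (h x) i - x i) \<le> \<eta>" if x: "x \<in> g ` D" for x
        proof -
          have "h x \<in> D" using x homeomorphism_image2[OF h] by blast
          then show ?thesis using g'(3)[of "h x" i] homeomorphism_apply2[OF h x] \<open>i < m\<close> by simp
        qed
        show ?thesis
          by (rule Tietze[OF c1 clgD less_imp_le[OF \<eta>(1)] c2]) auto
      qed
      then obtain \<Delta> where \<Delta>: "\<And>i. i < m \<Longrightarrow> continuous_on UNIV (\<Delta> i)"
        "\<And>i x. i < m \<Longrightarrow> x \<in> g ` D \<Longrightarrow> \<Delta> i x = g' (h x) i - x i" "\<And>i x. i < m \<Longrightarrow> \<bar>\<Delta> i x\<bar> \<le> \<eta>" by metis
      define \<delta> where "\<delta> x = (\<lambda>i. if i < m then \<Delta> i x else 0)" for x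
      show False
      proof (rule perturbed_frontier_separates[where U = U1 and P = "g ` D" and \<delta> = \<delta> and e = e and m = m and n = n
            and p = ?p and \<rho>' = \<rho>' and \<rho> = \<rho> and ?q1.0 = q1 and ?q2.0 = q2 and \<mu> = \<mu> and \<eta> = \<eta>])
        show "continuous_on UNIV \<delta>" unfolding \<delta>_def
        proof (rule continuous_on_coordinatewise_then_product)
          fix i show "continuous_on UNIV (\<lambda>x. if i < m then \<Delta> i x else 0)"
            using \<Delta>(1)[of i] by (cases "i < m") auto
        qed
        show "\<bar>\<delta> x i\<bar> \<le> \<eta>" for x i unfolding \<delta>_def using \<Delta>(3) \<eta>(1) by simp
        \<comment> \<open>A frontier point of \<open>U1\<close> inside the box cannot lie in the
          disjoint open set \<open>U2\<close>, so it lies on the image of \<open>G\<close>; the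
          others are on the sides of the box.\<close>
        show "x \<in> g ` D \<or> (\<exists>i<m. \<rho>' \<le> \<bar>x i - ?p i\<bar>)" if x: "x \<in> closure U1" "x \<notin> U1" for x
        proof (cases "x \<in> ?B")
          case True
          then have "x \<in> S \<or> x \<in> g ` G" unfolding S_def by blast
          then show ?thesis using disj[of x] x GD unfolding U2_def by blast
        next
          case False
          moreover have "x \<in> Esp m" using clU x(1) unfolding cbx_def by blast
          ultimately show ?thesis unfolding obx_def by (auto simp: not_less)
        qed
        show "(\<lambda>i. x i + \<delta> x i) \<noteq> e t" if x: "x \<in> g ` D" and t: "t \<in> {0..1}" for x t
        proof
          assume eq: "(\<lambda>i. x i + \<delta> x i) = e t"
          have hx: "h x \<in> D" using x homeomorphism_image2[OF h] by blast
          then have "g' (h x) \<in> Esp m" using g'(2) by blast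
          moreover have "x \<in> Esp m" using x g(3) by blast
          ultimately have "x i + \<delta> x i = g' (h x) i" for i
            unfolding \<delta>_def using \<Delta>(2)[OF _ x, of i] by (cases "i < m") auto
          then have "e t = g' (h x)" using eq by auto
          then have "e t \<in> g' ` D" using hx by blast
          then show False using e(2) t unfolding path_image_def by blast
        qed
        show "continuous_on {0..1} e" using e(1) unfolding path_def .
        show "e t \<in> obx m ?p \<rho>" if "t \<in> {0..1}" for t using e(2) that unfolding path_image_def by blast
        show "q1 \<in> obx m ?p \<rho>" "q2 \<in> obx m ?p \<rho>" using q1 q2 obx_mono[OF \<rho>(2)] by blast+
        show "q2 \<notin> closure U1" using disj q2 by blast
        show "\<delta> x \<in> Esp m" for x unfolding \<delta>_def by simp
        show "0 < \<rho>" using \<rho> by linarith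
      qed (use m U1o clU q1 qE \<mu> \<eta> e in auto)
    qed
    then show "q1 \<notin> g' ` D \<and> q2 \<notin> g' ` D \<and> \<not> path_component (obx m ?p \<rho> - g' ` D) q1 q2"
      using notin[OF \<mu>(2)] notin[OF \<mu>(3)] by blast
  qed
qed

section \<open>The order of crossing\<close>

lemma path_component_of_subpath:
  assumes c: "pathin X c" and ab: "a \<in> {0..1}" "b \<in> {0..1}"
    and S: "\<And>t. min a b \<le> t \<Longrightarrow> t \<le> max a b \<Longrightarrow> c t \<in> S"
  shows "path_component_of (subtopology X S) (c a) (c b)"
  unfolding path_component_of_def
proof (intro exI conjI)
  let ?g = "\<lambda>s. (1 - s) * a + s * b"
  have g: "min a b \<le> ?g s" "?g s \<le> max a b" if "s \<in> {0..1}" for s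
  proof -
    have "(1 - s) * min a b + s * min a b \<le> ?g s" "?g s \<le> (1 - s) * max a b + s * max a b"
      using that by (intro add_mono mult_left_mono; simp)+
    then show "min a b \<le> ?g s" "?g s \<le> max a b" by (simp_all add: algebra_simps)
  qed
  have "continuous_map (top_of_set {0..1}) (top_of_set {0..1}) ?g"
  proof -
    have "continuous_on {0..1} ?g" by (intro continuous_intros)
    moreover have "?g \<in> {0..1} \<rightarrow> {0..1}" using g ab by (smt (verit) Pi_I atLeastAtMost_iff)
    ultimately show ?thesis by (simp add: image_subset_iff_funcset)
  qed
  then have "continuous_map (top_of_set {0..1}) X (c \<circ> ?g)"
    using c unfolding pathin_def by (rule continuous_map_compose)
  then show "pathin (subtopology X S) (c \<circ> ?g)"
    unfolding pathin_def continuous_map_in_subtopology using S g by auto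
qed auto

text \<open>The closed set \<open>P i\<close> may enter \<open>B\<close> in several pieces;
  \<open>Q i\<close> is a path connected core containing every point where \<open>c\<close> meets
  it. Hence all hits of one plaque lie on the same side of any other plaque, which is what turns
  times of crossing into an order.\<close>

locale crossing =
  fixes N :: "'b topology" and B :: "'b set" and c :: "real \<Rightarrow> 'b" and I :: "'w set"
    and P Q :: "'w \<Rightarrow> 'b set"
  assumes B: "openin N B"
    and c: "pathin (subtopology N B) c"
    and P_closed: "i \<in> I \<Longrightarrow> closedin N (P i)"
    and P_disjoint: "i \<in> I \<Longrightarrow> j \<in> I \<Longrightarrow> i \<noteq> j \<Longrightarrow> P i \<inter> P j = {}"
    and ends: "i \<in> I \<Longrightarrow> c 0 \<notin> P i \<and> c 1 \<notin> P i"
    and separates: "i \<in> I \<Longrightarrow> \<not> path_component_of (subtopology N (B - P i)) (c 0) (c 1)"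
    and Q_sub: "i \<in> I \<Longrightarrow> Q i \<subseteq> P i \<inter> B"
    and hits: "i \<in> I \<Longrightarrow> t \<in> {0..1} \<Longrightarrow> c t \<in> P i \<Longrightarrow> c t \<in> Q i"
    and Q_path_connected: "i \<in> I \<Longrightarrow> path_connectedin N (Q i)"
begin

section \<open>First and last hits, and the sides of a plaque\<close>

definition hit_times :: "'w \<Rightarrow> real set" where
  "hit_times i = {t \<in> {0..1}. c t \<in> P i}"

definition first_hit :: "'w \<Rightarrow> real" where
  "first_hit i = Inf (hit_times i)"

abbreviation same_side :: "'w \<Rightarrow> 'b \<Rightarrow> 'b \<Rightarrow> bool" where
  "same_side i \<equiv> path_component_of (subtopology N (B - P i))"

lemma cB: "t \<in> {0..1} \<Longrightarrow> c t \<in> B"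
  using c unfolding pathin_def continuous_map_in_subtopology by auto

lemma cN: "pathin N c"
  using c unfolding pathin_def continuous_map_in_subtopology by auto

lemma hit_times_ne: assumes "i \<in> I" shows "hit_times i \<noteq> {}"
proof
  assume e: "hit_times i = {}"
  have "same_side i (c 0) (c 1)"
    using cB e by (intro path_component_of_subpath[OF cN]) (auto simp: hit_times_def)
  then show False using separates[OF assms] by blast
qed

lemma closed_hit_times: assumes "i \<in> I" shows "closed (hit_times i)"
proof -
  have "closedin (top_of_set {0..1}) {t \<in> topspace (top_of_set {0..1}). c t \<in> P i}"
    using closedin_continuous_map_preimage[OF cN[unfolded pathin_def] P_closed[OF assms]] .
  then have "closedin (top_of_set {0..1}) (hit_times i)" by (simp add: hit_times_def)
  then show ?thesis by (rule closedin_closed_trans) simp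
qed

lemma hit_times_bdd: "bdd_below (hit_times i)" "bdd_above (hit_times i)"
  unfolding hit_times_def by (auto intro!: bdd_belowI[of _ 0] bdd_aboveI[of _ 1])

lemma first_hit_mem: "i \<in> I \<Longrightarrow> first_hit i \<in> hit_times i"
  unfolding first_hit_def
  by (rule closed_contains_Inf[OF hit_times_ne hit_times_bdd(1) closed_hit_times])

lemma last_hit_mem: "i \<in> I \<Longrightarrow> Sup (hit_times i) \<in> hit_times i"
  by (rule closed_contains_Sup[OF hit_times_ne hit_times_bdd(2) closed_hit_times])

lemma first_hit_le: "t \<in> hit_times i \<Longrightarrow> first_hit i \<le> t"
  unfolding first_hit_def by (rule cInf_lower[OF _ hit_times_bdd(1)])

lemma last_hit_ge: "t \<in> hit_times i \<Longrightarrow> t \<le> Sup (hit_times i)"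
  by (rule cSup_upper[OF _ hit_times_bdd(2)])

lemma hit_times_disjoint: "i \<in> I \<Longrightarrow> j \<in> I \<Longrightarrow> i \<noteq> j \<Longrightarrow> hit_times i \<inter> hit_times j = {}"
  unfolding hit_times_def using P_disjoint by blast

lemma first_hit_inj: "i \<in> I \<Longrightarrow> j \<in> I \<Longrightarrow> first_hit i = first_hit j \<longleftrightarrow> i = j"
  using first_hit_mem hit_times_disjoint by (metis IntI empty_iff)

lemma same_side_hit:
  assumes ij: "i \<in> I" "j \<in> I" "i \<noteq> j" and t: "t \<in> hit_times i" and y: "y \<in> Q i"
  shows "same_side j (c t) y"
proof -
  have "c t \<in> Q i" using hits[OF ij(1)] t unfolding hit_times_def by blast
  moreover have "path_connectedin (subtopology N (B - P j)) (Q i)"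
    unfolding path_connectedin_subtopology using Q_path_connected[OF ij(1)] Q_sub[OF ij(1)] P_disjoint[OF ij] by blast
  ultimately show ?thesis using y path_connectedin[of "subtopology N (B - P j)" "Q i"]
    unfolding path_component_of_def by blast
qed

text \<open>Up to its first hit of \<open>P i\<close> the path has not yet met \<open>P j\<close>,
  and from there the core \<open>Q i\<close> leads on without meeting \<open>P j\<close>.\<close>

lemma first_hit_less_same_side:
  assumes ij: "i \<in> I" "j \<in> I" and less: "first_hit i < first_hit j" and y: "y \<in> Q i"
  shows "same_side j (c 0) y"
proof -
  have t: "first_hit i \<in> {0..1}" using first_hit_mem[OF ij(1)] unfolding hit_times_def by blast
  have "same_side j (c 0) (c (first_hit i))"
  proof (rule path_component_of_subpath[OF cN])
    fix s assume s: "min 0 (first_hit i) \<le> s" "s \<le> max 0 (first_hit i)"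
    then have s1: "s \<in> {0..1}" using t by auto
    have "s \<notin> hit_times j" using first_hit_le[of s j] less s t by auto
    then show "c s \<in> B - P j" using cB[OF s1] s1 unfolding hit_times_def by blast
  qed (use t in auto)
  moreover have "same_side j (c (first_hit i)) y"
    using same_side_hit[OF ij _ first_hit_mem[OF ij(1)] y] less by blast
  ultimately show ?thesis by (rule path_component_of_trans)
qed

text \<open>The mirror image: the path is followed backwards from its end to its last hit of
  \<open>P j\<close>.\<close>

lemma last_hit_less_same_side:
  assumes ij: "i \<in> I" "j \<in> I" and less: "Sup (hit_times i) < Sup (hit_times j)" and y: "y \<in> Q j"
  shows "same_side i (c 1) y"
proof -
  let ?t = "Sup (hit_times j)"
  have t: "?t \<in> {0..1}" using last_hit_mem[OF ij(2)] unfolding hit_times_def by blast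
  have "same_side i (c 1) (c ?t)"
  proof (rule path_component_of_subpath[OF cN])
    fix s assume s: "min 1 ?t \<le> s" "s \<le> max 1 ?t"
    then have s1: "s \<in> {0..1}" using t by auto
    have "s \<notin> hit_times i" using last_hit_ge[of s i] less s t by auto
    then show "c s \<in> B - P i" using cB[OF s1] s1 unfolding hit_times_def by blast
  qed (use t in auto)
  moreover have "same_side i (c ?t) y"
    using same_side_hit[OF ij(2,1) _ last_hit_mem[OF ij(2)] y] less by blast
  ultimately show ?thesis by (rule path_component_of_trans)
qed

lemma Q_ne: assumes "i \<in> I" obtains y where "y \<in> Q i"
  using first_hit_mem[OF assms] hits[OF assms] unfolding hit_times_def by blast

text \<open>First and last hits order two plaques alike: otherwise \<open>Q i\<close> would be
  joined off \<open>P j\<close> to both ends of the path, and \<open>P j\<close> would not separate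
  them.\<close>

lemma first_hit_less_same_side_end:
  assumes ij: "i \<in> I" "j \<in> I" and less: "first_hit i < first_hit j" and y: "y \<in> Q j"
  shows "same_side i (c 1) y"
proof (rule last_hit_less_same_side[OF ij _ y], rule ccontr)
  assume "\<not> Sup (hit_times i) < Sup (hit_times j)"
  moreover have "Sup (hit_times i) \<noteq> Sup (hit_times j)"
    using last_hit_mem[OF ij(1)] last_hit_mem[OF ij(2)] hit_times_disjoint[OF ij] less
    by (metis IntI empty_iff less_irrefl)
  ultimately have l: "Sup (hit_times j) < Sup (hit_times i)" by simp
  obtain z where z: "z \<in> Q i" using Q_ne[OF ij(1)] by blast
  have "same_side j (c 0) z" using first_hit_less_same_side[OF ij less z] .
  moreover have "same_side j (c 1) z" using last_hit_less_same_side[OF ij(2,1) l z] .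
  ultimately have "same_side j (c 0) (c 1)" using path_component_of_trans path_component_of_sym by metis
  then show False using separates[OF ij(2)] by blast
qed

lemma first_hit_less_iff:
  assumes ij: "i \<in> I" "j \<in> I" and y: "y \<in> Q i"
  shows "first_hit i < first_hit j \<longleftrightarrow> same_side j (c 0) y"
proof
  assume s: "same_side j (c 0) y"
  have "y \<notin> P j" using path_component_in_topspace[OF s] by auto
  then have "i \<noteq> j" using y Q_sub[OF ij(1)] by blast
  moreover have "\<not> first_hit j < first_hit i"
  proof
    assume "first_hit j < first_hit i"
    from first_hit_less_same_side_end[OF ij(2,1) this y] s
    have "same_side j (c 0) (c 1)" using path_component_of_trans path_component_of_sym by metis
    then show False using separates[OF ij(2)] by blast
  qed
  ultimately show "first_hit i < first_hit j" using first_hit_inj[OF ij] by linarith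
qed (use first_hit_less_same_side[OF ij _ y] in blast)

lemma first_hit_greater_iff:
  assumes ij: "i \<in> I" "j \<in> I" and y: "y \<in> Q i"
  shows "first_hit j < first_hit i \<longleftrightarrow> same_side j (c 1) y"
proof
  assume s: "same_side j (c 1) y"
  have "y \<notin> P j" using path_component_in_topspace[OF s] by auto
  then have "i \<noteq> j" using y Q_sub[OF ij(1)] by blast
  moreover have "\<not> first_hit i < first_hit j"
  proof
    assume "first_hit i < first_hit j"
    from first_hit_less_same_side[OF ij this y] s
    have "same_side j (c 0) (c 1)" using path_component_of_trans path_component_of_sym by metis
    then show False using separates[OF ij(2)] by blast
  qed
  ultimately show "first_hit j < first_hit i" using first_hit_inj[OF ij] by linarith
qed (use first_hit_less_same_side_end[OF ij(2,1) _ y] in blast)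

text \<open>A core other than that of \<open>j\<close> lies on exactly one of the sides of
  \<open>P j\<close> marked by \<open>c 0\<close> and \<open>c 1\<close>. The right side mentions
  neither times nor the path \<open>c\<close>; in this form betweenness can be compared across
  boxes.\<close>

lemma btw_first_hit_iff:
  assumes ijk: "i \<in> I" "j \<in> I" "k \<in> I" and y: "y \<in> Q i" and z: "z \<in> Q k"
  shows "btw first_hit i j k \<longleftrightarrow> i \<noteq> j \<and> k \<noteq> j \<and> \<not> same_side j y z"
proof (cases "i = j \<or> k = j")
  case False
  have 1: "first_hit i < first_hit j \<or> first_hit j < first_hit i" "first_hit k < first_hit j \<or> first_hit j < first_hit k"
    using False first_hit_inj ijk by (metis linorder_neqE)+
  note less = first_hit_less_iff[OF ijk(1,2) y] first_hit_less_iff[OF ijk(3,2) z]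
    first_hit_greater_iff[OF ijk(1,2) y] first_hit_greater_iff[OF ijk(3,2) z]
  have sep: "\<not> same_side j (c 0) (c 1)" using separates[OF ijk(2)] .
  have join: "same_side j a y \<Longrightarrow> same_side j a z \<Longrightarrow> same_side j y z" for a
    using path_component_of_trans[of "subtopology N (B - P j)" y a z]
      path_component_of_sym[of "subtopology N (B - P j)" a y] by blast
  have split: "same_side j (c 0) u \<Longrightarrow> same_side j (c 1) v \<Longrightarrow> same_side j u v \<Longrightarrow> False" for u v
    using sep path_component_of_trans[of "subtopology N (B - P j)" "c 0" u v]
      path_component_of_trans[of "subtopology N (B - P j)" "c 0" v "c 1"]
      path_component_of_sym[of "subtopology N (B - P j)" "c 1" v] by blast
  have sym: "same_side j y z \<Longrightarrow> same_side j z y" by (simp add: path_component_of_sym)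
  have "same_side j y z \<longleftrightarrow> (first_hit i < first_hit j \<longleftrightarrow> first_hit k < first_hit j)"
    using 1 less join[of "c 0"] join[of "c 1"] split[of y z] split[of z y] sym less_asym[of "first_hit i" "first_hit j"] less_asym[of "first_hit k" "first_hit j"]
    by blast
  then show ?thesis using False 1 unfolding btw_def by auto
qed (auto simp: btw_def)

lemma openin_first_hit_sides:
  assumes N: "locally_path_connected_space N" and j: "j \<in> I"
  shows "openin N {y. same_side j (c 0) y}" "openin N {y. same_side j (c 1) y}"
proof -
  have o: "openin N (B - P j)" using openin_diff[OF B P_closed[OF j]] .
  then have "locally_path_connected_space (subtopology N (B - P j))"
    using N locally_path_connected_space_open_subset by blast
  then have "openin (subtopology N (B - P j)) {y. same_side j a y}" for a
    by (rule openin_path_component_of_locally_path_connected_space)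
  then show "openin N {y. same_side j (c 0) y}" "openin N {y. same_side j (c 1) y}"
    using openin_trans_full[OF _ o] by blast+
qed

end

section \<open>Foliation charts\<close>

text \<open>By the cut-wire-fence theorem, closed sets that no connected set joins are separated by
  a clopen set; here connected sets have at most one point.\<close>

lemma totally_disconnected_clopen_nbhd:
  assumes Y: "compact_space Y" "Hausdorff_space Y" "totally_disconnected_space Y"
    and V: "openin Y V" "y \<in> V"
  obtains W where "openin Y W" "closedin Y W" "y \<in> W" "W \<subseteq> V"
proof -
  have y: "y \<in> topspace Y" using V openin_subset by blast
  have "separated_between Y {y} (topspace Y - V)"
  proof (rule cut_wire_fence_theorem_gen[OF Y(1)])
    show "compactin Y {y}" using y by simp
    show "closedin Y (topspace Y - V)" using V(1) by (rule openin_closedin_eq[THEN iffD1, THEN conjunct2])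
    fix C assume "connectedin Y C"
    then obtain a where "C \<subseteq> {a}" using Y(3) unfolding totally_disconnected_space_def by blast
    then show "disjnt C {y} \<or> disjnt C (topspace Y - V)" using V(2) by (auto simp: disjnt_def)
  qed (use Y in auto)
  then obtain A B where AB: "openin Y A" "openin Y B" "A \<union> B = topspace Y" "disjnt A B" "{y} \<subseteq> A" "topspace Y - V \<subseteq> B"
    unfolding separated_between_def by blast
  have "A = topspace Y - B" using AB(3,4) openin_subset[OF AB(1)] by (auto simp: disjnt_def)
  then have "closedin Y A" using AB(2) by (simp add: closedin_diff)
  moreover have "A \<subseteq> V" using AB(3,4,6) openin_subset[OF AB(1)] by (auto simp: disjnt_def)
  ultimately show ?thesis using that AB(1,5) by blast
qed

text \<open>A basic open set of the product topology restricts finitely many coordinates, and in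
  \<open>Esp m\<close> those from \<open>m\<close> on vanish anyway; the smallest of finitely many
  radii works.\<close>

lemma cbx_nbhd:
  assumes V: "openin (top_of_set (Esp m)) V" "p \<in> V"
  obtains r where "0 < r" "cbx m p r \<subseteq> V"
proof -
  obtain V' where V': "open V'" "V = Esp m \<inter> V'" using V(1) unfolding openin_open by blast
  then have "openin (product_topology (\<lambda>i. euclideanreal) UNIV) V'"
    by (simp add: euclidean_product_topology)
  moreover have "p \<in> V'" using V(2) V'(2) by blast
  ultimately have "\<exists>X. p \<in> (\<Pi>\<^sub>E i\<in>UNIV. X i) \<and> (\<forall>i. openin euclideanreal (X i)) \<and> finite {i. X i \<noteq> topspace euclideanreal} \<and> (\<Pi>\<^sub>E i\<in>UNIV. X i) \<subseteq> V'"
    using product_topology_open_contains_basis[of "\<lambda>i. euclideanreal" UNIV V' p] by simp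
  then obtain X where X: "p \<in> (\<Pi>\<^sub>E i\<in>UNIV. X i)" "\<And>i. open (X i)" "(\<Pi>\<^sub>E i\<in>UNIV. X i) \<subseteq> V'"
    and fin: "finite {i. X i \<noteq> UNIV}" by auto
  have pX: "p i \<in> X i" for i using X(1) by (auto simp: PiE_iff)
  have "\<exists>r>0. cball (p i) r \<subseteq> X i" for i using X(2) pX open_contains_cball by blast
  then obtain r where r: "\<And>i. 0 < r i" "\<And>i. cball (p i) (r i) \<subseteq> X i" by metis
  \<comment> \<open>The inserted 1 covers the case that no coordinate is restricted.\<close>
  define s where "s = Min (insert 1 (r ` {i. X i \<noteq> UNIV \<and> i < m}))"
  have f: "finite (insert 1 (r ` {i. X i \<noteq> UNIV \<and> i < m}))" by simp
  have s: "0 < s" "\<And>i. i < m \<Longrightarrow> X i \<noteq> UNIV \<Longrightarrow> s \<le> r i"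
    unfolding s_def using r(1) f by auto
  have "cbx m p s \<subseteq> V"
  proof
    fix x assume x: "x \<in> cbx m p s"
    have "x i \<in> X i" for i
    proof (cases "i < m \<and> X i \<noteq> UNIV")
      case True
      then have "\<bar>x i - p i\<bar> \<le> r i" using x s(2)[of i] unfolding cbx_def by force
      then show ?thesis using r(2)[of i] by (auto simp: dist_real_def)
    next
      case False
      have "x i = p i" if "m \<le> i" using x V(2) V'(2) that unfolding cbx_def by auto
      then show ?thesis using False pX[of i] by (cases "m \<le> i") auto
    qed
    then show "x \<in> V" using X(3) x V'(2) unfolding cbx_def by (auto simp: PiE_iff)
  qed
  then show ?thesis using that s(1) by blast
qed

lemma cube_eq_cbx: "cube n = cbx n (\<lambda>_. 0) 1"
  unfolding cube_def cbx_def topspace_Euclidean_space by (auto simp: abs_le_iff)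

lemma open_cube_eq_obx: "open_cube n = obx n (\<lambda>_. 0) 1"
  unfolding open_cube_def obx_def topspace_Euclidean_space by (auto simp: abs_less_iff)

lemma open_cube_sub: "open_cube n \<subseteq> cube n"
  unfolding cube_eq_cbx open_cube_eq_obx by (rule obx_sub_cbx)

lemma openin_open_cube: "openin (top_of_set (Esp n)) (open_cube n)"
  unfolding open_cube_eq_obx by (rule openin_obx)

lemma cube_sub_Esp: "cube n \<subseteq> Esp n" unfolding cube_eq_cbx cbx_def by blast

context foliated_space
begin

section \<open>Charts and patches, the sets that are products in chart coordinates\<close>

abbreviation Cl :: "'a \<Rightarrow> 'a set" where "Cl x \<equiv> M closure_of U x"

abbreviation chart_space :: "'a \<Rightarrow> ((nat \<Rightarrow> real) \<times> 'b) topology" where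
  "chart_space x \<equiv> prod_topology (top_of_set (cube n)) (subtopology X (T x))"

text \<open>Choosing a two-sided continuous inverse as a whole gives continuity and both
  cancellation laws from one fact.\<close>

definition chart_inv :: "'a \<Rightarrow> (nat \<Rightarrow> real) \<times> 'b \<Rightarrow> 'a" where
  "chart_inv x = (SOME g. homeomorphic_maps (subtopology M (Cl x)) (chart_space x) (\<phi> x) g)"

definition patch :: "'a \<Rightarrow> (nat \<Rightarrow> real) set \<Rightarrow> 'b set \<Rightarrow> 'a set" where
  "patch x V W = {z \<in> Cl x. \<phi> x z \<in> V \<times> W}"

lemma M_compact: "compact_space M" and M_connected: "connected_space M" and M_ne: "topspace M \<noteq> {}"
  and M_metrizable: "metrizable_space M"
  using continuum unfolding continuum_def by auto

lemma M_Hausdorff: "Hausdorff_space M"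
  using M_metrizable metrizable_imp_Hausdorff_space by blast

lemma X_Hausdorff: "Hausdorff_space X"
  using model_metrizable metrizable_imp_Hausdorff_space by blast

lemma chart_inv:
  assumes "x \<in> topspace M"
  shows "homeomorphic_maps (subtopology M (Cl x)) (chart_space x) (\<phi> x) (chart_inv x)"
proof -
  have "subtopology (Euclidean_space n) (cube n) = top_of_set (cube n)"
    using cube_sub_Esp[of n] by (simp add: Euclidean_space_eq_top_of_set subtopology_subtopology Int_absorb1)
  then have "homeomorphic_map (subtopology M (Cl x)) (chart_space x) (\<phi> x)"
    using chart_homeomorphism[OF assms] by simp
  then have "\<exists>g. homeomorphic_maps (subtopology M (Cl x)) (chart_space x) (\<phi> x) g"
    unfolding homeomorphic_map_maps .
  then show ?thesis unfolding chart_inv_def by (rule someI_ex)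
qed

lemma T_sub: "x \<in> topspace M \<Longrightarrow> T x \<subseteq> topspace X"
  using transversal_compact compactin_subset_topspace by blast

lemma Cl_sub: "Cl x \<subseteq> topspace M"
  by (rule closure_of_subset_topspace)

lemma topspace_chart_space: "x \<in> topspace M \<Longrightarrow> topspace (chart_space x) = cube n \<times> T x"
  using T_sub by (auto simp: topspace_prod_topology)

lemma U_sub: "x \<in> topspace M \<Longrightarrow> U x \<subseteq> Cl x"
  using nbhd_open openin_subset closure_of_subset by metis

lemma
  assumes x: "x \<in> topspace M"
  shows chart_mem: "z \<in> Cl x \<Longrightarrow> \<phi> x z \<in> cube n \<times> T x"
    and chart_inv_mem: "p \<in> cube n \<times> T x \<Longrightarrow> chart_inv x p \<in> Cl x"
    and chart_inv_left: "z \<in> Cl x \<Longrightarrow> chart_inv x (\<phi> x z) = z"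
    and chart_inv_right: "p \<in> cube n \<times> T x \<Longrightarrow> \<phi> x (chart_inv x p) = p"
proof -
  have t: "topspace (subtopology M (Cl x)) = Cl x" using Cl_sub by auto
  note h = chart_inv[OF x, unfolded homeomorphic_maps_def continuous_map_def t topspace_chart_space[OF x]]
  show "z \<in> Cl x \<Longrightarrow> \<phi> x z \<in> cube n \<times> T x" "p \<in> cube n \<times> T x \<Longrightarrow> chart_inv x p \<in> Cl x"
    "z \<in> Cl x \<Longrightarrow> chart_inv x (\<phi> x z) = z" "p \<in> cube n \<times> T x \<Longrightarrow> \<phi> x (chart_inv x p) = p"
    using h by blast+
qed

lemma continuous_chart: "x \<in> topspace M \<Longrightarrow> continuous_map (subtopology M (Cl x)) (chart_space x) (\<phi> x)"
  using chart_inv unfolding homeomorphic_maps_def by blast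

lemma continuous_chart_inv: "x \<in> topspace M \<Longrightarrow> continuous_map (chart_space x) M (chart_inv x)"
  using chart_inv unfolding homeomorphic_maps_def continuous_map_in_subtopology by blast

lemma in_U_iff:
  assumes "x \<in> topspace M"
  shows "z \<in> U x \<longleftrightarrow> z \<in> Cl x \<and> \<phi> x z \<in> open_cube n \<times> (X interior_of T x)"
  using arg_cong[OF nbhd_eq[OF assms], of "\<lambda>S. z \<in> S"] unfolding mem_Collect_eq .

lemma patch_eq_image:
  assumes x: "x \<in> topspace M" and VW: "V \<subseteq> cube n" "W \<subseteq> T x"
  shows "patch x V W = chart_inv x ` (V \<times> W)"
proof
  show "patch x V W \<subseteq> chart_inv x ` (V \<times> W)"
    unfolding patch_def using chart_inv_left[OF x] by (force simp: image_iff)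
  show "chart_inv x ` (V \<times> W) \<subseteq> patch x V W"
  proof
    fix z assume "z \<in> chart_inv x ` (V \<times> W)"
    then obtain p where p: "p \<in> V \<times> W" "z = chart_inv x p" by blast
    then have "p \<in> cube n \<times> T x" using VW by auto
    then show "z \<in> patch x V W" unfolding patch_def using p chart_inv_mem[OF x] chart_inv_right[OF x] by auto
  qed
qed

lemma patch_mono: "V \<subseteq> V' \<Longrightarrow> W \<subseteq> W' \<Longrightarrow> patch x V W \<subseteq> patch x V' W'"
  unfolding patch_def by auto

lemma patch_sub_U:
  assumes x: "x \<in> topspace M" and "V \<subseteq> open_cube n" "openin X W" "W \<subseteq> T x"
  shows "patch x V W \<subseteq> U x"
  using assms interior_of_maximal[of W "T x" X] unfolding patch_def in_U_iff[OF x] subset_iff by auto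

text \<open>The chart lives on the closure of \<open>U x\<close>, so the preimage is open only
  relative to that closure; being contained in the open set \<open>U x\<close>, it is open in
  \<open>M\<close>.\<close>

lemma openin_patch:
  assumes x: "x \<in> topspace M" and V: "openin (top_of_set (Esp n)) V" "V \<subseteq> open_cube n" and W: "openin X W" "W \<subseteq> T x"
  shows "openin M (patch x V W)"
proof -
  have "openin (top_of_set (cube n)) V"
    using openin_subset_trans[OF V(1) _ cube_sub_Esp] V(2) open_cube_sub by blast
  moreover have "openin (subtopology X (T x)) W" using W openin_subset_topspace_eq
    by (metis inf.absorb1 openin_subtopology)
  ultimately have "openin (chart_space x) (V \<times> W)" by (simp add: openin_prod_Times_iff)
  then have "openin (subtopology M (Cl x)) {z \<in> topspace (subtopology M (Cl x)). \<phi> x z \<in> V \<times> W}"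
    by (rule openin_continuous_map_preimage[OF continuous_chart[OF x]])
  moreover have "{z \<in> topspace (subtopology M (Cl x)). \<phi> x z \<in> V \<times> W} = patch x V W"
    unfolding patch_def using Cl_sub by auto
  ultimately obtain A where A: "openin M A" "patch x V W = A \<inter> Cl x" unfolding openin_subtopology by auto
  then have "patch x V W = A \<inter> U x" using patch_sub_U[OF x V(2) W] U_sub[OF x] by blast
  then show ?thesis using A(1) nbhd_open[OF x] by auto
qed

lemma compactin_patch:
  assumes x: "x \<in> topspace M" and V: "compact V" "V \<subseteq> cube n" and W: "compactin X W" "W \<subseteq> T x"
  shows "compactin M (patch x V W)"
  unfolding patch_eq_image[OF x V(2) W(2)]
proof (rule image_compactin[OF _ continuous_chart_inv[OF x]])
  have "compactin (top_of_set (cube n)) V" using V by (simp add: compactin_subtopology)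
  moreover have "compactin (subtopology X (T x)) W" using W by (simp add: compactin_subtopology)
  ultimately show "compactin (chart_space x) (V \<times> W)" by (simp add: compactin_Times)
qed

lemma path_connectedin_patch:
  assumes x: "x \<in> topspace M" and V: "path_connected V" "V \<subseteq> cube n" and w: "w \<in> T x"
  shows "path_connectedin M (patch x V {w})"
proof -
  have "patch x V {w} = (\<lambda>u. chart_inv x (u, w)) ` V"
    using patch_eq_image[OF x V(2), of "{w}"] w by (auto simp: image_iff)
  moreover have "continuous_map (top_of_set (cube n)) M (\<lambda>u. chart_inv x (u, w))"
  proof -
    have "continuous_map (top_of_set (cube n)) (chart_space x) (\<lambda>u. (u, w))"
      using w T_sub[OF x] by (auto simp: continuous_map_pairwise o_def)
    then show ?thesis using continuous_map_compose[OF _ continuous_chart_inv[OF x]] by (fastforce simp: o_def)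
  qed
  moreover have "path_connectedin (top_of_set (cube n)) V" using V by (simp add: path_connectedin_top_of_set)
  ultimately show ?thesis using path_connectedin_continuous_map_image by metis
qed

text \<open>The image in the transversal is connected, hence a point. This confines paths to plaques
  and makes heights constant along them.\<close>

lemma proj_const_on_connected:
  assumes td: "totally_disconnected_space (subtopology X (T x))"
    and x: "x \<in> topspace M" and S: "connectedin M S" "S \<subseteq> Cl x" "y \<in> S" "z \<in> S"
  shows "proj x y = proj x z"
proof -
  have "connectedin (subtopology M (Cl x)) S" using S by (simp add: connectedin_subtopology)
  moreover have "continuous_map (subtopology M (Cl x)) (subtopology X (T x)) (snd \<circ> \<phi> x)"
    by (rule continuous_map_compose[OF continuous_chart[OF x] continuous_map_snd])
  ultimately have "connectedin (subtopology X (T x)) ((snd \<circ> \<phi> x) ` S)"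
    using connectedin_continuous_map_image by blast
  then obtain a where "(snd \<circ> \<phi> x) ` S \<subseteq> {a}" using td unfolding totally_disconnected_space_def by blast
  then show ?thesis using S(3,4) unfolding proj_def by auto
qed

lemma plaque_eq_patch: assumes "x \<in> topspace M" shows "plaque x w = patch x (cube n) {w}"
  unfolding plaque_def patch_def proj_def using chart_mem[OF assms] by (auto simp: mem_Times_iff)

lemma compactin_plaque:
  assumes x: "x \<in> topspace M" and w: "w \<in> T x"
  shows "compactin M (plaque x w)"
  unfolding plaque_eq_patch[OF x]
  by (rule compactin_patch[OF x _ subset_refl]) (use w T_sub[OF x] in \<open>auto simp: cube_eq_cbx compact_cbx\<close>)

end

context matchbox_manifold
begin

lemma clopen_nbhd:
  assumes x: "x \<in> topspace M" and w: "openin X W" "w \<in> W" "W \<subseteq> T x"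
  obtains W' where "openin X W'" "compactin X W'" "w \<in> W'" "W' \<subseteq> W"
proof -
  have c: "compact_space (subtopology X (T x))" using transversal_compact[OF x] compact_space_subtopology by blast
  have "openin (subtopology X (T x)) W" using w by (metis inf.absorb1 openin_subtopology)
  then obtain W' where W': "openin (subtopology X (T x)) W'" "closedin (subtopology X (T x)) W'" "w \<in> W'" "W' \<subseteq> W"
    using totally_disconnected_clopen_nbhd[OF c Hausdorff_space_subtopology[OF X_Hausdorff]
      transversal_totally_disconnected[OF x]] w(2) by blast
  obtain A where A: "openin X A" "W' = A \<inter> T x" using W'(1) unfolding openin_subtopology by blast
  have "W' = A \<inter> W" using A(2) W'(4) w(3) by blast
  then have "openin X W'" using A(1) w(1) by blast
  moreover have "compactin X W'"
    using closedin_compact_space[OF c W'(2)] by (simp add: compactin_subtopology)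
  ultimately show ?thesis using that W'(3,4) by blast
qed

text \<open>Total disconnectedness provides a transverse factor \<open>W\<close> that is both open
  and compact. It can be open in \<open>X\<close> and not merely in \<open>T x\<close>, because the
  transverse coordinate of a point of \<open>U x\<close> is interior to \<open>T x\<close>.\<close>

lemma patch_nbhd:
  assumes x: "x \<in> topspace M" and z: "z \<in> U x" "z \<in> \<Omega>" "openin M \<Omega>"
  obtains r W where "0 < r" "openin X W" "compactin X W" "W \<subseteq> T x" "snd (\<phi> x z) \<in> W"
    "cbx n (fst (\<phi> x z)) r \<subseteq> open_cube n" "patch x (cbx n (fst (\<phi> x z)) r) W \<subseteq> \<Omega>"
proof -
  have zC: "z \<in> Cl x" using z U_sub[OF x] by blast
  obtain u0 w0 where uw: "\<phi> x z = (u0, w0)" by (cases "\<phi> x z")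
  have uw': "u0 \<in> open_cube n" "w0 \<in> X interior_of T x" using z(1) in_U_iff[OF x] uw by auto
  have "openin (subtopology M (Cl x)) (\<Omega> \<inter> Cl x)" using z(3) openin_subtopology by blast
  moreover have "homeomorphic_map (subtopology M (Cl x)) (chart_space x) (\<phi> x)"
    using chart_inv[OF x] homeomorphic_map_maps by blast
  ultimately have "openin (chart_space x) (\<phi> x ` (\<Omega> \<inter> Cl x))"
    using homeomorphic_map_openness_eq by metis
  moreover have "(u0, w0) \<in> \<phi> x ` (\<Omega> \<inter> Cl x)" using z zC uw by force
  ultimately obtain V W where VW: "openin (top_of_set (cube n)) V" "openin (subtopology X (T x)) W"
    "u0 \<in> V" "w0 \<in> W" "V \<times> W \<subseteq> \<phi> x ` (\<Omega> \<inter> Cl x)"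
    unfolding openin_prod_topology_alt by metis
  obtain V' where V': "open V'" "V = cube n \<inter> V'" using VW(1) unfolding openin_open by blast
  have "openin (top_of_set (Esp n)) (open_cube n \<inter> V')" by (rule openin_Int_open[OF openin_open_cube V'(1)])
  then obtain r where r: "0 < r" "cbx n u0 r \<subseteq> open_cube n \<inter> V'" using cbx_nbhd VW(3) V'(2) uw'(1) by blast
  obtain W1 where W1: "openin X W1" "W = W1 \<inter> T x" using VW(2) unfolding openin_subtopology by blast
  have "openin X (W1 \<inter> X interior_of T x)" using W1(1) openin_interior_of by blast
  moreover have "w0 \<in> W1 \<inter> X interior_of T x" using VW(4) W1(2) uw'(2) by blast
  moreover have iT: "X interior_of T x \<subseteq> T x" by (rule interior_of_subset)
  ultimately obtain W' where W': "openin X W'" "compactin X W'" "w0 \<in> W'" "W' \<subseteq> W1 \<inter> X interior_of T x"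
    using clopen_nbhd[OF x] by (metis le_infI2)
  have "patch x (cbx n u0 r) W' \<subseteq> \<Omega>"
  proof
    fix y assume y: "y \<in> patch x (cbx n u0 r) W'"
    then have yC: "y \<in> Cl x" unfolding patch_def by blast
    have "\<phi> x y \<in> cbx n u0 r \<times> W'" using y unfolding patch_def by blast
    moreover have "cbx n u0 r \<subseteq> V" "W' \<subseteq> W"
      unfolding V'(2) W1(2) using r(2) open_cube_sub W'(4) iT by blast+
    ultimately have "\<phi> x y \<in> V \<times> W" using Sigma_mono[of "cbx n u0 r" V "\<lambda>_. W'" "\<lambda>_. W"] by (meson subsetD)
    then have "\<phi> x y \<in> \<phi> x ` (\<Omega> \<inter> Cl x)" using VW(5) by (rule subsetD[rotated])
    then obtain y' where y': "\<phi> x y = \<phi> x y'" "y' \<in> \<Omega> \<inter> Cl x" by (rule imageE)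
    have "y = y'" using chart_inv_left[OF x yC] chart_inv_left[OF x, of y'] y' by simp
    then show "y \<in> \<Omega>" using y' by simp
  qed
  then show ?thesis using that[of r W'] r W' iT uw by auto
qed

end

section \<open>Codimension one embeddings\<close>

locale codim_one_embedding = matchbox_manifold n M X T U \<phi>
  for n :: nat and M :: "'a topology" and X :: "'x topology" and T :: "'a \<Rightarrow> 'x set"
    and U :: "'a \<Rightarrow> 'a set" and \<phi> :: "'a \<Rightarrow> 'a \<Rightarrow> (nat \<Rightarrow> real) \<times> 'x" +
  fixes N :: "'b topology" and f :: "'a \<Rightarrow> 'b"
  assumes manifold: "topological_manifold (Suc n) N"
    and embedding: "embedding_map M N f"
begin

text \<open>The separating sets are images of whole plaques, because these are compact and so closed
  in \<open>N\<close>; their parts in \<open>R\<close> are the cores. The last clause gives a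
  compact transversal of \<open>R\<close>, needed for the recurrence of path components.\<close>

definition good_box :: "'a \<Rightarrow> 'a set \<Rightarrow> 'b set \<Rightarrow> (real \<Rightarrow> 'b) \<Rightarrow> bool" where
  "good_box x R B c \<longleftrightarrow> x \<in> topspace M \<and> openin M R \<and> R \<subseteq> U x \<and> f ` R \<subseteq> B \<and>
     crossing N B c (proj x ` R) (\<lambda>w. f ` plaque x w) (\<lambda>w. f ` (plaque x w \<inter> R)) \<and>
     (\<forall>w\<in>proj x ` R. path_connectedin M (plaque x w \<inter> R)) \<and>
     (\<exists>Z. compactin M Z \<and> Z \<subseteq> R \<and> (\<forall>y\<in>R. \<exists>z\<in>Z. proj x z = proj x y))"

section \<open>The ambient manifold, the embedding, and the construction of good boxes\<close>

lemma N_Hausdorff: "Hausdorff_space N"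
  using manifold unfolding topological_manifold_def by blast

lemma f_cont: "continuous_map M N f"
  using embedding embedding_map_imp_homeomorphic_space embedding_map_def homeomorphic_imp_continuous_map continuous_map_in_subtopology
  by metis

lemma f_mem: "y \<in> topspace M \<Longrightarrow> f y \<in> topspace N"
  using f_cont unfolding continuous_map_def by auto

lemma f_inj: "inj_on f (topspace M)"
  using embedding unfolding embedding_map_def homeomorphic_map_def by (simp add: homeomorphic_eq_injective_perfect_map)

text \<open>Since \<open>f\<close> is an embedding and not only an injection, an ambient open set
  can keep out the parts of \<open>M\<close> that are far away inside \<open>M\<close>.\<close>

lemma f_open:
  assumes "openin M Q"
  obtains R where "openin N R" "\<And>y. y \<in> topspace M \<Longrightarrow> f y \<in> R \<longleftrightarrow> y \<in> Q"
proof -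
  have "openin (subtopology N (f ` topspace M)) (f ` Q)"
    using embedding assms unfolding embedding_map_def by (metis homeomorphic_map_openness_eq)
  then obtain R where R: "openin N R" "f ` Q = R \<inter> f ` topspace M" unfolding openin_subtopology by blast
  have "f y \<in> R \<longleftrightarrow> y \<in> Q" if y: "y \<in> topspace M" for y
  proof -
    have "f y \<in> R \<longleftrightarrow> f y \<in> f ` Q" using R(2) y by blast
    also have "\<dots> \<longleftrightarrow> y \<in> Q" using inj_on_image_mem_iff[OF f_inj y] openin_subset[OF assms] by blast
    finally show ?thesis .
  qed
  then show ?thesis using that R(1) by blast
qed

lemma N_chart:
  assumes "p \<in> topspace N"
  obtains W V \<psi> \<psi>' where "openin N W" "p \<in> W" "openin (top_of_set (Esp (Suc n))) V"
    "homeomorphic_maps (subtopology N W) (top_of_set V) \<psi> \<psi>'"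
proof -
  obtain W V where WV: "openin N W" "p \<in> W" "openin (Euclidean_space (Suc n)) V"
    "subtopology N W homeomorphic_space subtopology (Euclidean_space (Suc n)) V"
    using manifold assms unfolding topological_manifold_def by blast
  have V: "openin (top_of_set (Esp (Suc n))) V" using WV(3) unfolding Euclidean_space_eq_top_of_set .
  then have "subtopology (Euclidean_space (Suc n)) V = top_of_set V"
    using openin_imp_subset[OF V] by (simp add: Euclidean_space_eq_top_of_set subtopology_subtopology Int_absorb1)
  then obtain \<psi> \<psi>' where "homeomorphic_maps (subtopology N W) (top_of_set V) \<psi> \<psi>'"
    using WV(4) unfolding homeomorphic_space_def by auto
  then show ?thesis by (rule that[OF WV(1,2) V])
qed

lemma N_locally_path_connected: "locally_path_connected_space N"
  unfolding locally_path_connected_space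
proof (intro strip)
  fix G y assume "openin N G \<and> y \<in> G"
  then have G: "openin N G" "y \<in> G" by auto
  then have yN: "y \<in> topspace N" using openin_subset by blast
  obtain W V \<psi> \<psi>' where W: "openin N W" "y \<in> W" "openin (top_of_set (Esp (Suc n))) V"
    and h: "homeomorphic_maps (subtopology N W) (top_of_set V) \<psi> \<psi>'" using N_chart[OF yN] by blast
  have "locally_path_connected_space (top_of_set (Esp (Suc n)))"
    using locally_path_connected_Euclidean_space[of "Suc n"] unfolding Euclidean_space_eq_top_of_set .
  then have "locally_path_connected_space (subtopology (top_of_set (Esp (Suc n))) V)"
    using W(3) by (rule locally_path_connected_space_open_subset)
  moreover have "subtopology (top_of_set (Esp (Suc n))) V = top_of_set V"
    using openin_imp_subset[OF W(3)] by (simp add: subtopology_subtopology Int_absorb1)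
  ultimately have "locally_path_connected_space (top_of_set V)" by simp
  then have "locally_path_connected_space (subtopology N W)"
    using homeomorphic_locally_path_connected_space h unfolding homeomorphic_space_def by blast
  moreover have "openin (subtopology N W) (G \<inter> W)" "y \<in> G \<inter> W" using G W openin_subtopology by blast+
  ultimately obtain S where S: "openin (subtopology N W) S" "path_connectedin (subtopology N W) S" "y \<in> S" "S \<subseteq> G \<inter> W"
    unfolding locally_path_connected_space by blast
  then show "\<exists>S. openin N S \<and> path_connectedin N S \<and> y \<in> S \<and> S \<subseteq> G"
    using openin_trans_full[OF S(1) W(1)] path_connectedin_subtopology by blast
qed

text \<open>Read in an ambient chart, the plaque through \<open>z\<close> satisfies the hypotheses
  of \<open>stable_separation\<close> for three nested cubes around \<open>p\<close>. All plaques
  uniformly close to it over the closed cube \<open>D\<close> separate the same two points, and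
  compactness of \<open>D\<close> makes this hold for an open set of transverse parameters, shrunk
  to a compact open \<open>W5\<close>. The crossing path is the segment between the two points in
  the smallest cube, which a plaque enters only through its core.\<close>

lemma good_box_exists:
  assumes x: "x \<in> topspace M" and z: "z \<in> U x" and \<Omega>: "openin M \<Omega>" "z \<in> \<Omega>" and \<Gamma>: "openin N \<Gamma>" "f z \<in> \<Gamma>"
  obtains R B c where "good_box x R B c" "z \<in> R" "R \<subseteq> \<Omega>" "B \<subseteq> \<Gamma>"
proof -
  let ?m = "Suc n"
  have zM: "z \<in> topspace M" using \<Omega> openin_subset by blast
  have zC: "z \<in> Cl x" using z U_sub[OF x] by blast
  obtain W V \<psi> \<psi>' where W: "openin N W" "f z \<in> W" and V: "openin (top_of_set (Esp ?m)) V"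
    and h: "homeomorphic_maps (subtopology N W) (top_of_set V) \<psi> \<psi>'"
    using N_chart[OF f_mem[OF zM]] by blast
  have VE: "V \<subseteq> Esp ?m" using openin_imp_subset[OF V] .
  have tW: "topspace (subtopology N W) = W" using openin_subset[OF W(1)] by auto
  have \<psi>V: "\<psi> q \<in> V" and \<psi>l: "\<psi>' (\<psi> q) = q" if "q \<in> W" for q
    using h that unfolding homeomorphic_maps_def continuous_map_def tW by auto
  have \<psi>'W: "\<psi>' v \<in> W" and \<psi>r: "\<psi> (\<psi>' v) = v" if "v \<in> V" for v
    using h that unfolding homeomorphic_maps_def continuous_map_def tW by auto
  have c\<psi>: "continuous_map (subtopology N W) (top_of_set V) \<psi>" and c\<psi>': "continuous_map (top_of_set V) (subtopology N W) \<psi>'"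
    using h unfolding homeomorphic_maps_def by auto
  have \<psi>open: "openin (top_of_set (Esp ?m)) (\<psi> ` G)" if G: "openin N G" "G \<subseteq> W" for G
  proof -
    have "openin (subtopology N W) G" using G by (metis inf.absorb1 openin_subtopology)
    moreover have "homeomorphic_map (subtopology N W) (top_of_set V) \<psi>" using h homeomorphic_map_maps by blast
    ultimately have "openin (top_of_set V) (\<psi> ` G)" using homeomorphic_map_openness_eq by metis
    then show ?thesis using V by (rule openin_trans)
  qed
  define p where "p = \<psi> (f z)"
  define \<Gamma>1 where "\<Gamma>1 = W \<inter> \<Gamma>"
  have \<Gamma>1: "openin N \<Gamma>1" "f z \<in> \<Gamma>1" "\<Gamma>1 \<subseteq> W" unfolding \<Gamma>1_def using W \<Gamma> by auto
  have pre: "openin M {y \<in> topspace M. f y \<in> G}" if "openin N G" for G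
    using openin_continuous_map_preimage[OF f_cont that] .
  define \<Omega>1 where "\<Omega>1 = \<Omega> \<inter> {y \<in> topspace M. f y \<in> \<Gamma>1}"
  have \<Omega>1: "z \<in> \<Omega>1" "openin M \<Omega>1" unfolding \<Omega>1_def using \<Omega> \<Gamma>1 zM pre[OF \<Gamma>1(1)] by auto
  define u0 where "u0 = fst (\<phi> x z)"
  define w0 where "w0 = snd (\<phi> x z)"
  obtain r W1 where r: "0 < r" and W1: "openin X W1" "compactin X W1" "W1 \<subseteq> T x" "w0 \<in> W1"
    and D1: "cbx n u0 r \<subseteq> open_cube n" and P1: "patch x (cbx n u0 r) W1 \<subseteq> \<Omega>1"
    unfolding u0_def w0_def by (rule patch_nbhd[OF x z \<Omega>1]) blast
  define D where "D = cbx n u0 r"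
  have Dc: "D \<subseteq> cube n" using D1 open_cube_sub unfolding D_def by blast
  have \<phi>z: "\<phi> x z = (u0, w0)" by (simp add: u0_def w0_def)
  have zin: "chart_inv x (u0, w0) = z" using chart_inv_left[OF x zC] \<phi>z by simp
  have u0E: "u0 \<in> Esp n" using chart_mem[OF x zC] cube_sub_Esp \<phi>z by auto
  have u0ob: "u0 \<in> obx n u0 s" if "0 < s" for s using u0E that unfolding obx_def by simp
  have ob_open: "openin M (patch x (obx n u0 s) W')" if "s \<le> r" "openin X W'" "W' \<subseteq> T x" for s W'
  proof (rule openin_patch[OF x openin_obx _ that(2,3)])
    show "obx n u0 s \<subseteq> open_cube n" using D1 obx_mono[OF that(1)] obx_sub_cbx by blast
  qed
  have z_patch: "z \<in> patch x (obx n u0 s) W'" if "0 < s" "w0 \<in> W'" for s W'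
    unfolding patch_def using zC \<phi>z u0ob that by simp
  define Q1 where "Q1 = patch x (obx n u0 r) W1"
  have Q1: "openin M Q1" "z \<in> Q1" unfolding Q1_def using ob_open[OF order_refl W1(1,3)] z_patch[OF r W1(4)] by auto
  obtain R1 where R1: "openin N R1" "\<And>y. y \<in> topspace M \<Longrightarrow> f y \<in> R1 \<longleftrightarrow> y \<in> Q1" using f_open[OF Q1(1)] by blast
  have pull: "y \<in> Q" if R: "\<And>y. y \<in> topspace M \<Longrightarrow> f y \<in> R \<longleftrightarrow> y \<in> Q" and y: "y \<in> topspace M" "f y \<in> W" "\<psi> (f y) \<in> \<psi> ` (\<Gamma>1 \<inter> R)" for Q R y
  proof -
    obtain q where q: "q \<in> \<Gamma>1 \<inter> R" "\<psi> (f y) = \<psi> q" using y(3) by blast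
    then have "f y = q" using \<psi>l[OF y(2)] \<psi>l[of q] \<Gamma>1(3) by force
    then show ?thesis using q R[OF y(1)] by blast
  qed
  have "openin (top_of_set (Esp ?m)) (\<psi> ` (\<Gamma>1 \<inter> R1))" using \<psi>open \<Gamma>1 R1(1) by blast
  moreover have "p \<in> \<psi> ` (\<Gamma>1 \<inter> R1)" unfolding p_def using \<Gamma>1(2) R1(2)[OF zM] Q1(2) by blast
  \<comment> \<open>The image of \<open>M\<close> meets this cube only in the image of
    \<open>Q1\<close>, so no other part of \<open>M\<close> interferes there.\<close>
  ultimately obtain \<rho>' where \<rho>': "0 < \<rho>'" "cbx ?m p \<rho>' \<subseteq> \<psi> ` (\<Gamma>1 \<inter> R1)" using cbx_nbhd by blast
  define \<rho> where "\<rho> = \<rho>' / 2"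
  have \<rho>: "0 < \<rho>" "\<rho> < \<rho>'" using \<rho>'(1) by (auto simp: \<rho>_def)
  have V2V: "\<psi> ` (\<Gamma>1 \<inter> R1) \<subseteq> V" using \<psi>V \<Gamma>1(3) by blast
  have obV: "obx ?m p \<rho> \<subseteq> V" using V2V \<rho>'(2) obx_mono[of \<rho> \<rho>'] obx_sub_cbx \<rho>(2) by (meson less_imp_le order_trans)
  have pE: "p \<in> Esp ?m" using \<psi>V[OF W(2)] VE unfolding p_def by blast
  have pob: "p \<in> obx ?m p s" if "0 < s" for s using pE that unfolding obx_def by simp
  have obc: "obx ?m p \<rho> \<subseteq> cbx ?m p \<rho>'"
    using obx_mono[of \<rho> \<rho>' ?m p] obx_sub_cbx[of ?m p \<rho>'] \<rho>(2) by simp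
  define B where "B = {q \<in> W. \<psi> q \<in> obx ?m p \<rho>}"
  have Bopen: "openin N B"
  proof -
    have "openin (top_of_set V) (obx ?m p \<rho>)" using openin_subset_trans[OF openin_obx obV VE] .
    then have "openin (subtopology N W) {q \<in> topspace (subtopology N W). \<psi> q \<in> obx ?m p \<rho>}"
      by (rule openin_continuous_map_preimage[OF c\<psi>])
    then have "openin (subtopology N W) B" unfolding tW B_def .
    then show ?thesis using openin_trans_full W(1) by blast
  qed
  have B\<Gamma>: "B \<subseteq> \<Gamma>"
  proof
    fix q assume q: "q \<in> B"
    then have "q \<in> W" "\<psi> q \<in> cbx ?m p \<rho>'" unfolding B_def using obc by auto
    then obtain q' where "q' \<in> \<Gamma>1" "\<psi> q = \<psi> q'" using \<rho>'(2) by blast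
    then have "q = q'" using \<psi>l \<open>q \<in> W\<close> \<Gamma>1(3) by (metis subsetD)
    then show "q \<in> \<Gamma>" using \<open>q' \<in> \<Gamma>1\<close> unfolding \<Gamma>1_def by blast
  qed
  \<comment> \<open>A patch inside \<open>\<Omega>2\<close> is mapped into \<open>B\<close>; this
    provides the assumption of \<open>stable_separation\<close> on the image of the inner
    disc.\<close>
  define \<Omega>2 where "\<Omega>2 = Q1 \<inter> {y \<in> topspace M. f y \<in> B}"
  have fzB: "f z \<in> B" unfolding B_def using W(2) pob[OF \<rho>(1)] by (simp add: p_def)
  have \<Omega>2: "z \<in> \<Omega>2" "openin M \<Omega>2" unfolding \<Omega>2_def using Q1 zM fzB pre[OF Bopen] by auto
  obtain r2 W2 where r2: "0 < r2" and W2: "openin X W2" "W2 \<subseteq> T x" "w0 \<in> W2"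
    and P2: "patch x (cbx n u0 r2) W2 \<subseteq> \<Omega>2"
    unfolding u0_def w0_def by (rule patch_nbhd[OF x z \<Omega>2]) blast
  define r0 where "r0 = min r r2"
  have r0: "0 < r0" "r0 \<le> r" "r0 \<le> r2" unfolding r0_def using r r2 by auto
  define W3 where "W3 = W1 \<inter> W2"
  have W3: "openin X W3" "W3 \<subseteq> T x" "w0 \<in> W3" "W3 \<subseteq> W1" "W3 \<subseteq> W2" unfolding W3_def using W1 W2 by auto
  have ob0D: "obx n u0 r0 \<subseteq> D" unfolding D_def using obx_mono[OF r0(2)] obx_sub_cbx by blast
  define Q3 where "Q3 = patch x (obx n u0 r0) W3"
  have Q3: "openin M Q3" "z \<in> Q3" unfolding Q3_def using ob_open[OF r0(2) W3(1,2)] z_patch[OF r0(1) W3(3)] by auto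
  have Q3\<Omega>2: "Q3 \<subseteq> \<Omega>2"
    unfolding Q3_def using P2 patch_mono[OF _ W3(5)] obx_mono[OF r0(3)] obx_sub_cbx by (metis order_trans)
  obtain R3 where R3: "openin N R3" "\<And>y. y \<in> topspace M \<Longrightarrow> f y \<in> R3 \<longleftrightarrow> y \<in> Q3" using f_open[OF Q3(1)] by blast
  have "openin (top_of_set (Esp ?m)) (\<psi> ` (\<Gamma>1 \<inter> R3))" using \<psi>open \<Gamma>1 R3(1) by blast
  moreover have "p \<in> \<psi> ` (\<Gamma>1 \<inter> R3)" unfolding p_def using \<Gamma>1(2) R3(2)[OF zM] Q3(2) by blast
  ultimately obtain s where s: "0 < s" "cbx ?m p s \<subseteq> \<psi> ` (\<Gamma>1 \<inter> R3)" using cbx_nbhd by blast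
  \<comment> \<open>The smallest of the three cubes, entered by the image of \<open>M\<close> only
    from the small patch \<open>Q3\<close>.\<close>
  define \<rho>0 where "\<rho>0 = min s \<rho>"
  have \<rho>0: "0 < \<rho>0" "\<rho>0 \<le> \<rho>" "\<rho>0 \<le> s" unfolding \<rho>0_def using s(1) \<rho>(1) by auto
  have pull3: "y \<in> Q3" if "y \<in> topspace M" "f y \<in> W" "\<psi> (f y) \<in> obx ?m p \<rho>0" for y
    using pull[OF R3(2) that(1,2)] that(3) s(2) obx_mono[OF \<rho>0(3), of ?m p] obx_sub_cbx by blast
  \<comment> \<open>All plaques near \<open>z\<close> parametrised in ambient coordinates: for
    \<open>w0\<close> this is the disc \<open>g\<close> of \<open>stable_separation\<close>, for
    nearby \<open>w\<close> its perturbation \<open>g'\<close>.\<close>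
  define H where "H q = \<psi> (f (chart_inv x q))" for q
  have DW: "D \<times> W1 \<subseteq> cube n \<times> T x" using Dc W1(3) by blast
  have ci: "chart_inv x q \<in> \<Omega>1" if "q \<in> D \<times> W1" for q
    using P1 patch_eq_image[OF x Dc W1(3)] that unfolding D_def by blast
  have ciM: "chart_inv x q \<in> topspace M" "f (chart_inv x q) \<in> W" if "q \<in> D \<times> W1" for q
    using ci[OF that] \<Gamma>1(3) unfolding \<Omega>1_def by auto
  have HV: "H q \<in> V" if "q \<in> D \<times> W1" for q unfolding H_def using \<psi>V ciM[OF that] by blast
  have H_inj: "inj_on H (D \<times> W1)"
  proof (rule inj_onI)
    fix a b assume ab: "a \<in> D \<times> W1" "b \<in> D \<times> W1" "H a = H b"
    have "f (chart_inv x a) = f (chart_inv x b)"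
      using ab(3) \<psi>l[OF ciM(2)[OF ab(1)]] \<psi>l[OF ciM(2)[OF ab(2)]] unfolding H_def by metis
    then have "chart_inv x a = chart_inv x b" using f_inj ciM(1)[OF ab(1)] ciM(1)[OF ab(2)] unfolding inj_on_def by blast
    have "\<phi> x (chart_inv x a) = a" using chart_inv_right[OF x subsetD[OF DW ab(1)]] .
    moreover have "\<phi> x (chart_inv x b) = b" using chart_inv_right[OF x subsetD[OF DW ab(2)]] .
    ultimately show "a = b" using \<open>chart_inv x a = chart_inv x b\<close> by argo
  qed
  let ?P = "prod_topology (top_of_set D) (subtopology X W1)"
  have cH: "continuous_map ?P (top_of_set V) H"
  proof -
    have e: "?P = subtopology (chart_space x) (D \<times> W1)"
      by (simp only: subtopology_Times subtopology_subtopology Int_absorb1[OF Dc] Int_absorb1[OF W1(3)])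
    have "continuous_map ?P M (chart_inv x)"
      unfolding e by (rule continuous_map_from_subtopology[OF continuous_chart_inv[OF x]])
    then have "continuous_map ?P N (f \<circ> chart_inv x)" using f_cont by (rule continuous_map_compose)
    moreover have "(f \<circ> chart_inv x) ` topspace ?P \<subseteq> W"
      using ciM(2) by (auto simp: topspace_prod_topology)
    ultimately have "continuous_map ?P (subtopology N W) (f \<circ> chart_inv x)"
      by (auto simp: continuous_map_in_subtopology)
    then have "continuous_map ?P (top_of_set V) (\<psi> \<circ> (f \<circ> chart_inv x))" using c\<psi> by (rule continuous_map_compose)
    then show ?thesis unfolding H_def o_def .
  qed
  have W1X: "W1 \<subseteq> topspace X" using openin_subset[OF W1(1)] .
  have cHw: "continuous_on D (\<lambda>u. H (u, w))" if w: "w \<in> W1" for w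
  proof -
    have "continuous_map (top_of_set D) ?P (\<lambda>u. (u, w))"
      using w W1X by (auto simp: continuous_map_pairwise o_def)
    then have "continuous_map (top_of_set D) (top_of_set V) (H \<circ> (\<lambda>u. (u, w)))" using cH by (rule continuous_map_compose)
    then show ?thesis by (auto simp: o_def continuous_map_in_subtopology)
  qed
  have Hw_inj: "inj_on (\<lambda>u. H (u, w)) D" if "w \<in> W1" for w
    using H_inj that unfolding inj_on_def by (metis Pair_inject mem_Sigma_iff)
  have Hw_E: "(\<lambda>u. H (u, w)) ` D \<subseteq> Esp ?m" if "w \<in> W1" for w
    using HV VE that by blast
  have Hp: "H (u0, w0) = p" unfolding H_def p_def zin ..
  have patchD: "u \<in> V'" if "chart_inv x (u, w) \<in> patch x V' W'" "u \<in> D" "w \<in> W1" for u w V' W'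
    using that chart_inv_right[OF x, of "(u, w)"] DW unfolding patch_def by auto
  obtain q1 q2 \<eta> where \<eta>: "0 < \<eta>" and q1: "q1 \<in> obx ?m (H (u0, w0)) \<rho>0" and q2: "q2 \<in> obx ?m (H (u0, w0)) \<rho>0"
    and sep: "\<And>g'. continuous_on D g' \<Longrightarrow> g' ` D \<subseteq> Esp ?m \<Longrightarrow> (\<And>u i. u \<in> D \<Longrightarrow> i < ?m \<Longrightarrow> \<bar>g' u i - H (u, w0) i\<bar> \<le> \<eta>) \<Longrightarrow>
       q1 \<notin> g' ` D \<and> q2 \<notin> g' ` D \<and> \<not> path_component (obx ?m (H (u0, w0)) \<rho> - g' ` D) q1 q2"
  proof (rule stable_separation[OF refl D_def u0E r0(1,2) cHw[OF W1(4)] Hw_inj[OF W1(4)] Hw_E[OF W1(4)] \<rho>0(1,2) \<rho>(2)])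
    fix u assume u: "u \<in> D" "H (u, w0) \<in> cbx ?m (H (u0, w0)) \<rho>'"
    have uw: "(u, w0) \<in> D \<times> W1" using u W1(4) by blast
    have "H (u, w0) \<in> \<psi> ` (\<Gamma>1 \<inter> R1)" using u(2) \<rho>'(2) unfolding Hp by blast
    then have "chart_inv x (u, w0) \<in> Q1"
      using pull[OF R1(2) ciM[OF uw]] unfolding H_def by blast
    then show "u \<in> obx n u0 r" unfolding Q1_def using patchD u(1) W1(4) by blast
  next
    fix u assume u: "u \<in> D" "H (u, w0) \<in> obx ?m (H (u0, w0)) \<rho>0"
    have uw: "(u, w0) \<in> D \<times> W1" using u W1(4) by blast
    have "chart_inv x (u, w0) \<in> Q3"
      by (rule pull3[OF ciM[OF uw]]) (use u(2)[unfolded Hp] in \<open>simp add: H_def\<close>)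
    then show "u \<in> obx n u0 r0" unfolding Q3_def using patchD u(1) W1(4) by blast
  next
    have "H (u, w0) \<in> obx ?m p \<rho>'" if u: "u \<in> obx n u0 r0" for u
    proof -
      have "chart_inv x (u, w0) \<in> Q3"
        unfolding Q3_def using patch_eq_image[OF x _ W3(2), of "obx n u0 r0"] ob0D Dc u W3(3) by blast
      then have "H (u, w0) \<in> obx ?m p \<rho>" using Q3\<Omega>2 unfolding \<Omega>2_def B_def H_def by blast
      then show ?thesis using obx_mono[of \<rho> \<rho>' ?m p] \<rho>(2) by auto
    qed
    then show "(\<lambda>u. H (u, w0)) ` obx n u0 r0 \<subseteq> obx ?m (H (u0, w0)) \<rho>'" unfolding Hp by blast
  qed blast
  note q1 = q1[unfolded Hp] and q2 = q2[unfolded Hp] and sep = sep[unfolded Hp]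
  \<comment> \<open>The pairs at which some coordinate of the plaque of \<open>w\<close> deviates
    from that of \<open>w0\<close> by at least \<open>\<eta>\<close>. Projection along the compact
    \<open>D\<close> is a closed map, so the parameters free of such a deviation form an open
    set.\<close>
  define K where "K = (\<Union>i\<in>{..<?m}. {q \<in> topspace ?P. \<bar>H q i - H (fst q, w0) i\<bar> \<in> {\<eta>..}})"
  have "closedin ?P K"
    unfolding K_def
  proof (rule closedin_Union, simp, safe)
    fix i
    have coord: "continuous_map (top_of_set V) euclideanreal (\<lambda>v. v i)"
      by (simp add: continuous_on_coord)
    have a: "continuous_map ?P euclideanreal (\<lambda>q. H q i)"
      using continuous_map_compose[OF cH coord] by (simp add: o_def)
    have a1: "continuous_map ?P (top_of_set D) fst" by (rule continuous_map_fst)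
    have a2: "continuous_map (top_of_set D) euclideanreal (\<lambda>u. H (u, w0) i)"
      using continuous_on_product_then_coordinatewise[OF cHw[OF W1(4)]] by simp
    have b: "continuous_map ?P euclideanreal (\<lambda>q. H (fst q, w0) i)"
      using continuous_map_compose[OF a1 a2] by (simp add: o_def)
    have "continuous_map ?P euclideanreal (\<lambda>q. \<bar>H q i - H (fst q, w0) i\<bar>)"
      by (intro continuous_map_real_abs continuous_map_diff a b)
    moreover have "closedin euclideanreal {\<eta>..}" by simp
    ultimately show "closedin ?P {q \<in> topspace ?P. \<bar>H q i - H (fst q, w0) i\<bar> \<in> {\<eta>..}}"
      by (rule closedin_continuous_map_preimage)
  qed
  moreover have "compact_space (top_of_set D)" unfolding D_def using compact_cbx by (simp add: compact_space_def compactin_subtopology)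
  ultimately have "closedin (subtopology X W1) (snd ` K)"
    using Abstract_Topological_Spaces.closed_map_snd[of "top_of_set D" "subtopology X W1"] unfolding closed_map_def by blast
  then have "openin (subtopology X W1) (topspace (subtopology X W1) - snd ` K)" by blast
  then have "openin (subtopology X W1) (W1 - snd ` K)" using W1X by (simp add: Int_absorb1)
  then have W4: "openin X (W1 - snd ` K)" using openin_trans_full W1(1) by blast
  have w04: "w0 \<in> W1 - snd ` K"
    using W1(4) \<eta> by (auto simp: K_def)
  have close: "\<bar>H (u, w) i - H (u, w0) i\<bar> \<le> \<eta>" if "w \<in> W1 - snd ` K" "u \<in> D" "i < ?m" for u w i
  proof (rule ccontr)
    assume "\<not> ?thesis"
    then have "(u, w) \<in> K" unfolding K_def using that W1X by (auto intro!: bexI[of _ i])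
    then show False using that(1) by force
  qed
  obtain W5 where W5: "openin X W5" "compactin X W5" "w0 \<in> W5" "W5 \<subseteq> W3 \<inter> (W1 - snd ` K)"
    using clopen_nbhd[OF x, of "W3 \<inter> (W1 - snd ` K)" w0] W3 W4 w04 by blast
  have W5s: "W5 \<subseteq> W1" "W5 \<subseteq> T x" "W5 \<subseteq> W3" using W5(4) W3(2) by auto
  define R where "R = patch x (obx n u0 r0) W5"
  have obC: "obx n u0 r0 \<subseteq> open_cube n" "obx n u0 r0 \<subseteq> cube n" using ob0D Dc D1 unfolding D_def by auto
  have RQ3: "R \<subseteq> Q3" unfolding R_def Q3_def using patch_mono[OF subset_refl W5s(3)] .
  have Ro: "openin M R" unfolding R_def using ob_open[OF r0(2) W5(1) W5s(2)] .
  have zR: "z \<in> R" unfolding R_def using z_patch[OF r0(1) W5(3)] .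
  have RU: "R \<subseteq> U x" unfolding R_def by (rule patch_sub_U[OF x obC(1) W5(1) W5s(2)])
  have Q3\<Omega>: "Q3 \<subseteq> \<Omega>" 
    using Q3\<Omega>2 P1 patch_mono[of "obx n u0 r" "cbx n u0 r" W1 W1] obx_sub_cbx unfolding \<Omega>2_def Q1_def \<Omega>1_def by blast
  have fRB: "f ` R \<subseteq> B" using RQ3 Q3\<Omega>2 unfolding \<Omega>2_def by blast
  have projR: "w \<in> W5" if "w \<in> proj x ` R" for w
    using that unfolding R_def patch_def proj_def by auto
  have plaqueR: "plaque x w \<inter> R = patch x (obx n u0 r0) {w}" if "w \<in> W5" for w
    using that obC(2) unfolding plaque_eq_patch[OF x] R_def patch_def by auto
  have pcR: "path_connectedin M (plaque x w \<inter> R)" if "w \<in> proj x ` R" for w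
  proof -
    have "path_connected (obx n u0 r0)" unfolding path_connected_component using obx_path_component by blast
    then show ?thesis
      unfolding plaqueR[OF projR[OF that]] by (rule path_connectedin_patch[OF x _ obC(2)]) (use projR[OF that] W5s in blast)
  qed
  \<comment> \<open>Boxes are convex, so the segment stays in the smallest cube and its image
    \<open>c\<close> meets plaques only within \<open>R\<close>.\<close>
  define seg where "seg t = (\<lambda>i. (1 - t) * q1 i + t * q2 i)" for t :: real
  have seg: "seg t \<in> obx ?m p \<rho>0" if "t \<in> {0..1}" for t
    unfolding seg_def using obx_segment[OF q1 q2] that by simp
  have obx0V: "obx ?m p \<rho>0 \<subseteq> V" "obx ?m p \<rho>0 \<subseteq> obx ?m p \<rho>" using obx_mono[OF \<rho>0(2)] obV by blast+
  define c where "c = \<psi>' \<circ> seg"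
  have cW: "c t \<in> W" "\<psi> (c t) = seg t" if "t \<in> {0..1}" for t
    unfolding c_def using \<psi>'W \<psi>r seg[OF that] obx0V by auto
  have hitsQ3: "y \<in> R" if y: "y \<in> plaque x w" "w \<in> W5" "f y = c t" "t \<in> {0..1}" for y w t
  proof -
    have yM: "y \<in> topspace M" using y(1) Cl_sub unfolding plaque_def by blast
    have "y \<in> Q3" using pull3[OF yM] y(3) cW[OF y(4)] seg[OF y(4)] by simp
    then show ?thesis using y(1,2) unfolding Q3_def R_def patch_def plaque_def proj_def by auto
  qed
  have seg01: "seg 0 = q1" "seg 1 = q2" unfolding seg_def by auto
  have sepw: "q1 \<notin> (\<lambda>u. H (u, w)) ` D" "q2 \<notin> (\<lambda>u. H (u, w)) ` D"
     "\<not> path_component (obx ?m p \<rho> - (\<lambda>u. H (u, w)) ` D) q1 q2" if w: "w \<in> W5" for w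
  proof -
    have w1: "w \<in> W1" "w \<in> W1 - snd ` K" using w W5(4) by auto
    have "q1 \<notin> (\<lambda>u. H (u, w)) ` D \<and> q2 \<notin> (\<lambda>u. H (u, w)) ` D \<and> \<not> path_component (obx ?m p \<rho> - (\<lambda>u. H (u, w)) ` D) q1 q2"
      by (rule sep[OF cHw[OF w1(1)] Hw_E[OF w1(1)] close[OF w1(2)]])
    then show "q1 \<notin> (\<lambda>u. H (u, w)) ` D" "q2 \<notin> (\<lambda>u. H (u, w)) ` D"
     "\<not> path_component (obx ?m p \<rho> - (\<lambda>u. H (u, w)) ` D) q1 q2" by blast+
  qed
  \<comment> \<open>A hit lies in \<open>R\<close>, hence in the part of the plaque over
    \<open>D\<close>, which is the part described by \<open>H\<close>.\<close>
  have endw: "c t \<notin> f ` plaque x w" if w: "w \<in> W5" and t: "t \<in> {0..1}" and nq: "seg t \<notin> (\<lambda>u. H (u, w)) ` D" for w t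
  proof
    assume "c t \<in> f ` plaque x w"
    then obtain y where y: "y \<in> plaque x w" "c t = f y" by blast
    have "y \<in> plaque x w \<inter> R" using hitsQ3[OF y(1) w _ t] y by simp
    then have "y \<in> chart_inv x ` (obx n u0 r0 \<times> {w})"
      unfolding plaqueR[OF w] using patch_eq_image[OF x obC(2), of "{w}"] w W5s(2) by blast
    then obtain u where "u \<in> obx n u0 r0" "y = chart_inv x (u, w)" by blast
    then have "u \<in> D" "seg t = H (u, w)" using ob0D cW(2)[OF t] y(2) unfolding H_def by auto
    then show False using nq by blast
  qed
  have "crossing N B c (proj x ` R) (\<lambda>w. f ` plaque x w) (\<lambda>w. f ` (plaque x w \<inter> R))"
  proof
    show "openin N B" by (rule Bopen)
    have "continuous_on {0..1} seg" unfolding seg_def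
      by (intro continuous_on_coordinatewise_then_product continuous_intros)
    moreover have "seg ` {0..1} \<subseteq> V" using seg obx0V by blast
    ultimately have "continuous_map (top_of_set {0..1}) (top_of_set V) seg"
      by (simp add: image_subset_iff_funcset)
    then have "continuous_map (top_of_set {0..1}) (subtopology N W) c"
      unfolding c_def using c\<psi>' by (rule continuous_map_compose)
    then have "continuous_map (top_of_set {0..1}) N c" using continuous_map_in_subtopology by blast
    moreover have "c t \<in> B" if "t \<in> {0..1}" for t
      using cW[OF that] seg[OF that] obx0V(2) unfolding B_def by auto
    ultimately show "pathin (subtopology N B) c"
      unfolding pathin_def continuous_map_in_subtopology by auto
  next
    fix w assume w: "w \<in> proj x ` R"
    note w5 = projR[OF w]
    show "closedin N (f ` plaque x w)"
      using compactin_imp_closedin[OF N_Hausdorff image_compactin[OF compactin_plaque[OF x] f_cont]] w5 W5s(2) by blast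
    show "c 0 \<notin> f ` plaque x w \<and> c 1 \<notin> f ` plaque x w"
      using endw[OF w5] sepw[OF w5] seg01 by auto
    show "\<not> path_component_of (subtopology N (B - f ` plaque x w)) (c 0) (c 1)"
    proof
      assume "path_component_of (subtopology N (B - f ` plaque x w)) (c 0) (c 1)"
      then obtain g where g: "pathin (subtopology N (B - f ` plaque x w)) g" "g 0 = c 0" "g 1 = c 1"
        unfolding path_component_of_def by blast
      have gB: "g t \<in> B - f ` plaque x w" if "t \<in> {0..1}" for t
        using g(1) that unfolding pathin_def continuous_map_in_subtopology by auto
      have "continuous_map (top_of_set {0..1}) (subtopology N W) g"
        using g(1) gB unfolding pathin_def continuous_map_in_subtopology B_def by auto
      then have "continuous_map (top_of_set {0..1}) (top_of_set V) (\<psi> \<circ> g)" using c\<psi> by (rule continuous_map_compose)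
      then have 1: "path (\<psi> \<circ> g)" unfolding path_def by (simp add: continuous_map_in_subtopology)
      \<comment> \<open>A path off the whole plaque also avoids its part over \<open>D\<close>, and
        that part already separates \<open>q1\<close> from \<open>q2\<close>.\<close>
      have 2: "path_image (\<psi> \<circ> g) \<subseteq> obx ?m p \<rho> - (\<lambda>u. H (u, w)) ` D"
      proof
        fix v assume "v \<in> path_image (\<psi> \<circ> g)"
        then obtain t where t: "t \<in> {0..1}" "v = \<psi> (g t)" unfolding path_image_def by auto
        have gt: "g t \<in> W" "\<psi> (g t) \<in> obx ?m p \<rho>" "g t \<notin> f ` plaque x w" using gB[OF t(1)] unfolding B_def by auto
        have "\<psi> (g t) \<noteq> H (u, w)" if u: "u \<in> D" for u
        proof
          assume e: "\<psi> (g t) = H (u, w)"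
          have uw: "(u, w) \<in> D \<times> W1" using u w5 W5s(1) by blast
          have "g t = f (chart_inv x (u, w))"
            using e \<psi>l[OF gt(1)] \<psi>l[OF ciM(2)[OF uw]] unfolding H_def by metis
          moreover have "chart_inv x (u, w) \<in> plaque x w"
            using uw DW chart_inv_mem[OF x, of "(u,w)"] chart_inv_right[OF x, of "(u,w)"]
            unfolding plaque_def proj_def by auto
          ultimately show False using gt(3) by blast
        qed
        then have "v \<notin> (\<lambda>u. H (u, w)) ` D" unfolding t(2) image_iff by metis
        then show "v \<in> obx ?m p \<rho> - (\<lambda>u. H (u, w)) ` D" using gt(2) unfolding t(2) by (rule DiffI[rotated])
      qed
      have "path_component (obx ?m p \<rho> - (\<lambda>u. H (u, w)) ` D) q1 q2"
        unfolding path_component_def pathstart_def pathfinish_def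
        using 1 2 g(2,3) cW(2)[of 0] cW(2)[of 1] seg01 by (intro exI[of _ "\<psi> \<circ> g"]) simp
      then show False using sepw(3)[OF w5] by blast
    qed
    show "f ` (plaque x w \<inter> R) \<subseteq> f ` plaque x w \<inter> B" using fRB by blast
    show "c t \<in> f ` (plaque x w \<inter> R)" if t: "t \<in> {0..1}" "c t \<in> f ` plaque x w" for t
    proof -
      obtain y where y: "c t = f y" "y \<in> plaque x w" using t(2) by (rule imageE)
      then have "y \<in> R" using hitsQ3[OF y(2) w5 _ t(1)] by simp
      then show ?thesis using y by simp
    qed
    show "path_connectedin N (f ` (plaque x w \<inter> R))"
      using path_connectedin_continuous_map_image[OF f_cont pcR[OF w]] .
    fix w' assume w': "w' \<in> proj x ` R" "w \<noteq> w'"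
    have "plaque x w \<inter> plaque x w' = {}" using w'(2) unfolding plaque_def by blast
    moreover have "plaque x w \<subseteq> topspace M" "plaque x w' \<subseteq> topspace M" using Cl_sub unfolding plaque_def by auto
    ultimately show "f ` plaque x w \<inter> f ` plaque x w' = {}"
      using inj_on_image_Int[OF f_inj] by (metis image_empty)
  qed
  \<comment> \<open>The points over the centre \<open>u0\<close> form the transversal; it is compact
    because \<open>W5\<close> is.\<close>
  moreover have "\<exists>Z. compactin M Z \<and> Z \<subseteq> R \<and> (\<forall>y\<in>R. \<exists>z\<in>Z. proj x z = proj x y)"
  proof (intro exI[of _ "patch x {u0} W5"] conjI ballI)
    have u0c: "{u0} \<subseteq> obx n u0 r0" "{u0} \<subseteq> cube n" using u0ob[OF r0(1)] obC by auto
    show "compactin M (patch x {u0} W5)" by (rule compactin_patch[OF x _ u0c(2) W5(2) W5s(2)]) simp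
    show "patch x {u0} W5 \<subseteq> R" unfolding R_def by (rule patch_mono[OF u0c(1) subset_refl])
    fix y assume "y \<in> R"
    then have w: "proj x y \<in> W5" using projR by blast
    have q: "(u0, proj x y) \<in> cube n \<times> T x" using u0c(2) w W5s(2) by blast
    have "chart_inv x (u0, proj x y) \<in> patch x {u0} W5"
      using chart_inv_mem[OF x q] chart_inv_right[OF x q] w unfolding patch_def by simp
    moreover have "proj x (chart_inv x (u0, proj x y)) = proj x y" using chart_inv_right[OF x q] unfolding proj_def by simp
    ultimately show "\<exists>z\<in>patch x {u0} W5. proj x z = proj x y" by blast
  qed
  ultimately have "good_box x R B c" unfolding good_box_def using x Ro RU fRB pcR by blast
  then show ?thesis using that zR RQ3 Q3\<Omega> B\<Gamma> by blast
qed

end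

section \<open>Countable bases, minima on compact sets, and transfer of betweenness\<close>

lemma (in Metric_space) compact_imp_second_countable:
  assumes "compact_space mtopology"
  shows "second_countable mtopology"
proof -
  have "mtotally_bounded M" using assms compact_space_eq_mcomplete_mtotally_bounded by auto
  then have "\<forall>k. \<exists>A. finite A \<and> A \<subseteq> M \<and> M \<subseteq> (\<Union>a\<in>A. mball a (1 / real (Suc k)))"
    unfolding mtotally_bounded_def by simp
  then obtain A where A: "\<And>k. finite (A k)" "\<And>k. A k \<subseteq> M" "\<And>k. M \<subseteq> (\<Union>a\<in>A k. mball a (1 / real (Suc k)))"
    by metis
  define C where "C = (\<Union>k. (\<lambda>a. mball a (1 / real (Suc k))) ` A k)"
  have "countable C" unfolding C_def using A(1) by (auto intro: countable_finite)
  moreover have "\<forall>V\<in>C. openin mtopology V" unfolding C_def by auto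
  moreover have "\<exists>V\<in>C. x \<in> V \<and> V \<subseteq> G" if G: "openin mtopology G" "x \<in> G" for G x
  proof -
    obtain e where e: "0 < e" "mball x e \<subseteq> G" using G unfolding openin_mtopology by blast
    have xM: "x \<in> M" using G openin_subset by fastforce
    obtain k where k: "1 / real (Suc k) < e / 2" using e(1) nat_approx_posE[of "e/2"] by auto
    obtain a where a: "a \<in> A k" "x \<in> mball a (1 / real (Suc k))" using A(3)[of k] xM by blast
    have "mball a (1 / real (Suc k)) \<subseteq> mball x e"
      by (rule mball_subset) (use a k xM in auto)
    then show ?thesis using a e(2) unfolding C_def by blast
  qed
  ultimately show ?thesis unfolding second_countable_def by blast
qed

text \<open>Without a minimum the open sets above values attained on \<open>K\<close> would cover
  \<open>K\<close>; a finite subcover misses the point with the least of its finitely many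
  values.\<close>

lemma compactin_attains_min:
  fixes h :: "'w \<Rightarrow> real"
  assumes K: "compactin X K" "K \<noteq> {}" "K \<subseteq> W" and o: "\<And>v. v \<in> K \<Longrightarrow> openin X {w \<in> W. h v < h w}"
  obtains b where "b \<in> K" "\<And>v. v \<in> K \<Longrightarrow> h b \<le> h v"
proof -
  have "\<exists>b\<in>K. \<forall>v\<in>K. h b \<le> h v"
  proof (rule ccontr)
    assume "\<not> ?thesis"
    then have cov: "\<And>b. b \<in> K \<Longrightarrow> \<exists>v\<in>K. h v < h b" by (meson not_le)
    define C where "C = (\<lambda>v. {w \<in> W. h v < h w}) ` K"
    have "K \<subseteq> \<Union>C" using cov K(3) unfolding C_def by blast
    moreover have "\<forall>S\<in>C. openin X S" unfolding C_def using o by blast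
    ultimately obtain F where F: "finite F" "F \<subseteq> C" "K \<subseteq> \<Union>F" using K(1) unfolding compactin_def by meson
    obtain A where A: "finite A" "A \<subseteq> K" "F = (\<lambda>v. {w \<in> W. h v < h w}) ` A"
      using finite_subset_image[OF F(1) F(2)[unfolded C_def]] by blast
    have ne: "A \<noteq> {}" using F(3) A(3) K(2) by auto
    have "Min (h ` A) \<in> h ` A" using A(1) ne by simp
    then obtain a where a: "a \<in> A" "h a = Min (h ` A)" by auto
    have "a \<in> \<Union>F" using a(1) A(2) F(3) by blast
    then obtain v where "v \<in> A" "h v < h a" unfolding A(3) by blast
    moreover have "Min (h ` A) \<le> h v" using A(1) \<open>v \<in> A\<close> by simp
    ultimately show False using a(2) by simp
  qed
  then show ?thesis using that by blast
qed

text \<open>Of three points with distinct values exactly one lies between the others, so preserving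
  betweenness in one direction already gives the converse.\<close>

lemma btw_transfer:
  assumes eq: "\<And>a b. a \<in> S \<Longrightarrow> b \<in> S \<Longrightarrow> h a = h b \<longleftrightarrow> k a = k b"
    and imp: "\<And>a b c. a \<in> S \<Longrightarrow> b \<in> S \<Longrightarrow> c \<in> S \<Longrightarrow> btw h a b c \<Longrightarrow> btw k a b c"
    and S: "x \<in> S" "y \<in> S" "w \<in> S"
  shows "btw h x y w \<longleftrightarrow> btw k x y w"
proof
  assume b: "btw k x y w"
  have "h x \<noteq> h y" "h w \<noteq> h y" "h x \<noteq> h w" using b eq S unfolding btw_def by (metis less_asym less_irrefl less_trans)+
  moreover have "\<not> btw h y x w" using imp[of y x w] S b unfolding btw_def by force
  moreover have "\<not> btw h x w y" using imp[of x w y] S b unfolding btw_def by force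
  ultimately show "btw h x y w" unfolding btw_def by linarith
qed (rule imp[OF S])

context codim_one_embedding
begin

section \<open>Heights on good boxes: order, sides, gaps and coherence\<close>

definition height :: "'a \<Rightarrow> (real \<Rightarrow> 'b) \<Rightarrow> 'a \<Rightarrow> real" where
  "height x c y = crossing.first_hit c (\<lambda>w. f ` plaque x w) (proj x y)"

lemma good_boxD:
  assumes "good_box x R B c"
  shows "x \<in> topspace M" "openin M R" "R \<subseteq> U x" "f ` R \<subseteq> B" "R \<subseteq> topspace M" "R \<subseteq> Cl x"
    "crossing N B c (proj x ` R) (\<lambda>w. f ` plaque x w) (\<lambda>w. f ` (plaque x w \<inter> R))"
    "\<And>w. w \<in> proj x ` R \<Longrightarrow> path_connectedin M (plaque x w \<inter> R)"
    "\<exists>Z. compactin M Z \<and> Z \<subseteq> R \<and> (\<forall>y\<in>R. \<exists>z\<in>Z. proj x z = proj x y)"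
    "openin N B"
proof -
  note g = assms[unfolded good_box_def]
  show 1: "x \<in> topspace M" "openin M R" "R \<subseteq> U x" "f ` R \<subseteq> B"
    "\<And>w. w \<in> proj x ` R \<Longrightarrow> path_connectedin M (plaque x w \<inter> R)"
    "\<exists>Z. compactin M Z \<and> Z \<subseteq> R \<and> (\<forall>y\<in>R. \<exists>z\<in>Z. proj x z = proj x y)"
    "crossing N B c (proj x ` R) (\<lambda>w. f ` plaque x w) (\<lambda>w. f ` (plaque x w \<inter> R))"
    using g by auto
  show "R \<subseteq> topspace M" using openin_subset[OF 1(2)] .
  show "R \<subseteq> Cl x" using 1(3) U_sub[OF 1(1)] by blast
  show "openin N B" using 1(7) unfolding crossing_def by blast
qed

lemma chart_fst_mem_obx:
  assumes "x \<in> topspace M" "z \<in> Cl x" "0 < r"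
  shows "fst (\<phi> x z) \<in> obx n (fst (\<phi> x z)) r"
proof -
  have "fst (\<phi> x z) \<in> cube n" using chart_mem[OF assms(1,2)] by (simp add: mem_Times_iff)
  then have "fst (\<phi> x z) \<in> Esp n" using cube_sub_Esp by blast
  then show ?thesis using assms(3) unfolding obx_def by simp
qed

lemma mem_plaque: "y \<in> Cl x \<Longrightarrow> y \<in> plaque x w \<longleftrightarrow> proj x y = w"
  unfolding plaque_def by blast

lemma height_eq_iff:
  assumes g: "good_box x R B c" and yv: "y \<in> R" "v \<in> R"
  shows "height x c y = height x c v \<longleftrightarrow> proj x y = proj x v"
  unfolding height_def using crossing.first_hit_inj[OF good_boxD(7)[OF g]] yv by blast

lemma f_mem_core:
  assumes g: "good_box x R B c" and y: "y \<in> R"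
  shows "f y \<in> f ` (plaque x (proj x y) \<inter> R)"
  using mem_plaque good_boxD(6)[OF g] y by blast

lemma btw_height_iff:
  assumes g: "good_box x R B c" and m: "y \<in> R" "v \<in> R" "w \<in> R"
  shows "btw (height x c) y v w \<longleftrightarrow> proj x y \<noteq> proj x v \<and> proj x w \<noteq> proj x v \<and>
     \<not> path_component_of (subtopology N (B - f ` plaque x (proj x v))) (f y) (f w)"
  using crossing.btw_first_hit_iff[OF good_boxD(7)[OF g] imageI[OF m(1)] imageI[OF m(2)] imageI[OF m(3)]
      f_mem_core[OF g m(1)] f_mem_core[OF g m(3)]]
  unfolding btw_def height_def .

text \<open>Lower and higher plaques are those on the side of \<open>c 0\<close> and of
  \<open>c 1\<close>; path components of open sets of \<open>N\<close> are open, and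
  \<open>f\<close> pulls them back.\<close>

lemma openin_height_sides:
  assumes g: "good_box x R B c" and v: "v \<in> R"
  shows "openin M {y \<in> R. height x c y < height x c v}" "openin M {y \<in> R. height x c v < height x c y}"
proof -
  note cr = good_boxD(7)[OF g]
  note o = crossing.openin_first_hit_sides[OF cr N_locally_path_connected imageI[OF v]]
  note pre = openin_continuous_map_preimage[OF f_cont]
  have "{y \<in> R. height x c y < height x c v} = R \<inter> {y \<in> topspace M. f y \<in> {q. path_component_of (subtopology N (B - f ` plaque x (proj x v))) (c 0) q}}"
    unfolding height_def
    using crossing.first_hit_less_iff[OF cr imageI imageI[OF v] f_mem_core[OF g]] good_boxD(5)[OF g] by auto
  then show "openin M {y \<in> R. height x c y < height x c v}"
    using openin_Int[OF good_boxD(2)[OF g] pre[OF o(1)]] by simp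
  have "{y \<in> R. height x c v < height x c y} = R \<inter> {y \<in> topspace M. f y \<in> {q. path_component_of (subtopology N (B - f ` plaque x (proj x v))) (c 1) q}}"
    unfolding height_def
    using crossing.first_hit_greater_iff[OF cr imageI imageI[OF v] f_mem_core[OF g]] good_boxD(5)[OF g] by auto
  then show "openin M {y \<in> R. height x c v < height x c y}"
    using openin_Int[OF good_boxD(2)[OF g] pre[OF o(2)]] by simp
qed

lemma height_const_on_connected:
  assumes g: "good_box x R B c" and S: "connectedin M S" "S \<subseteq> R" "y \<in> S" "v \<in> S"
  shows "height x c y = height x c v"
  unfolding height_def
  using proj_const_on_connected[OF transversal_totally_disconnected good_boxD(1)[OF g] S(1) _ S(3,4)]
    good_boxD(1,6)[OF g] S(2) by simp

lemma good_box_transversal: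
  assumes g: "good_box x R B c"
  shows "\<exists>Z. compactin M Z \<and> Z \<subseteq> R \<and> (\<forall>y\<in>R. \<exists>z\<in>Z. path_component_of M y z)"
proof -
  obtain Z where Z: "compactin M Z" "Z \<subseteq> R" "\<And>y. y \<in> R \<Longrightarrow> \<exists>z\<in>Z. proj x z = proj x y"
    using good_boxD(9)[OF g] by blast
  have "\<exists>z\<in>Z. path_component_of M y z" if y: "y \<in> R" for y
  proof -
    obtain z where z: "z \<in> Z" "proj x z = proj x y" using Z(3)[OF y] by blast
    have "y \<in> plaque x (proj x y) \<inter> R" "z \<in> plaque x (proj x y) \<inter> R"
      using mem_plaque good_boxD(6)[OF g] y z Z(2) by blast+
    then have "path_component_of M y z"
      using good_boxD(8)[OF g imageI[OF y]] unfolding path_connectedin path_component_of_def by blast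
    then show ?thesis using z(1) by blast
  qed
  then show ?thesis using Z by blast
qed

text \<open>Among the points of a compact totally disconnected transversal, an adjacent pair is found
  at the boundary between two complementary clopen parts.\<close>

lemma height_gap:
  assumes g: "good_box x R B c" and Q: "openin M Q" "Q \<noteq> {}" "Q \<subseteq> R"
    and nf: "\<And>Q. openin M Q \<Longrightarrow> Q \<noteq> {} \<Longrightarrow> Q \<subseteq> U x \<Longrightarrow> \<exists>y\<in>Q. \<exists>z\<in>Q. proj x y \<noteq> proj x z"
  shows "\<exists>a\<in>Q. \<exists>b\<in>Q. \<exists>V. openin M V \<and> a \<in> V \<and> height x c a < height x c b \<and>
     (\<forall>v\<in>V. \<not> (height x c a < height x c v \<and> height x c v < height x c b))"
proof -
  note x = good_boxD(1)[OF g]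
  obtain z where z: "z \<in> Q" using Q(2) by blast
  have zU: "z \<in> U x" using z Q(3) good_boxD(3)[OF g] by blast
  have zC: "z \<in> Cl x" using zU U_sub[OF x] by blast
  define u0 where "u0 = fst (\<phi> x z)"
  obtain r W where r: "0 < r" and W: "openin X W" "compactin X W" "W \<subseteq> T x" "snd (\<phi> x z) \<in> W"
    and D: "cbx n u0 r \<subseteq> open_cube n" and P: "patch x (cbx n u0 r) W \<subseteq> Q"
    unfolding u0_def by (rule patch_nbhd[OF x zU z Q(1)]) blast
  have u0: "u0 \<in> obx n u0 r" unfolding u0_def by (rule chart_fst_mem_obx[OF x zC r])
  have obD: "obx n u0 r \<subseteq> open_cube n" "obx n u0 r \<subseteq> cube n" "u0 \<in> cube n"
    using D obx_sub_cbx[of n u0 r] open_cube_sub[of n] u0 by blast+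
  define V where "V = patch x (obx n u0 r) W"
  have V: "openin M V" "V \<subseteq> Q"
    unfolding V_def using openin_patch[OF x openin_obx obD(1) W(1,3)] P patch_mono[OF obx_sub_cbx subset_refl] by blast+
  \<comment> \<open>A section over the centre \<open>u0\<close> carries the heights to the compact
    transverse factor \<open>W\<close>.\<close>
  define s where "s w = chart_inv x (u0, w)" for w
  have uw: "(u0, w) \<in> cube n \<times> T x" if "w \<in> W" for w using obD(3) W(3) that by blast
  have sV: "s w \<in> V" and ps: "proj x (s w) = w" if "w \<in> W" for w
    using chart_inv_mem[OF x uw[OF that]] chart_inv_right[OF x uw[OF that]] u0 that
    unfolding V_def patch_def s_def proj_def by auto
  have pV: "proj x v \<in> W" if "v \<in> V" for v using that unfolding V_def patch_def proj_def by auto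
  have sR: "s w \<in> R" if "w \<in> W" for w using sV[OF that] V(2) Q(3) by blast
  define h where "h w = height x c (s w)" for w
  have hV: "height x c v = h (proj x v)" if "v \<in> V" for v
    unfolding h_def height_def ps[OF pV[OF that]] ..
  have h_inj: "w = w'" if "w \<in> W" "w' \<in> W" "h w = h w'" for w w'
    using height_eq_iff[OF g sR[OF that(1)] sR[OF that(2)]] that ps unfolding h_def by metis
  have WX: "W \<subseteq> topspace X" using openin_subset[OF W(1)] .
  have cs: "continuous_map (subtopology X W) M s"
  proof -
    have "continuous_map (subtopology X W) (chart_space x) (\<lambda>w. (u0, w))"
      using obD(3) W(3) by (auto simp: continuous_map_pairwise o_def continuous_map_in_subtopology)
    then have "continuous_map (subtopology X W) M (chart_inv x \<circ> (\<lambda>w. (u0, w)))"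
      using continuous_chart_inv[OF x] by (rule continuous_map_compose)
    moreover have "chart_inv x \<circ> (\<lambda>w. (u0, w)) = s" by (auto simp: s_def)
    ultimately show ?thesis by simp
  qed
  have sides: "openin X {w \<in> W. h v < h w}" "openin X {w \<in> W. h w < h v}" if v: "v \<in> W" for v
  proof -
    have "openin X {w \<in> W. s w \<in> G}" if "openin M G" for G
    proof -
      have "openin (subtopology X W) {w \<in> topspace (subtopology X W). s w \<in> G}"
        by (rule openin_continuous_map_preimage[OF cs that])
      then have "openin (subtopology X W) {w \<in> W. s w \<in> G}" using WX by (simp add: Int_absorb1)
      then show ?thesis using openin_trans_full W(1) by blast
    qed
    from this[OF openin_height_sides(2)[OF g sR[OF v]]] this[OF openin_height_sides(1)[OF g sR[OF v]]]
    show "openin X {w \<in> W. h v < h w}" "openin X {w \<in> W. h w < h v}"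
      unfolding h_def using sR by (simp_all cong: conj_cong)
  qed
  have "V \<noteq> {}" using sV[OF W(4)] by blast
  moreover have "V \<subseteq> U x" using V(2) Q(3) good_boxD(3)[OF g] by blast
  ultimately obtain y y' where y: "y \<in> V" "y' \<in> V" "proj x y \<noteq> proj x y'" using nf[OF V(1)] by blast
  have "\<exists>w1\<in>W. \<exists>w2\<in>W. h w1 < h w2"
    using h_inj[OF pV[OF y(1)] pV[OF y(2)]] y(3) pV[OF y(1)] pV[OF y(2)] by (metis linorder_neqE)
  then obtain w1 w2 where w: "w1 \<in> W" "w2 \<in> W" "h w1 < h w2" by blast
  have "closedin X {w2}" using closedin_Hausdorff_singleton[OF X_Hausdorff] w(2) WX by blast
  then have o2: "openin X (W - {w2})" using W(1) by blast
  have m2: "w1 \<in> W - {w2}" "W - {w2} \<subseteq> T x" using w W(3) by auto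
  obtain W' where W': "openin X W'" "compactin X W'" "w1 \<in> W'" "W' \<subseteq> W - {w2}"
    by (rule clopen_nbhd[OF x o2 m2])
  have cl: "closedin X W" "closedin X W'" using compactin_imp_closedin[OF X_Hausdorff] W(2) W'(2) by auto
  have W'W: "W' \<subseteq> W" using W'(4) by blast
  \<comment> \<open>\<open>W'\<close> contains \<open>w1\<close> but not \<open>w2\<close>. The pair
    sought consists of \<open>b\<close>, the lowest point outside \<open>W'\<close> of height at
    least \<open>h w1\<close>, and \<open>a\<close>, the highest point of \<open>W'\<close> of
    height at most \<open>h b\<close>.\<close>
  define Y where "Y = W - W' - {w \<in> W. h w < h w1}"
  have cY: "compactin X Y"
    by (rule closed_compactin[OF W(2)]) (use cl W'(1) sides(2)[OF w(1)] in \<open>auto simp: Y_def\<close>)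
  have "w2 \<in> Y" unfolding Y_def using w W'(4) by auto
  then have Yne: "Y \<noteq> {}" by blast
  have YW: "Y \<subseteq> W" unfolding Y_def by blast
  obtain b where b: "b \<in> Y" "\<And>v. v \<in> Y \<Longrightarrow> h b \<le> h v"
    by (rule compactin_attains_min[OF cY Yne YW, of h]) (use sides(1) YW in blast)+
  have bW: "b \<in> W" using b(1) YW by blast
  define Z where "Z = W' - {w \<in> W. h b < h w}"
  have cZ: "compactin X Z"
    by (rule closed_compactin[OF W'(2)]) (use cl sides(1)[OF bW] in \<open>auto simp: Z_def\<close>)
  have w1b: "h w1 \<le> h b" using b(1) bW unfolding Y_def by auto
  then have w1Z: "w1 \<in> Z" unfolding Z_def using W'(3) by auto
  then have Zne: "Z \<noteq> {}" by blast
  have ZW: "Z \<subseteq> W" unfolding Z_def using W'W by blast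
  obtain a where a: "a \<in> Z" "\<And>v. v \<in> Z \<Longrightarrow> - h a \<le> - h v"
    by (rule compactin_attains_min[OF cZ Zne ZW, of "\<lambda>w. - h w"]) (use sides(2) ZW in auto)
  have aW: "a \<in> W" using a(1) ZW by blast
  have "a \<noteq> b" using a(1) b(1) unfolding Y_def Z_def by blast
  moreover have "h a \<le> h b" using a(1) aW unfolding Z_def by auto
  ultimately have ab: "h a < h b" using h_inj[OF aW bW] by linarith
  \<comment> \<open>A parameter strictly between would belong to \<open>Z\<close> and exceed its
    maximum, or to \<open>Y\<close> and undercut its minimum; membership in \<open>Y\<close> uses
    \<open>h w1 \<le> h a\<close>.\<close>
  have gap: "\<not> (h a < h w \<and> h w < h b)" if "w \<in> W" for w
  proof
    assume l: "h a < h w \<and> h w < h b"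
    show False
    proof (cases "w \<in> W'")
      case True
      then have "w \<in> Z" unfolding Z_def using l by auto
      then show False using a(2)[of w] l by linarith
    next
      case False
      then have "w \<in> Y" unfolding Y_def using that a(2)[OF w1Z] l by auto
      then show False using b(2)[of w] l by linarith
    qed
  qed
  have 1: "s a \<in> Q" "s b \<in> Q" "s a \<in> V" using sV aW bW V(2) by auto
  have 2: "height x c (s a) < height x c (s b)" using ab unfolding h_def .
  have 3: "\<forall>v\<in>V. \<not> (height x c (s a) < height x c v \<and> height x c v < height x c (s b))"
    using gap[OF pV] hV unfolding h_def by simp
  show ?thesis
    by (intro bexI[OF _ 1(1)] bexI[OF _ 1(2)] exI[of _ V] conjI V(1) 1(3) 2 3)
qed

text \<open>Both heights are compared with that of a third box in the chart at \<open>x\<close>,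
  small enough to lie in both. A path in the smaller complement is a path in the larger one, so
  being separated passes from a large box to a small one, and \<open>btw_transfer\<close> supplies
  the converse. To compare plaques of different charts, \<open>B1\<close> is kept in an ambient open
  set that meets the image of \<open>M\<close> only in the image of \<open>Q\<close>.\<close>

lemma good_boxes_coherent:
  assumes g: "good_box x R B c" and g': "good_box x' R' B' c'" and z: "z \<in> R" "z \<in> R'"
  shows "\<exists>Q. openin M Q \<and> z \<in> Q \<and> (\<forall>a\<in>Q. \<forall>b\<in>Q. \<forall>e\<in>Q. btw (height x c) a b e \<longleftrightarrow> btw (height x' c') a b e)"
proof -
  note x = good_boxD(1)[OF g] and x' = good_boxD(1)[OF g']
  have zU: "z \<in> U x" "z \<in> U x'" using z good_boxD(3)[OF g] good_boxD(3)[OF g'] by auto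
  have zM: "z \<in> topspace M" using z good_boxD(5)[OF g] by blast
  have RR: "openin M (R \<inter> R')" using good_boxD(2) g g' by blast
  define u0 where "u0 = fst (\<phi> x' z)"
  obtain r W where r: "0 < r" and W: "openin X W" "compactin X W" "W \<subseteq> T x'" "snd (\<phi> x' z) \<in> W"
    and D: "cbx n u0 r \<subseteq> open_cube n" and P: "patch x' (cbx n u0 r) W \<subseteq> R \<inter> R'"
    unfolding u0_def by (rule patch_nbhd[OF x' zU(2) _ RR]) (use z in auto)
  have zC: "z \<in> Cl x'" using zU U_sub[OF x'] by blast
  have u0: "u0 \<in> obx n u0 r" unfolding u0_def by (rule chart_fst_mem_obx[OF x' zC r])
  have obD: "obx n u0 r \<subseteq> open_cube n" "obx n u0 r \<subseteq> cube n"
    using D obx_sub_cbx[of n u0 r] open_cube_sub[of n] by blast+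
  define Q where "Q = patch x' (obx n u0 r) W"
  have Q: "openin M Q" "z \<in> Q" "Q \<subseteq> R \<inter> R'"
  proof -
    show "openin M Q" unfolding Q_def using openin_patch[OF x' openin_obx obD(1) W(1,3)] .
    show "z \<in> Q" unfolding Q_def patch_def using zC u0 W(4) by (auto simp: u0_def mem_Times_iff)
    show "Q \<subseteq> R \<inter> R'" unfolding Q_def using P patch_mono[OF obx_sub_cbx subset_refl] by blast
  qed
  have QC: "Q \<subseteq> Cl x" "Q \<subseteq> Cl x'" using Q(3) good_boxD(6)[OF g] good_boxD(6)[OF g'] by auto
  \<comment> \<open>A slice of \<open>Q\<close> in the chart at \<open>x'\<close> is connected, so
    it lies in one plaque of the chart at \<open>x\<close>.\<close>
  have slice: "proj x y = proj x v" if yv: "y \<in> Q" "v \<in> Q" "proj x' y = proj x' v" for y v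
  proof -
    let ?S = "patch x' (obx n u0 r) {proj x' y}"
    have w: "proj x' y \<in> W" using yv(1) unfolding Q_def patch_def proj_def by auto
    have "path_connected (obx n u0 r)" unfolding path_connected_component using obx_path_component by blast
    then have "path_connectedin M ?S" by (rule path_connectedin_patch[OF x' _ obD(2)]) (use w W(3) in blast)
    then have con: "connectedin M ?S" by (rule path_connectedin_imp_connectedin)
    have "?S \<subseteq> Q" unfolding Q_def using patch_mono[OF subset_refl, of "{proj x' y}" W] w by blast
    then have sub: "?S \<subseteq> Cl x" using QC by blast
    have "y \<in> ?S" "v \<in> ?S" using yv unfolding Q_def patch_def proj_def by (auto simp: mem_Times_iff)
    then show ?thesis by (rule proj_const_on_connected[OF transversal_totally_disconnected[OF x] x con sub])
  qed
  obtain G where G: "openin N G" "\<And>y. y \<in> topspace M \<Longrightarrow> f y \<in> G \<longleftrightarrow> y \<in> Q" using f_open[OF Q(1)] by blast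
  have \<Gamma>: "openin N (B \<inter> B' \<inter> G)" using good_boxD(10)[OF g] good_boxD(10)[OF g'] G(1) by blast
  have fz: "f z \<in> B \<inter> B' \<inter> G" using z good_boxD(4)[OF g] good_boxD(4)[OF g'] G(2)[OF zM] Q(2) by blast
  obtain R1 B1 c1 where g1: "good_box x R1 B1 c1" and zR1: "z \<in> R1" and R1Q: "R1 \<subseteq> Q" and B1: "B1 \<subseteq> B \<inter> B' \<inter> G"
    by (rule good_box_exists[OF x zU(1) Q(1,2) \<Gamma> fz])
  have R1R: "R1 \<subseteq> R" "R1 \<subseteq> R'" using R1Q Q(3) by auto
  have peq: "proj x y = proj x v \<longleftrightarrow> proj x' y = proj x' v" if yv: "y \<in> R1" "v \<in> R1" for y v
  proof
    \<comment> \<open>For the converse the set \<open>Q\<close> is of no help, since it may cut a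
      plaque of the chart at \<open>x\<close> into pieces; within the good box \<open>R1\<close>
      these plaques are connected.\<close>
    assume e: "proj x y = proj x v"
    have pc: "path_connectedin M (plaque x (proj x y) \<inter> R1)" using good_boxD(8)[OF g1] yv(1) by blast
    have "plaque x (proj x y) \<inter> R1 \<subseteq> Cl x'" using R1Q QC by blast
    moreover have "y \<in> plaque x (proj x y) \<inter> R1" "v \<in> plaque x (proj x y) \<inter> R1"
      using yv e mem_plaque good_boxD(6)[OF g1] by auto
    ultimately show "proj x' y = proj x' v"
      using proj_const_on_connected[OF transversal_totally_disconnected[OF x'] x' path_connectedin_imp_connectedin[OF pc]] by blast
  next
    assume "proj x' y = proj x' v"
    then show "proj x y = proj x v" using slice R1Q yv by blast
  qed
  have 1: "btw (height x c) a b e \<longleftrightarrow> btw (height x c1) a b e" if m: "a \<in> R1" "b \<in> R1" "e \<in> R1" for a b e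
  proof (rule btw_transfer[OF _ _ m])
    show "height x c y = height x c v \<longleftrightarrow> height x c1 y = height x c1 v" if "y \<in> R1" "v \<in> R1" for y v
      using height_eq_iff[OF g] height_eq_iff[OF g1] that R1R by blast
    show "btw (height x c1) y v w" if yvw: "y \<in> R1" "v \<in> R1" "w \<in> R1" "btw (height x c) y v w" for y v w
    proof -
      have "B1 - f ` plaque x (proj x v) \<subseteq> B - f ` plaque x (proj x v)" using B1 by blast
      note mono = path_component_of_mono[OF _ this]
      have "y \<in> R" "v \<in> R" "w \<in> R" using yvw(1-3) R1R by auto
      note yvw(4)[unfolded btw_height_iff[OF g this]]
      then show ?thesis
        unfolding btw_height_iff[OF g1 yvw(1-3)] using mono by blast
    qed
  qed
  have 2: "btw (height x' c') a b e \<longleftrightarrow> btw (height x c1) a b e" if m: "a \<in> R1" "b \<in> R1" "e \<in> R1" for a b e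
  proof (rule btw_transfer[OF _ _ m])
    show "height x' c' y = height x' c' v \<longleftrightarrow> height x c1 y = height x c1 v" if "y \<in> R1" "v \<in> R1" for y v
      using height_eq_iff[OF g'] height_eq_iff[OF g1] that R1R peq by blast
    show "btw (height x c1) y v w" if yvw: "y \<in> R1" "v \<in> R1" "w \<in> R1" "btw (height x' c') y v w" for y v w
    proof -
      \<comment> \<open>A plaque of the chart at \<open>x'\<close> meets \<open>B1\<close> only in
        the image of \<open>Q\<close>, where it lies on the matching plaque of the chart at
        \<open>x\<close>; deleting the latter deletes at least as much.\<close>
      have "B1 - f ` plaque x (proj x v) \<subseteq> B' - f ` plaque x' (proj x' v)"
      proof
        fix q assume q: "q \<in> B1 - f ` plaque x (proj x v)"
        have "q \<notin> f ` plaque x' (proj x' v)"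
        proof
          assume "q \<in> f ` plaque x' (proj x' v)"
          then obtain p where p: "q = f p" "p \<in> plaque x' (proj x' v)" by (rule imageE)
          have pM: "p \<in> topspace M" and pp: "proj x' p = proj x' v" using p(2) Cl_sub unfolding plaque_def by auto
          have "p \<in> Q" using G(2)[OF pM] q B1 p(1) by blast
          then have "proj x p = proj x v" using slice R1Q yvw(2) pp by blast
          then have "p \<in> plaque x (proj x v)" using mem_plaque QC \<open>p \<in> Q\<close> by blast
          then show False using q p(1) by blast
        qed
        then show "q \<in> B' - f ` plaque x' (proj x' v)" using q B1 by blast
      qed
      note mono = path_component_of_mono[OF _ this]
      have "y \<in> R'" "v \<in> R'" "w \<in> R'" using yvw(1-3) R1R by auto
      note yvw(4)[unfolded btw_height_iff[OF g' this]]
      then show ?thesis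
        unfolding btw_height_iff[OF g1 yvw(1-3)] peq[OF yvw(1,2)] peq[OF yvw(3,2)] using mono by blast
    qed
  qed
  show ?thesis
    by (intro exI[of _ R1] conjI ballI) (use good_boxD(2)[OF g1] zR1 1 2 in auto)
qed

text \<open>Without open sets inside a single plaque, the first-hit heights of the good boxes would
  form an ordered box atlas.\<close>

lemma homogeneous_imp_flat_open_set:
  assumes hom: "homogeneous_space M"
  obtains x Q where "x \<in> topspace M" "openin M Q" "Q \<noteq> {}" "Q \<subseteq> U x" "\<And>y z. y \<in> Q \<Longrightarrow> z \<in> Q \<Longrightarrow> proj x y = proj x z"
proof -
  have "\<exists>x Q. x \<in> topspace M \<and> openin M Q \<and> Q \<noteq> {} \<and> Q \<subseteq> U x \<and> (\<forall>y\<in>Q. \<forall>z\<in>Q. proj x y = proj x z)"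
  proof (rule ccontr)
    assume "\<not> ?thesis"
    then have nf: "\<exists>y\<in>Q. \<exists>z\<in>Q. proj x y \<noteq> proj x z"
      if "x \<in> topspace M" "openin M Q" "Q \<noteq> {}" "Q \<subseteq> U x" for x Q using that by blast
    obtain S d where "Metric_space S d" and M: "M = Metric_space.mtopology S d"
      using M_metrizable unfolding metrizable_space_def by blast
    interpret MM: Metric_space S d by fact
    define BB where "BB = {(R, h). \<exists>x B c. good_box x R B c \<and> h = height x c}"
    show False
    proof (rule MM.no_ordered_box_atlas[where BB = BB, folded M])
      show "compact_space M" "connected_space M" "homogeneous_space M" using M_compact M_connected hom by auto
      show "S \<noteq> {}" using M_ne M by auto
      fix R h assume "(R, h) \<in> BB"
      then obtain x B c where g: "good_box x R B c" and h: "h = height x c" unfolding BB_def by auto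
      show "openin M R" using good_boxD(2)[OF g] .
      show "h y = h v" if "connectedin M A" "A \<subseteq> R" "y \<in> A" "v \<in> A" for A y v
        unfolding h using height_const_on_connected[OF g that] .
      show "openin M {y \<in> R. h y < h v}" "openin M {y \<in> R. h v < h y}" if "v \<in> R" for v
        unfolding h using openin_height_sides[OF g that] by auto
      show "\<exists>Z. compactin M Z \<and> Z \<subseteq> R \<and> (\<forall>y\<in>R. \<exists>z\<in>Z. path_component_of M y z)"
        using good_box_transversal[OF g] .
      show "\<exists>a\<in>Q. \<exists>b\<in>Q. \<exists>V. openin M V \<and> a \<in> V \<and> h a < h b \<and> (\<forall>v\<in>V. \<not> (h a < h v \<and> h v < h b))"
        if "openin M Q" "Q \<noteq> {}" "Q \<subseteq> R" for Q
        unfolding h using height_gap[OF g that] nf[OF good_boxD(1)[OF g]] by blast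
      show "\<exists>y\<in>Q. \<exists>v\<in>Q. h y \<noteq> h v" if Q: "openin M Q" "Q \<noteq> {}" "Q \<subseteq> R" for Q
      proof -
        obtain y v where "y \<in> Q" "v \<in> Q" "proj x y \<noteq> proj x v"
          using nf[OF good_boxD(1)[OF g] Q(1,2)] Q(3) good_boxD(3)[OF g] by blast
        then show ?thesis unfolding h using height_eq_iff[OF g] Q(3) by blast
      qed
      fix R' h' z assume "(R', h') \<in> BB" and z: "z \<in> R" "z \<in> R'"
      then obtain x' B' c' where g': "good_box x' R' B' c'" and h': "h' = height x' c'" unfolding BB_def by auto
      show "\<exists>Q. openin M Q \<and> z \<in> Q \<and> (\<forall>a\<in>Q. \<forall>b\<in>Q. \<forall>e\<in>Q. btw h a b e \<longleftrightarrow> btw h' a b e)"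
        unfolding h h' using good_boxes_coherent[OF g g' z] .
    next
      fix V z assume V: "openin M V" "z \<in> V"
      then have z: "z \<in> topspace M" using openin_subset by blast
      obtain R B c where "good_box z R B c" "z \<in> R" "R \<subseteq> V" "B \<subseteq> topspace N"
        by (rule good_box_exists[OF z nbhd_mem[OF z] V openin_topspace f_mem[OF z]])
      then show "\<exists>R h. (R, h) \<in> BB \<and> z \<in> R \<and> R \<subseteq> V" unfolding BB_def by blast
    qed
  qed
  then show ?thesis using that by blast
qed

text \<open>Flatness makes the transverse coordinate constant on a patch inside \<open>Q\<close>, so
  the leafwise coordinate alone is a homeomorphism onto an open box.\<close>

lemma flat_open_set_imp_chart:
  assumes x: "x \<in> topspace M" and Q: "openin M Q" "Q \<noteq> {}" "Q \<subseteq> U x"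
    and flat: "\<And>y z. y \<in> Q \<Longrightarrow> z \<in> Q \<Longrightarrow> proj x y = proj x z"
  obtains z G V where "z \<in> G" "openin M G" "openin (Euclidean_space n) V"
    "subtopology M G homeomorphic_space subtopology (Euclidean_space n) V"
proof -
  obtain z where z: "z \<in> Q" using Q(2) by blast
  have zU: "z \<in> U x" and zC: "z \<in> Cl x" using z Q(3) U_sub[OF x] by auto
  define u0 where "u0 = fst (\<phi> x z)"
  define w0 where "w0 = snd (\<phi> x z)"
  obtain r W where r: "0 < r" and W: "openin X W" "compactin X W" "W \<subseteq> T x" "w0 \<in> W"
    and D: "cbx n u0 r \<subseteq> open_cube n" and P: "patch x (cbx n u0 r) W \<subseteq> Q"
    unfolding u0_def w0_def by (rule patch_nbhd[OF x zU z Q(1)]) blast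
  have u0: "u0 \<in> obx n u0 r" unfolding u0_def by (rule chart_fst_mem_obx[OF x zC r])
  define V where "V = obx n u0 r"
  have VD: "V \<subseteq> open_cube n" "V \<subseteq> cube n" "V \<subseteq> Esp n"
    unfolding V_def using D obx_sub_cbx[of n u0 r] open_cube_sub[of n] cube_sub_Esp[of n] by blast+
  define G where "G = patch x V W"
  have GQ: "G \<subseteq> Q" unfolding G_def V_def using P patch_mono[OF obx_sub_cbx subset_refl] by blast
  have zG: "z \<in> G" unfolding G_def patch_def V_def using zC u0 W(4) by (auto simp: u0_def w0_def mem_Times_iff)
  have Go: "openin M G" unfolding G_def by (rule openin_patch[OF x _ VD(1) W(1,3)]) (simp add: V_def openin_obx)
  have w: "snd (\<phi> x y) = w0" if "y \<in> G" for y
    using flat[of y z] that GQ z unfolding proj_def w0_def by blast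
  have GC: "G \<subseteq> Cl x" unfolding G_def patch_def by blast
  have tG: "topspace (subtopology M G) = G" using openin_subset[OF Go] by auto
  have st: "subtopology (top_of_set (Esp n)) V = top_of_set V" using VD(3) by (simp add: subtopology_subtopology Int_absorb1)
  have "homeomorphic_maps (subtopology M G) (top_of_set V) (\<lambda>y. fst (\<phi> x y)) (\<lambda>u. chart_inv x (u, w0))"
    unfolding homeomorphic_maps_def
  proof (intro conjI ballI)
    have "continuous_map (subtopology M (Cl x)) (top_of_set (cube n)) (fst \<circ> \<phi> x)"
      by (rule continuous_map_compose[OF continuous_chart[OF x] continuous_map_fst])
    then have "continuous_map (subtopology M G) (top_of_set (cube n)) (fst \<circ> \<phi> x)"
      by (rule continuous_map_from_subtopology_mono[OF _ GC])
    then show "continuous_map (subtopology M G) (top_of_set V) (\<lambda>y. fst (\<phi> x y))"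
      by (auto simp: continuous_map_in_subtopology o_def G_def patch_def)
    have "continuous_map (top_of_set V) (chart_space x) (\<lambda>u. (u, w0))"
      using VD(2) W(3,4) T_sub[OF x] by (auto simp: continuous_map_pairwise o_def continuous_map_in_subtopology)
    then have "continuous_map (top_of_set V) M (chart_inv x \<circ> (\<lambda>u. (u, w0)))"
      using continuous_chart_inv[OF x] by (rule continuous_map_compose)
    moreover have "chart_inv x (u, w0) \<in> G" if "u \<in> V" for u
    proof -
      have "(u, w0) \<in> cube n \<times> T x" using that VD(2) W(3,4) by blast
      then show ?thesis unfolding G_def patch_def using chart_inv_mem[OF x] chart_inv_right[OF x] that W(4) by auto
    qed
    ultimately show "continuous_map (top_of_set V) (subtopology M G) (\<lambda>u. chart_inv x (u, w0))"
      by (auto simp: continuous_map_in_subtopology o_def)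
    show "chart_inv x (fst (\<phi> x y), w0) = y" if "y \<in> topspace (subtopology M G)" for y
    proof -
      have "y \<in> G" using that tG by simp
      then show ?thesis using w[of y] chart_inv_left[OF x, of y] GC by (metis prod.collapse subsetD)
    qed
    show "fst (\<phi> x (chart_inv x (u, w0))) = u" if "u \<in> topspace (top_of_set V)" for u
    proof -
      have "(u, w0) \<in> cube n \<times> T x" using that VD(2) W(3,4) by auto
      then show ?thesis using chart_inv_right[OF x, of "(u, w0)"] by simp
    qed
  qed
  then have "subtopology M G homeomorphic_space subtopology (Euclidean_space n) V"
    unfolding Euclidean_space_eq_top_of_set st homeomorphic_space_def by blast
  moreover have "openin (Euclidean_space n) V" unfolding Euclidean_space_eq_top_of_set V_def by (rule openin_obx)
  ultimately show ?thesis using that zG Go by blast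
qed

text \<open>The local charts are translates of a single one by homeomorphisms; the Hausdorff and
  countability conditions come from compact metrizability.\<close>

theorem homogeneous_imp_manifold:
  assumes hom: "homogeneous_space M"
  shows "topological_manifold n M"
proof -
  obtain x Q where "x \<in> topspace M" "openin M Q" "Q \<noteq> {}" "Q \<subseteq> U x" "\<And>y z. y \<in> Q \<Longrightarrow> z \<in> Q \<Longrightarrow> proj x y = proj x z"
    using homogeneous_imp_flat_open_set[OF hom] by metis
  then obtain z G V where zG: "z \<in> G" "openin M G" "openin (Euclidean_space n) V"
    and h: "subtopology M G homeomorphic_space subtopology (Euclidean_space n) V"
    using flat_open_set_imp_chart by metis
  have zM: "z \<in> topspace M" using zG openin_subset by blast
  have "\<exists>W V. openin M W \<and> y \<in> W \<and> openin (Euclidean_space n) V \<and>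
        subtopology M W homeomorphic_space subtopology (Euclidean_space n) V" if y: "y \<in> topspace M" for y
  proof -
    obtain k where k: "homeomorphic_map M M k" "k z = y" using hom zM y unfolding homogeneous_space_def by blast
    have o: "openin M (k ` G)" using homeomorphic_map_openness_eq[OF k(1)] zG(2) by metis
    have "homeomorphic_map (subtopology M G) (subtopology M (k ` G)) k"
      by (rule homeomorphic_map_subtopologies[OF k(1)])
        (use openin_subset[OF zG(2)] openin_subset[OF o] in \<open>simp add: Int_absorb1\<close>)
    then have "subtopology M (k ` G) homeomorphic_space subtopology M G"
      using homeomorphic_map_imp_homeomorphic_space homeomorphic_space_sym by blast
    then have "subtopology M (k ` G) homeomorphic_space subtopology (Euclidean_space n) V"
      using h homeomorphic_space_trans by blast
    moreover have "y \<in> k ` G" using k(2) zG(1) by blast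
    ultimately show ?thesis using o zG(3) by blast
  qed
  moreover have "second_countable M"
  proof -
    obtain S d where "Metric_space S d" and M: "M = Metric_space.mtopology S d"
      using M_metrizable unfolding metrizable_space_def by blast
    then show ?thesis using Metric_space.compact_imp_second_countable M_compact by metis
  qed
  ultimately show ?thesis unfolding topological_manifold_def using M_Hausdorff by blast
qed

end

theorem corollary1p3:
  fixes n :: nat
    and M :: "'a topology"
    and X :: "'x topology"
    and T :: "'a \<Rightarrow> 'x set"
    and U :: "'a \<Rightarrow> 'a set"
    and \<phi> :: "'a \<Rightarrow> 'a \<Rightarrow> (nat \<Rightarrow> real) \<times> 'x"
    and N :: "'b topology"
    and f :: "'a \<Rightarrow> 'b"
  assumes "matchbox_manifold n M X T U \<phi>"
    and "homogeneous_space M"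
    and "closed_manifold (n + 1) N"
    and "orientable (n + 1) N"
    and "embedding_map M N f"
  shows "topological_manifold n M"
proof -
  interpret matchbox_manifold n M X T U \<phi> by fact
  interpret codim_one_embedding n M X T U \<phi> N f
    by unfold_locales (use assms(3,5) in \<open>auto simp: closed_manifold_def\<close>)
  show ?thesis using homogeneous_imp_manifold[OF assms(2)] .
qed

end
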